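(* Let $c\ge 0$, $\gamma=c\left(1-\frac1{\sqrt3}\right)$, and let $\varphi$ be an even, $2\pi$-periodic solution of $\mathcal K\varphi=\varphi(c-\frac12\varphi)(c-\varphi)$ that is nondecreasing on $(-\pi,0)$ with $\varphi(0)=\gamma$. Then: (i) $\varphi$ is smooth and strictly increasing on $(-\pi,0)$. (ii) $\varphi\in C^\alpha(\mathbb S)$ for all $\alpha\in(0,1)$, and the $C^\alpha$-estimates are uniform in $\alpha$ over any compact subset of $(0,1)$, and uniform in $\varphi$ for wave speeds $c$ contained in any compact subset of $(0,\infty)$; that is, for all compact $A\subset(0,1)$ and $J\subset(0,\infty)$ there is $M<\infty$ such that $\|\varphi\|_{C^\alpha(\mathbb S)}\le M$ for every $\alpha\in A$ and every such solution $\varphi$ with wave speed $c\in J$. (iii) The estimate $\gamma-\varphi(x)\eqsim|x\log|x||$ holds for all $|x|\ll1$; that is, there are constants $C\ge1$ and $\delta>0$ such that $C^{-1}|x\log|x||\le\gamma-\varphi(x)\le C|x\log|x||$ for all $0<|x|<\delta$.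
   Context: $\mathbb S=\mathbb R/2\pi\mathbb Z$. The operator $\mathcal K$ is the Fourier multiplier with symbol $\tanh(\xi)/\xi$ (value $1$ at $\xi=0$): on a $2\pi$-periodic $f$ it multiplies the $n$-th Fourier coefficient by $\tanh(n)/n$. A solution with wave speed $c$ is a continuous $2\pi$-periodic real function satisfying the equation pointwise. The number $\gamma$ is the smallest critical point of $N(\varphi)=\varphi(c-\frac12\varphi)(c-\varphi)$ for $c>0$. $C^\alpha(\mathbb S)$, $0<\alpha<1$, is the space of $2\pi$-periodic $\alpha$-Hölder continuous functions with $\|u\|_{C^\alpha(\mathbb S)}=\sup_{x\ne y}|u(x)-u(y)|/|x-y|^\alpha$.
   Formalization: Parts (i) and (iii) are asserted only for nonconstant φ: the constants φ=γ with c²=6/(1+√3), and φ=0 with c=0, meet every hypothesis but are not strictly increasing and have γ−φ=0. Part (ii) is kept for all solutions. *)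

theory Defs
  imports "HOL-Analysis.Analysis"
begin

text \<open>
  Functions on the circle \<open>\<real>/2\<pi>\<int>\<close> are represented by \<open>2\<pi>\<close>-periodic functions on the real line.
\<close>

definition circle_periodic :: "(real \<Rightarrow> 'a) \<Rightarrow> bool" where
  "circle_periodic f \<longleftrightarrow> (\<forall>x. f (x + 2 * pi) = f x)"

definition fourier_coeff :: "(real \<Rightarrow> complex) \<Rightarrow> int \<Rightarrow> complex" where
  "fourier_coeff f n =
     complex_of_real (1 / (2 * pi)) * integral {-pi..pi} (\<lambda>x. f x * cis (- (real_of_int n * x)))"

definition tanh_symbol :: "real \<Rightarrow> real" where
  "tanh_symbol \<xi> = (if \<xi> = 0 then 1 else tanh \<xi> / \<xi>)"

text \<open>
  For continuous periodic \<open>f\<close> the Fourier coefficients are square summable, and so is the symbol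
  on the integers; hence the series below converges absolutely for every \<open>x\<close>, and its sum is the
  continuous periodic function with Fourier coefficients \<open>tanh_symbol n * fourier_coeff f n\<close>.
\<close>

definition K_op :: "(real \<Rightarrow> complex) \<Rightarrow> real \<Rightarrow> complex" where
  "K_op f x =
     (\<Sum>\<^sub>\<infinity>n::int. complex_of_real (tanh_symbol (real_of_int n)) * fourier_coeff f n
                    * cis (real_of_int n * x))"

definition N_nonlin :: "real \<Rightarrow> real \<Rightarrow> real" where
  "N_nonlin c y = y * (c - y / 2) * (c - y)"

definition periodic_solution :: "real \<Rightarrow> (real \<Rightarrow> real) \<Rightarrow> bool" where
  "periodic_solution c \<phi> \<longleftrightarrow>
     continuous_on UNIV \<phi> \<and> circle_periodic \<phi> \<and>
     (\<forall>x. K_op (\<lambda>y. complex_of_real (\<phi> y)) x = complex_of_real (N_nonlin c (\<phi> x)))"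

definition gamma_crit :: "real \<Rightarrow> real" where
  "gamma_crit c = c * (1 - 1 / sqrt 3)"

lemma gamma_crit_smallest_critical_point:
  assumes "c > 0"
  shows "is_arg_min (\<lambda>y. y) (\<lambda>y. (N_nonlin c has_real_derivative 0) (at y)) (gamma_crit c)"
proof -
  have D: "(N_nonlin c has_real_derivative (c\<^sup>2 - 3 * c * y + 3 / 2 * y\<^sup>2)) (at y)" for y
    unfolding N_nonlin_def
    by (rule derivative_eq_intros refl | simp)+
       (simp add: power2_eq_square algebra_simps)
  have crit: "(N_nonlin c has_real_derivative 0) (at y) \<longleftrightarrow> c\<^sup>2 - 3 * c * y + 3 / 2 * y\<^sup>2 = 0" for y
    using D[of y] DERIV_unique by metis
  define s :: real where "s = 1 / sqrt 3"
  have s: "s * s = 1 / 3" "s > 0" by (auto simp: s_def)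
  have fac: "c\<^sup>2 - 3 * c * y + 3 / 2 * y\<^sup>2 = 3 / 2 * ((y - c * (1 - s)) * (y - c * (1 + s)))" for y
  proof -
    have "(y - c * (1 - s)) * (y - c * (1 + s)) = y\<^sup>2 - 2 * c * y + c\<^sup>2 * (1 - s * s)"
      by (simp add: power2_eq_square algebra_simps)
    thus ?thesis using s(1) by (simp add: algebra_simps)
  qed
  have "y \<ge> c * (1 - s)" if "y = c * (1 - s) \<or> y = c * (1 + s)" for y
    using that assms s(2) by auto
  thus ?thesis
    unfolding is_arg_min_def crit fac gamma_crit_def s_def[symmetric] by force
qed

text \<open>Periodic solutions of speed \<open>c\<close>, even, nondecreasing on \<open>(-\<pi>, 0)\<close>, with crest value \<open>\<gamma>\<close>.\<close>

definition crest_solution :: "real \<Rightarrow> (real \<Rightarrow> real) \<Rightarrow> bool" where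
  "crest_solution c \<phi> \<longleftrightarrow>
     periodic_solution c \<phi> \<and> (\<forall>x. \<phi> (- x) = \<phi> x) \<and>
     mono_on {-pi<..<0} \<phi> \<and> \<phi> 0 = gamma_crit c"

text \<open>Intended for open \<open>S\<close> only, where the iterates of \<^const>\<open>deriv\<close> are meaningful.\<close>

definition smooth_on_open :: "real set \<Rightarrow> (real \<Rightarrow> real) \<Rightarrow> bool" where
  "smooth_on_open S f \<longleftrightarrow> (\<forall>k. \<forall>x\<in>S. ((deriv ^^ k) f) field_differentiable (at x))"

text \<open>The Hoelder seminorm is extended-real valued, so that it is \<open>\<infinity>\<close> outside the Hoelder space.\<close>

definition hoelder_norm :: "real \<Rightarrow> (real \<Rightarrow> real) \<Rightarrow> ereal" where
  "hoelder_norm \<alpha> u =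
     (SUP (x, y)\<in>{(x, y). x \<noteq> y}. ereal (\<bar>u x - u y\<bar> / \<bar>x - y\<bar> powr \<alpha>))"

definition hoelder_space :: "real \<Rightarrow> (real \<Rightarrow> real) set" where
  "hoelder_space \<alpha> = {u. circle_periodic u \<and> hoelder_norm \<alpha> u < \<infinity>}"

text \<open>
  A constant solution with crest value \<open>\<gamma>\<close> exists for one positive wave speed (and for \<open>c = 0\<close>).
  It satisfies every condition in \<^const>\<open>crest_solution\<close>, but is not strictly monotone and has no
  logarithmic crest, so statements about these properties must exclude constants.
\<close>

lemma K_op_const: "K_op (\<lambda>_. a) x = a"
proof -
  have coeff: "fourier_coeff (\<lambda>_. a) n = (if n = 0 then a else 0)" for n
  proof (cases "n = 0")
    case True
    thus ?thesis by (simp add: fourier_coeff_def scaleR_conv_of_real)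
  next
    case False
    define F where "F = (\<lambda>x. a / (- \<i> * of_int n) * cis (- (real_of_int n * x)))"
    have "((\<lambda>x. a * cis (- (real_of_int n * x))) has_integral (F pi - F (-pi))) {-pi..pi}"
    proof (rule fundamental_theorem_of_calculus)
      fix x :: real
      have ii: "\<i> * (a * (\<i> * w)) = - (a * w)" for w
        by (simp add: complex_eq_iff algebra_simps)
      have "((\<lambda>x. cis (- (real_of_int n * x))) has_vector_derivative
              (- real_of_int n) *\<^sub>R (\<i> * cis (- (real_of_int n * x)))) (at x within {-pi..pi})"
      proof -
        have "((\<lambda>z. exp (- (\<i> * (of_int n * z)))) has_field_derivative
                - (\<i> * of_int n) * exp (- (\<i> * (of_int n * complex_of_real x))))
                (at (complex_of_real x))"
          by (auto intro!: derivative_eq_intros)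
        from has_vector_derivative_real_field[OF this]
        show ?thesis by (simp add: cis_conv_exp scaleR_conv_of_real mult_ac has_vector_derivative_at_within)
      qed
      from has_vector_derivative_mult_right[OF this, of "a / (- \<i> * of_int n)"]
      show "(F has_vector_derivative a * cis (- (real_of_int n * x))) (at x within {-pi..pi})"
        unfolding F_def using False by (simp add: scaleR_conv_of_real ii)
    qed auto
    moreover have "F pi = F (-pi)"
      by (simp add: F_def cis.ctr complex_eq_iff sin_npi_int mult.commute)
    ultimately have "integral {-pi..pi} (\<lambda>x. a * cis (- (real_of_int n * x))) = 0"
      by (metis integral_unique diff_self)
    thus ?thesis
      using False unfolding fourier_coeff_def by (simp only: mult_zero_right if_False)
  qed
  have "K_op (\<lambda>_. a) x = (\<Sum>\<^sub>\<infinity>n\<in>{0::int}. a)"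
    unfolding K_op_def by (rule infsum_cong_neutral) (auto simp: coeff tanh_symbol_def)
  thus ?thesis by simp
qed

lemma constant_crest_solution:
  assumes "c\<^sup>2 * (1 + sqrt 3) = 6"
  shows "crest_solution c (\<lambda>_. gamma_crit c)"
proof -
  define s :: real where "s = 1 / sqrt 3"
  have s: "s * s = 1 / 3" "sqrt 3 = 3 * s" by (auto simp: s_def real_div_sqrt)
  have "(c - gamma_crit c / 2) * (c - gamma_crit c) = c\<^sup>2 * (s + s * s) / 2"
    by (simp add: gamma_crit_def s_def[symmetric] power2_eq_square field_simps)
  also have "\<dots> = c\<^sup>2 * (1 + sqrt 3) / 6" using s by (simp add: field_simps)
  also have "\<dots> = 1" using assms by simp
  finally have "N_nonlin c (gamma_crit c) = gamma_crit c"
    by (simp add: N_nonlin_def mult.assoc)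
  thus ?thesis
    by (auto simp: crest_solution_def periodic_solution_def circle_periodic_def K_op_const
        intro: mono_onI)
qed

end

theory Submission
  imports Defs "HOL-Real_Asymp.Real_Asymp"
begin

text \<open>
  The operator is convolution on the circle with the even kernel
  \<open>- (ln |2 sin (t / 2)|) / \<pi>\<close> plus a smooth function. On \<open>(0, \<pi>)\<close> this kernel stays decreasing after
  subtraction of a small multiple of \<open>cos t\<close>, so the kernel differences in the convolution are
  positive. With \<open>u = \<gamma> - \<phi>\<close> the equation reads \<open>F (u) = K \<phi>(0) - K \<phi>\<close> for
  \<open>F (u) = u\<^sup>2 (\<surd>3 c + u) / 2\<close>, and the positivity bounds \<open>F (u y) - F (u x)\<close> from below by a multiple
  of \<open>cos x - cos y\<close>; hence strict monotonicity.

  Near the crest the second difference of the kernel gives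
  \<open>u(x)\<^sup>2 \<approx> x\<^sup>2 \<integral>\<^sub>x\<^sup>\<pi> u(z) / z\<^sup>2 dz\<close>. Writing \<open>J\<close> for the integral, this is \<open>- x J' \<approx> \<surd>J\<close>, so
  \<open>\<surd>J\<close> grows like \<open>|log x|\<close> and \<open>u\<close> like \<open>x |log x|\<close>. In particular \<open>u \<ge> a x\<close>, which turns the
  Hoelder continuity of \<open>F (u)\<close> coming from the logarithmic kernel into that of \<open>u\<close>.
  Away from the crest \<open>F\<close> is a local diffeomorphism at \<open>u\<close>, and logarithmic convolution maps
  \<open>C\<^sup>k\<close> to \<open>C\<^sup>k\<^sup>,\<^sup>1\<^sup>/\<^sup>2\<close> and that to \<open>C\<^sup>k\<^sup>+\<^sup>1\<close>, so smoothness follows by bootstrapping.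
\<close>

text \<open>Since \<open>gamma_crit c\<close> is a critical point, \<open>crest_F\<close> vanishes
  quadratically at 0, so regularity of \<open>F (u)\<close> does not simply pass to \<open>u\<close>
  at the crest. Estimates there control products such as \<open>(u y - u x) * u y\<close>, and a
  lower bound on \<open>u\<close> is what frees the factor. That lower bound must be uniform in the
  speed although constant solutions exist, so a quantitative gap between constant and nonconstant
  profiles is needed. It comes from the cosine: convolved with the even profile it returns a
  multiple of \<open>cos x\<close>, the multiple being the first cosine moment. Comparing the points
  \<open>z\<close> and \<open>pi - z\<close> and integrating against \<open>cos z\<close> makes this
  moment appear on both sides; being positive it cancels, which leaves a lower bound on
  \<open>u pi\<close> in terms of \<open>c\<close> only, and then one on the moment itself. The
  constants behind the uniform Hoelder estimate are all fixed before \<open>c\<close> and the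
  profile. The convolution formula needs a limit argument because the coefficients
  \<open>1 / n\<close> of the logarithm are not summable; it is obtained by Abel summation.\<close>

lemma borel_measurable_lebesgue_on:
  fixes f :: "'a::euclidean_space \<Rightarrow> 'b::euclidean_space"
  assumes "f \<in> borel_measurable borel"
  shows "f \<in> borel_measurable (lebesgue_on S)"
  using assms by (intro measurable_restrict_space1 measurable_completion) simp

text \<open>The integral splits at \<open>x\<close>; each half is an explicit power integral over a
  length of at most \<open>b - a\<close>, hence the factor 2.\<close>

lemma abs_powr_integrable_bound:
  fixes a b x \<beta> :: real
  assumes "0 \<le> \<beta>" "\<beta> < 1" "x \<in> {a..b}"
  shows "(\<lambda>y. \<bar>x - y\<bar> powr - \<beta>) integrable_on {a..b}"
    and "integral {a..b} (\<lambda>y. \<bar>x - y\<bar> powr - \<beta>) \<le> 2 * (b - a) powr (1 - \<beta>) / (1 - \<beta>)"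
proof -
  have A: "((\<lambda>y. \<bar>x - y\<bar> powr - \<beta>) has_integral ((x - a) powr (1 - \<beta>) / (1 - \<beta>))) {a..x}"
  proof -
    have "((\<lambda>y. y powr - \<beta>) has_integral ((x - a) powr (- \<beta> + 1) / (- \<beta> + 1))) {0..x - a}"
      using assms by (intro has_integral_powr_from_0) auto
    hence "((\<lambda>y. (- y) powr - \<beta>) has_integral ((x - a) powr (1 - \<beta>) / (1 - \<beta>))) {a - x..0}"
      using has_integral_reflect_real[of "\<lambda>y. y powr - \<beta>" _ "x - a" 0] by (simp add: add.commute)
    from has_integral_shift_real_ivl[OF this, of "- x"]
    have "((\<lambda>y. (x - y) powr - \<beta>) has_integral ((x - a) powr (1 - \<beta>) / (1 - \<beta>))) {a..x}"
      by (simp add: algebra_simps)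
    thus ?thesis by (rule has_integral_eq[rotated]) auto
  qed
  have B: "((\<lambda>y. \<bar>x - y\<bar> powr - \<beta>) has_integral ((b - x) powr (1 - \<beta>) / (1 - \<beta>))) {x..b}"
  proof -
    have "((\<lambda>y. y powr - \<beta>) has_integral ((b - x) powr (- \<beta> + 1) / (- \<beta> + 1))) {0..b - x}"
      using assms by (intro has_integral_powr_from_0) auto
    from has_integral_shift_real_ivl[OF this, of "- x"]
    have "((\<lambda>y. (y - x) powr - \<beta>) has_integral ((b - x) powr (1 - \<beta>) / (1 - \<beta>))) {x..b}"
      by (simp add: algebra_simps)
    thus ?thesis by (rule has_integral_eq[rotated]) auto
  qed
  have C: "((\<lambda>y. \<bar>x - y\<bar> powr - \<beta>) has_integral
      ((x - a) powr (1 - \<beta>) / (1 - \<beta>) + (b - x) powr (1 - \<beta>) / (1 - \<beta>))) {a..b}"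
    using assms by (intro has_integral_combine[OF _ _ A B]) auto
  show "(\<lambda>y. \<bar>x - y\<bar> powr - \<beta>) integrable_on {a..b}" using C by blast
  have "(x - a) powr (1 - \<beta>) \<le> (b - a) powr (1 - \<beta>)" "(b - x) powr (1 - \<beta>) \<le> (b - a) powr (1 - \<beta>)"
    using assms by (auto intro!: powr_mono2)
  hence "(x - a) powr (1 - \<beta>) / (1 - \<beta>) + (b - x) powr (1 - \<beta>) / (1 - \<beta>)
      \<le> (b - a) powr (1 - \<beta>) / (1 - \<beta>) + (b - a) powr (1 - \<beta>) / (1 - \<beta>)"
    using assms by (intro add_mono divide_right_mono) auto
  thus "integral {a..b} (\<lambda>y. \<bar>x - y\<bar> powr - \<beta>) \<le> 2 * (b - a) powr (1 - \<beta>) / (1 - \<beta>)"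
    using integral_unique[OF C] by simp
qed

text \<open>Trades the logarithmic singularity for an integrable power and gains a power of
  \<open>|a - b|\<close>. By symmetry \<open>b \<le> a\<close>, where the left side is
  \<open>ln (1 + w)\<close> with \<open>w = (a - b) / b\<close>, so it is enough to bound
  \<open>ln (1 + w)\<close> by a multiple of \<open>w powr \<beta>\<close>.\<close>

lemma ln_diff_powr_le:
  fixes a b \<beta> :: real
  assumes "0 < \<beta>" "\<beta> \<le> 1" "0 < a" "0 < b"
  shows "\<bar>ln a - ln b\<bar> \<le> 2 / \<beta> * \<bar>a - b\<bar> powr \<beta> * (a powr - \<beta> + b powr - \<beta>)"
proof -
  have *: "ln (1 + w) \<le> 2 / \<beta> * w powr \<beta>" if "w \<ge> 0" for w :: real
  proof (cases "w \<le> 1")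
    case True
    have "ln (1 + w) \<le> w" using that by (simp add: ln_add_one_self_le_self)
    also have "w \<le> w powr \<beta>"
      using powr_mono'[of \<beta> 1 w] that True assms by simp
    also have "\<dots> \<le> 2 / \<beta> * w powr \<beta>"
      using assms by (intro mult_le_cancel_right1[THEN iffD2]) (auto simp: field_simps)
    finally show ?thesis .
  next
    case False
    \<comment> \<open>For large \<open>w\<close>, \<open>ln s \<le> s - 1\<close> is applied to
      \<open>s = (1 + w) powr \<beta>\<close>, and then \<open>1 + w \<le> 2 * w\<close>.\<close>
    have "\<beta> * ln (1 + w) = ln ((1 + w) powr \<beta>)" using False by (simp add: ln_powr)
    also have "\<dots> \<le> (1 + w) powr \<beta>" using False by (intro order.trans[OF ln_le_minus_one]) auto
    also have "\<dots> \<le> (2 * w) powr \<beta>" using False assms by (intro powr_mono2) auto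
    also have "\<dots> = 2 powr \<beta> * w powr \<beta>" using False by (simp add: powr_mult)
    also have "\<dots> \<le> 2 * w powr \<beta>"
      using powr_mono[of \<beta> 1 "2::real"] assms by (intro mult_right_mono) auto
    finally show ?thesis using assms by (simp add: field_simps)
  qed
  have key: "\<bar>ln a - ln b\<bar> \<le> 2 / \<beta> * \<bar>a - b\<bar> powr \<beta> * (a powr - \<beta> + b powr - \<beta>)"
    if "0 < b" "b \<le> a" for a b :: real
  proof -
    have "\<bar>ln a - ln b\<bar> = ln (1 + (a - b) / b)"
      using that by (simp add: ln_div field_simps)
    also have "\<dots> \<le> 2 / \<beta> * ((a - b) / b) powr \<beta>" using that by (intro *) auto
    also have "\<dots> = 2 / \<beta> * \<bar>a - b\<bar> powr \<beta> * b powr - \<beta>"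
      using that by (simp add: powr_divide powr_minus divide_simps)
    also have "\<dots> \<le> 2 / \<beta> * \<bar>a - b\<bar> powr \<beta> * (a powr - \<beta> + b powr - \<beta>)"
      using assms by (intro mult_left_mono) auto
    finally show ?thesis .
  qed
  show ?thesis
    using key[of a b] key[of b a] assms by (cases "a \<le> b") (auto simp: abs_minus_commute add.commute)
qed

section \<open>Integrals of periodic functions and convolution on the circle\<close>

lemma circle_periodic_int:
  assumes "circle_periodic f"
  shows "f (x + 2 * pi * of_int k) = f x"
proof (induction k rule: int_induct[where k = 0])
  case base show ?case by simp
next
  case (step1 i)
  have "f (x + 2 * pi * of_int (i + 1)) = f ((x + 2 * pi * of_int i) + 2 * pi)"
    by (simp add: algebra_simps)
  thus ?case using step1 assms by (simp add: circle_periodic_def)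
next
  case (step2 i)
  have "f (x + 2 * pi * of_int i) = f ((x + 2 * pi * of_int (i - 1)) + 2 * pi)"
    by (simp add: algebra_simps)
  thus ?case using step2 assms by (simp add: circle_periodic_def)
qed

lemma circle_periodic_has_integral_shift:
  fixes f :: "real \<Rightarrow> 'a::banach"
  assumes per: "circle_periodic f" and int: "(f has_integral I) {-pi..pi}"
  shows "((\<lambda>x. f (x + h)) has_integral I) {-pi..pi}"
proof -
  have A: "(f has_integral I) {-pi + 2 * pi * of_int k .. pi + 2 * pi * of_int k}" for k :: int
  proof -
    have "((\<lambda>x. f (x + 2 * pi * of_int (- k))) has_integral I) {-pi - 2 * pi * of_int (- k) .. pi - 2 * pi * of_int (- k)}"
      by (rule has_integral_shift_real_ivl[OF int])
    thus ?thesis by (subst (asm) circle_periodic_int[OF per]) simp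
  qed
  \<comment> \<open>For a shift by at most one period, the part of the window beyond
    \<open>pi\<close> is the translate by \<open>2 * pi\<close> of the lost part
    \<open>{-pi..h - pi}\<close>.\<close>
  have B: "(f has_integral I) {h - pi..h + pi}" if h: "0 \<le> h" "h \<le> 2 * pi" for h
  proof -
    have 1: "f integrable_on {-pi..h - pi}" "f integrable_on {h - pi..pi}"
      using int h by (auto intro: integrable_on_subinterval[of f "{-pi..pi}"])
    have i: "integral {-pi..h - pi} f + integral {h - pi..pi} f = I"
      using Henstock_Kurzweil_Integration.integral_combine[of "-pi" "h - pi" pi f] int h
      by (auto simp: integral_unique)
    have "((\<lambda>x. f (x + 2 * pi * of_int (-1))) has_integral integral {-pi..h - pi} f) {-pi - 2 * pi * of_int (- 1)..h - pi - 2 * pi * of_int (-1)}"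
      by (rule has_integral_shift_real_ivl[OF integrable_integral[OF 1(1)]])
    hence 2: "(f has_integral integral {-pi..h - pi} f) {pi..h + pi}"
      by (subst (asm) circle_periodic_int[OF per]) (simp add: add.commute)
    show ?thesis
      using has_integral_combine[OF _ _ integrable_integral[OF 1(2)] 2] h i by (simp add: add.commute)
  qed
  define k where "k = \<lfloor>h / (2 * pi)\<rfloor>"
  define h0 where "h0 = h - 2 * pi * of_int k"
  have "of_int k \<le> h / (2 * pi)" "h / (2 * pi) \<le> of_int k + 1"
    unfolding k_def by linarith+
  hence h0: "0 \<le> h0" "h0 \<le> 2 * pi" unfolding h0_def by (auto simp: field_simps)
  have "((\<lambda>x. f (x + h0)) has_integral I) {-pi..pi}"
    using has_integral_shift_real_ivl[OF B[OF h0], of h0] by simp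
  moreover have "f (x + h0) = f (x + h)" for x
    using circle_periodic_int[OF per, of "x + h0" k] by (simp add: h0_def)
  ultimately show ?thesis by simp
qed

lemma circle_periodic_integral_shift:
  fixes f :: "real \<Rightarrow> 'a::banach"
  assumes "circle_periodic f" "f integrable_on {-pi..pi}"
  shows "(\<lambda>x. f (x + h)) integrable_on {-pi..pi}"
    and "integral {-pi..pi} (\<lambda>x. f (x + h)) = integral {-pi..pi} f"
  using circle_periodic_has_integral_shift[OF assms(1) integrable_integral[OF assms(2)], of h]
  by (auto simp: integral_unique)

lemma circle_periodic_absolutely_integrable_shift:
  fixes f :: "real \<Rightarrow> real"
  assumes "circle_periodic f" "f absolutely_integrable_on {-pi..pi}"
  shows "(\<lambda>x. f (x + h)) absolutely_integrable_on {-pi..pi}"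
  using circle_periodic_integral_shift(1)[of f h] circle_periodic_integral_shift(1)[of "\<lambda>x. norm (f x)" h] assms
  by (auto simp: absolutely_integrable_on_def circle_periodic_def)

lemma circle_periodic_reflect_shift:
  fixes f :: "real \<Rightarrow> real"
  assumes "circle_periodic f" "f absolutely_integrable_on {-pi..pi}"
  shows "(\<lambda>y. f (x - y)) absolutely_integrable_on {-pi..pi}"
    and "integral {-pi..pi} (\<lambda>y. f (x - y)) = integral {-pi..pi} f"
proof -
  have "(\<lambda>y. f (y + x)) absolutely_integrable_on {-pi..pi}"
    by (rule circle_periodic_absolutely_integrable_shift[OF assms])
  hence "(\<lambda>y. f (- y + x)) absolutely_integrable_on {- pi..- (- pi)}"
    by (subst absolutely_integrable_reflect_real) simp
  thus "(\<lambda>y. f (x - y)) absolutely_integrable_on {-pi..pi}" by simp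
  have "integral {-pi..pi} (\<lambda>y. f (x - y)) = integral {- pi..- (- pi)} (\<lambda>y. f (- y + x))" by simp
  also have "\<dots> = integral {-pi..pi} (\<lambda>y. f (y + x))"
    by (subst Henstock_Kurzweil_Integration.integral_reflect_real[of _ _ "\<lambda>y. f (y + x)"]) simp
  also have "\<dots> = integral {-pi..pi} f"
    using assms by (intro circle_periodic_integral_shift) (auto simp: absolutely_integrable_on_def)
  finally show "integral {-pi..pi} (\<lambda>y. f (x - y)) = integral {-pi..pi} f" .
qed

definition circ_conv :: "(real \<Rightarrow> real) \<Rightarrow> (real \<Rightarrow> real) \<Rightarrow> real \<Rightarrow> real" where
  "circ_conv k f x = integral {-pi..pi} (\<lambda>y. k (x - y) * f y)"

lemma absolutely_integrable_mult_continuous: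
  fixes k f :: "real \<Rightarrow> real"
  assumes "k absolutely_integrable_on {a..b}" "continuous_on {a..b} f"
  shows "(\<lambda>y. k y * f y) absolutely_integrable_on {a..b}"
proof -
  have "(\<lambda>y. f y * k y) absolutely_integrable_on {a..b}"
    using assms
    by (intro absolutely_integrable_bounded_measurable_product_real)
       (auto intro!: continuous_imp_measurable_on_sets_lebesgue compact_imp_bounded compact_continuous_image)
  thus ?thesis by (simp add: mult.commute)
qed

lemma circ_conv_integrable:
  fixes k f :: "real \<Rightarrow> real"
  assumes "circle_periodic k" "k absolutely_integrable_on {-pi..pi}" "continuous_on UNIV f"
  shows "(\<lambda>y. k (x - y) * f y) absolutely_integrable_on {-pi..pi}"
  using assms circle_periodic_reflect_shift(1)[of k x]
  by (intro absolutely_integrable_mult_continuous) (auto intro: continuous_on_subset)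

lemma circ_conv_shift:
  assumes "circle_periodic k" "k absolutely_integrable_on {-pi..pi}" "continuous_on UNIV f" "circle_periodic f"
  shows "circ_conv k f (x + h) = circ_conv k (\<lambda>y. f (y + h)) x"
proof -
  have "circle_periodic (\<lambda>y. k (x + h - y) * f y)"
    unfolding circle_periodic_def
  proof
    fix y
    have "k (x + h - y) = k (x + h - (y + 2 * pi))"
      using assms(1) unfolding circle_periodic_def by (metis add_diff_cancel diff_diff_add diff_add_cancel)
    thus "k (x + h - (y + 2 * pi)) * f (y + 2 * pi) = k (x + h - y) * f y"
      using assms(4) by (simp add: circle_periodic_def)
  qed
  from circle_periodic_integral_shift(2)[OF this, of h] circ_conv_integrable[OF assms(1-3), of "x + h"]
  show ?thesis unfolding circ_conv_def absolutely_integrable_on_def by (simp add: algebra_simps)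
qed

lemma circ_conv_commute:
  assumes "circle_periodic k" "k absolutely_integrable_on {-pi..pi}" "continuous_on UNIV f" "circle_periodic f"
  shows "circ_conv k f x = integral {-pi..pi} (\<lambda>t. k t * f (x - t))"
proof -
  have f': "continuous_on UNIV (\<lambda>t. f (x - t))"
    by (rule continuous_on_compose2[OF assms(3)]) (auto intro!: continuous_intros)
  have i: "(\<lambda>t. k t * f (x - t)) absolutely_integrable_on {-pi..pi}"
    using assms f' by (intro absolutely_integrable_mult_continuous) (auto intro: continuous_on_subset)
  have p: "circle_periodic (\<lambda>t. k t * f (x - t))"
    unfolding circle_periodic_def
  proof
    fix t
    have "f (x - t) = f (x - (t + 2 * pi))"
      using assms(4) unfolding circle_periodic_def by (metis add_diff_cancel diff_diff_add diff_add_cancel)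
    thus "k (t + 2 * pi) * f (x - (t + 2 * pi)) = k t * f (x - t)"
      using assms(1) by (simp add: circle_periodic_def)
  qed
  from circle_periodic_reflect_shift(2)[OF p i, of x] show ?thesis
    by (simp add: circ_conv_def)
qed

text \<open>By evenness and periodicity \<open>f q\<close> is the value at the distance of
  \<open>q\<close> from the nearest multiple of \<open>2 * pi\<close>, which lies between
  \<open>|p|\<close> and \<open>pi\<close>. The set \<open>A\<close> is \<open>{0<..}\<close> for
  the kernel, which is singular at 0, and \<open>{0..}\<close> for the profile.\<close>

lemma circle_periodic_even_le:
  fixes f :: "real \<Rightarrow> real"
  assumes "circle_periodic f" "\<And>x. f (- x) = f x"
    and "\<And>s t. s \<in> A \<Longrightarrow> s \<le> t \<Longrightarrow> t \<le> pi \<Longrightarrow> f t \<le> f s"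
    and "\<bar>p\<bar> \<in> A" "0 \<le> q" "q \<le> 2 * pi" "\<bar>p\<bar> \<le> q" "\<bar>p\<bar> \<le> 2 * pi - q"
  shows "f q \<le> f p"
proof -
  have p: "f \<bar>p\<bar> = f p" using assms(2)[of p] by (cases "p \<ge> 0") auto
  show ?thesis
  proof (cases "q \<le> pi")
    case True
    thus ?thesis using assms(3)[of "\<bar>p\<bar>" q] assms p by auto
  next
    case False
    have "f q = f (2 * pi - q)"
      using assms(1) assms(2)[of "2 * pi - q"]
      by (metis circle_periodic_def diff_add_cancel minus_diff_eq)
    thus ?thesis using assms(3)[of "\<bar>p\<bar>" "2 * pi - q"] assms p False by auto
  qed
qed

lemma integral_even_half:
  fixes f :: "real \<Rightarrow> 'a::banach"
  assumes "f integrable_on {-a..a}" "0 \<le> a"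
  shows "(\<lambda>y. f y + f (- y)) integrable_on {0..a}"
    and "integral {-a..a} f = integral {0..a} (\<lambda>y. f y + f (- y))"
proof -
  have 1: "f integrable_on {0..a}" "f integrable_on {-a..0}"
    using assms by (auto intro: integrable_subinterval_real)
  have 2: "(\<lambda>y. f (- y)) integrable_on {0..a}"
    using 1(2) Henstock_Kurzweil_Integration.integrable_reflect_real[of f 0 "-a"] by simp
  have 3: "integral {0..a} (\<lambda>y. f (- y)) = integral {-a..0} f"
    using Henstock_Kurzweil_Integration.integral_reflect_real[of 0 "-a" f] by simp
  show "(\<lambda>y. f y + f (- y)) integrable_on {0..a}" using 1 2 by (intro integrable_add)
  show "integral {-a..a} f = integral {0..a} (\<lambda>y. f y + f (- y))"
    using Henstock_Kurzweil_Integration.integral_combine[of "-a" 0 a f] assms 1 2 3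
    by (simp add: Henstock_Kurzweil_Integration.integral_add add.commute)
qed

text \<open>At its singularities the kernel takes the value forced by \<open>ln 0 = 0\<close>, so
  sign estimates on integrands can fail on a null set, here \<open>N\<close>.\<close>

lemma integral_ge_0_spike:
  fixes f :: "real \<Rightarrow> real"
  assumes "f integrable_on S" "negligible N" "\<And>x. x \<in> S - N \<Longrightarrow> 0 \<le> f x"
  shows "0 \<le> integral S f"
proof -
  have "integral S f = integral S (\<lambda>x. if x \<in> N then 0 else f x)"
    by (rule integral_spike[OF assms(2)]) auto
  moreover have "(\<lambda>x. if x \<in> N then 0 else f x) integrable_on S"
    by (rule integrable_spike[OF assms(1,2)]) auto
  ultimately show ?thesis using assms(3) by (auto intro!: Henstock_Kurzweil_Integration.integral_nonneg)
qed

lemma integral_le_spike: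
  fixes f g :: "real \<Rightarrow> real"
  assumes "f integrable_on S" "g integrable_on S" "negligible N" "\<And>x. x \<in> S - N \<Longrightarrow> f x \<le> g x"
  shows "integral S f \<le> integral S g"
  using integral_ge_0_spike[OF integrable_diff[OF assms(2,1)] assms(3)] assms
  by (simp add: Henstock_Kurzweil_Integration.integral_diff)

text \<open>With \<open>m = (x + y) / 2\<close> and \<open>h = (y - x) / 2\<close> the difference of the two convolutions is
  \<open>\<integral>\<^sub>0\<^sup>\<pi> (k (m - z) - k (m + z)) (f (z - h) - f (z + h)) dz\<close>, where both factors are nonnegative.\<close>

lemma circ_conv_antimono:
  fixes k f :: "real \<Rightarrow> real"
  assumes k: "circle_periodic k" "k absolutely_integrable_on {-pi..pi}" "\<And>x. k (- x) = k x"
      "\<And>s t. 0 < s \<Longrightarrow> s \<le> t \<Longrightarrow> t \<le> pi \<Longrightarrow> k t \<le> k s"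
    and f: "continuous_on UNIV f" "circle_periodic f" "\<And>x. f (- x) = f x"
      "\<And>s t. 0 \<le> s \<Longrightarrow> s \<le> t \<Longrightarrow> t \<le> pi \<Longrightarrow> f t \<le> f s"
    and xy: "0 \<le> x" "x \<le> y" "y \<le> pi"
  shows "circ_conv k f y \<le> circ_conv k f x"
proof -
  define m where "m = (x + y) / 2"
  define h where "h = (y - x) / 2"
  define g where "g = (\<lambda>z. f (z - h) - f (z + h))"
  have mh: "m + h = y" "m - h = x" "0 \<le> h" "h \<le> pi / 2" "0 \<le> m" "m \<le> pi"
    using xy by (auto simp: m_def h_def field_simps)
  have cf: "continuous_on UNIV (\<lambda>z. f (z + h))" for h
    by (rule continuous_on_compose2[OF f(1)]) (auto intro!: continuous_intros)
  have g: "continuous_on UNIV g" unfolding g_def using cf[of h] cf[of "-h"] by (auto intro!: continuous_intros)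
  note ci = circ_conv_integrable[OF k(1,2), unfolded absolutely_integrable_on_def, THEN conjunct1]
  have "circ_conv k f x - circ_conv k f y = circ_conv k (\<lambda>z. f (z + - h)) m - circ_conv k (\<lambda>z. f (z + h)) m"
    using circ_conv_shift[OF k(1,2) f(1,2), of m "-h"] circ_conv_shift[OF k(1,2) f(1,2), of m "h"] mh by simp
  also have "\<dots> = circ_conv k g m"
    unfolding circ_conv_def g_def using ci[OF cf[of "-h"], of m] ci[OF cf[of h], of m]
    by (subst Henstock_Kurzweil_Integration.integral_diff[symmetric]) (auto simp: algebra_simps)
  also have "\<dots> = integral {0..pi} (\<lambda>z. k (m - z) * g z + k (m - - z) * g (- z))"
    unfolding circ_conv_def using integral_even_half(2)[OF ci[OF g, of m]] by simp
  also have "\<dots> \<ge> 0"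
  proof (rule integral_ge_0_spike[where N = "{m, 0, pi}"])
    show "(\<lambda>z. k (m - z) * g z + k (m - - z) * g (- z)) integrable_on {0..pi}"
      using integral_even_half(1)[OF ci[OF g, of m]] by simp
  next
    fix z assume z: "z \<in> {0..pi} - {m, 0, pi}"
    have "g (- z) = - g z"
      using f(3)[of "z + h"] f(3)[of "z - h"]
      by (simp add: g_def algebra_simps) (metis add.commute minus_add_distrib uminus_add_conv_diff)
    hence eq: "k (m - z) * g z + k (m - - z) * g (- z) = (k (m - z) - k (m + z)) * g z"
      by (simp add: algebra_simps)
    have "k (m + z) \<le> k (m - z)"
      by (rule circle_periodic_even_le[OF k(1,3), where A = "{0<..}"]) (use k(4) z mh in auto)
    moreover have "f (z + h) \<le> f (z - h)"
      by (rule circle_periodic_even_le[OF f(2,3), where A = "{0..}"]) (use f(4) z mh in auto)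
    ultimately show "0 \<le> k (m - z) * g z + k (m - - z) * g (- z)"
      unfolding eq by (intro mult_nonneg_nonneg) (auto simp: g_def)
  qed auto
  finally show ?thesis by simp
qed

section \<open>The kernel of the operator\<close>

text \<open>Jordan's inequality: a concave function lies above its chord.\<close>

lemma sin_ge_two_div_pi:
  assumes "0 \<le> x" "x \<le> pi / 2"
  shows "2 / pi * x \<le> sin x"
proof -
  have "concave_on {0..pi / 2} sin"
    by (rule f''_le0_imp_concave[where f' = cos and f'' = "\<lambda>x. - sin x"])
       (auto intro!: derivative_eq_intros sin_ge_zero)
  from concave_onD_Icc'[OF this, of x] assms show ?thesis by (simp add: field_simps)
qed

lemma abs_sin_half_ge:
  assumes "\<bar>t\<bar> \<le> pi"
  shows "\<bar>t\<bar> / pi \<le> \<bar>sin (t / 2)\<bar>"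
proof -
  have "2 / pi * \<bar>t / 2\<bar> \<le> sin \<bar>t / 2\<bar>" using assms by (intro sin_ge_two_div_pi) auto
  also have "sin \<bar>t / 2\<bar> \<le> \<bar>sin (t / 2)\<bar>" by (cases "t \<ge> 0") auto
  finally show ?thesis by simp
qed

lemma sin_half_eq_0_iff:
  assumes "\<bar>t\<bar> < 2 * pi"
  shows "sin (t / 2) = 0 \<longleftrightarrow> t = 0"
proof
  assume "sin (t / 2) = 0"
  then obtain i :: int where i: "t / 2 = of_int i * pi" by (auto simp: sin_zero_iff_int2)
  hence "\<bar>of_int i * pi\<bar> < 1 * pi" using assms by linarith
  hence "\<bar>real_of_int i\<bar> < 1" by (simp add: abs_mult)
  hence "i = 0" by linarith
  thus "t = 0" using i by simp
qed auto

lemma power_le_fact_exp: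
  fixes x :: real
  assumes "0 \<le> x"
  shows "x ^ k \<le> fact k * exp x"
proof -
  have "(\<Sum>n\<in>{k}. inverse (fact n) * x ^ n) \<le> (\<Sum>n. inverse (fact n) * x ^ n)"
    by (rule sum_le_suminf) (use summable_exp[of x] assms in auto)
  also have "\<dots> = exp x" by (simp add: exp_def scaleR_conv_of_real divide_inverse)
  finally show ?thesis by (simp add: field_simps)
qed

text \<open>The weights satisfy \<open>tanh n / n = 1 / n - 2 \<cdot> kw n\<close>; at \<open>n = 0\<close> both fractions are \<open>0\<close>.\<close>

definition kw :: "nat \<Rightarrow> real" where
  "kw n = 1 / (real n * (exp (2 * real n) + 1))"

lemma kw_nonneg: "0 \<le> kw n"
  by (simp add: kw_def)

lemma kw_0 [simp]: "kw 0 = 0"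
  by (simp add: kw_def)

lemma tanh_symbol_kw:
  assumes "n \<noteq> 0"
  shows "tanh_symbol (real n) = 1 / real n - 2 * kw n"
proof -
  define E where "E = exp (2 * real n)"
  have E: "E > 0" by (simp add: E_def)
  have "tanh (real n) = (E - 1) / (E + 1)"
    using tanh_real_altdef[of "real n"] E
    by (simp add: E_def exp_minus divide_simps)
  thus ?thesis using assms E by (simp add: tanh_symbol_def kw_def E_def[symmetric] divide_simps)
qed

lemma kw_power_summable: "summable (\<lambda>n. real n ^ k * kw n)"
proof (rule summable_comparison_test')
  have "summable (\<lambda>n. exp (- 1 :: real) ^ n)" by (intro summable_geometric) auto
  thus "summable (\<lambda>n. fact k * exp (- 1 :: real) ^ n)" by (rule summable_mult)
next
  fix n :: nat
  show "norm (real n ^ k * kw n) \<le> fact k * exp (- 1) ^ n"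
  proof (cases "n = 0")
    case False
    have "kw n \<le> 1 / (1 * exp (2 * real n))"
      unfolding kw_def using False by (intro divide_left_mono mult_mono) (auto intro!: mult_pos_pos add_pos_pos)
    hence "real n ^ k * kw n \<le> (fact k * exp (real n)) * (1 / exp (2 * real n))"
      by (intro mult_mono power_le_fact_exp) (auto simp: kw_nonneg)
    also have "\<dots> = fact k * exp (- 1) ^ n"
      by (simp add: exp_of_nat_mult[symmetric] exp_minus divide_simps flip: exp_add)
    finally show ?thesis by (simp add: kw_nonneg)
  qed simp
qed

text \<open>The weight \<open>n ^ k\<close> and the phase \<open>k * (pi / 2)\<close> make this the
  \<open>k\<close>-th derivative of \<open>kw_series 0\<close>, so one formula and one summability
  statement serve all orders.\<close>

definition kw_series :: "nat \<Rightarrow> real \<Rightarrow> real" where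
  "kw_series k t = (\<Sum>n. real n ^ k * kw n * cos (real n * t + real k * (pi / 2)))"

lemma kw_series_summable:
  "summable (\<lambda>n. real n ^ k * kw n * cos (real n * t + r))"
proof (rule summable_comparison_test'[OF kw_power_summable[of k]])
  fix n :: nat
  have "\<bar>real n ^ k * kw n\<bar> * \<bar>cos (real n * t + r)\<bar> \<le> \<bar>real n ^ k * kw n\<bar> * 1"
    by (intro mult_left_mono) auto
  thus "norm (real n ^ k * kw n * cos (real n * t + r)) \<le> real n ^ k * kw n"
    by (simp add: abs_mult kw_nonneg)
qed

lemma kw_series_has_derivative:
  "(kw_series k has_real_derivative kw_series (Suc k) t) (at t)"
  unfolding kw_series_def
proof (rule has_field_derivative_series'(2)[where S = UNIV and ?x0.0 = 0])
  fix n :: nat and x :: real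
  show "((\<lambda>t. real n ^ k * kw n * cos (real n * t + real k * (pi / 2))) has_real_derivative
     real n ^ Suc k * kw n * cos (real n * x + real (Suc k) * (pi / 2))) (at x within UNIV)"
  proof -
    have "real n * x + real (Suc k) * (pi / 2) = (real n * x + real k * (pi / 2)) + pi / 2"
      by (simp add: algebra_simps)
    hence "cos (real n * x + real (Suc k) * (pi / 2)) = - sin (real n * x + real k * (pi / 2))"
      by (simp only: cos_add cos_pi_half sin_pi_half)
    thus ?thesis by (auto intro!: derivative_eq_intros)
  qed
next
  show "uniformly_convergent_on UNIV
     (\<lambda>m x. \<Sum>i<m. real i ^ Suc k * kw i * cos (real i * x + real (Suc k) * (pi / 2)))"
  proof (rule Weierstrass_m_test'[OF _ kw_power_summable[of "Suc k"]])
    fix n :: nat and x :: real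
    have "\<bar>real n ^ Suc k * kw n\<bar> * \<bar>cos (real n * x + real (Suc k) * (pi / 2))\<bar> \<le> \<bar>real n ^ Suc k * kw n\<bar> * 1"
      by (intro mult_left_mono) auto
    thus "norm (real n ^ Suc k * kw n * cos (real n * x + real (Suc k) * (pi / 2))) \<le> real n ^ Suc k * kw n"
      by (simp add: abs_mult kw_nonneg)
  qed
next
  show "summable (\<lambda>n. real n ^ k * kw n * cos (real n * 0 + real k * (pi / 2)))"
    by (rule kw_series_summable)
qed auto

lemma kw_series_0: "kw_series 0 t = (\<Sum>n. kw n * cos (real n * t))"
  by (simp add: kw_series_def)

lemma kw_series_1: "kw_series 1 t = - (\<Sum>n. real n * kw n * sin (real n * t))"
proof -
  have "summable (\<lambda>n. real n ^ 1 * kw n * cos (real n * t + - (pi / 2)))" by (rule kw_series_summable)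
  hence "summable (\<lambda>n. real n * kw n * sin (real n * t))" by (simp add: cos_diff)
  thus ?thesis by (simp add: kw_series_def cos_add suminf_minus)
qed

text \<open>The kernel of the multiplier is \<open>1 / (2 * pi)\<close> times 1 plus twice the sum
  of \<open>tanh n / n * cos (n * t)\<close> over \<open>n \<ge> 1\<close>. With
  \<open>tanh n / n = 1 / n - 2 * kw n\<close>, the part with \<open>1 / n\<close> sums to
  \<open>- log_ker t\<close>; the rest, together with the constant mode, is
  \<open>smooth_ker\<close>.\<close>

definition smooth_ker :: "real \<Rightarrow> real" where
  "smooth_ker t = (1 - 4 * kw_series 0 t) / (2 * pi)"

definition log_ker :: "real \<Rightarrow> real" where
  "log_ker t = ln \<bar>2 * sin (t / 2)\<bar>"

definition K_ker :: "real \<Rightarrow> real" where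
  "K_ker t = smooth_ker t - log_ker t / pi"

lemma smooth_ker_even: "smooth_ker (- t) = smooth_ker t"
  by (simp add: smooth_ker_def kw_series_0)

lemma smooth_ker_periodic: "circle_periodic smooth_ker"
proof -
  have "cos (real n * (t + 2 * pi)) = cos (real n * t)" for n t
  proof -
    have "real n * (t + 2 * pi) = real n * t + 2 * pi * real n" by (simp add: algebra_simps)
    thus ?thesis using sin_npi[of "2 * n"] cos_npi[of "2 * n"]
      by (simp only: cos_add) (simp add: mult_ac)
  qed
  thus ?thesis by (simp add: circle_periodic_def smooth_ker_def kw_series_0)
qed

lemma log_ker_even: "log_ker (- t) = log_ker t"
  by (simp add: log_ker_def)

lemma log_ker_periodic: "circle_periodic log_ker"
  by (simp add: circle_periodic_def log_ker_def add_divide_distrib sin_add)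

lemma K_ker_even: "K_ker (- t) = K_ker t"
  by (simp add: K_ker_def log_ker_even smooth_ker_even)

lemma K_ker_periodic: "circle_periodic K_ker"
  using log_ker_periodic smooth_ker_periodic by (simp add: circle_periodic_def K_ker_def)

lemma smooth_ker_continuous: "continuous_on S smooth_ker"
proof -
  have "continuous_on UNIV (kw_series 0)"
    by (auto intro!: continuous_at_imp_continuous_on DERIV_isCont[OF kw_series_has_derivative])
  hence "continuous_on UNIV smooth_ker"
    unfolding smooth_ker_def by (intro continuous_intros) auto
  thus ?thesis by (rule continuous_on_subset) auto
qed

text \<open>Provides an integrable majorant: \<open>ln s \<le> s - 1\<close> at
  \<open>s = |t| powr - (1 / 2)\<close>, combined with
  \<open>|t| / 2 \<le> |2 * sin (t / 2)|\<close>.\<close>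

lemma log_ker_abs_le:
  assumes "\<bar>t\<bar> \<le> pi"
  shows "\<bar>log_ker t\<bar> \<le> 1 + 2 * \<bar>t\<bar> powr - (1 / 2)"
proof (cases "t = 0")
  case False
  define w where "w = \<bar>2 * sin (t / 2)\<bar>"
  have w: "\<bar>t\<bar> / 2 \<le> w"
  proof -
    have "\<bar>t\<bar> / 4 \<le> \<bar>t\<bar> / pi" using pi_less_4 by (intro divide_left_mono) auto
    also have "\<dots> \<le> \<bar>sin (t / 2)\<bar>" by (rule abs_sin_half_ge[OF assms])
    finally show ?thesis by (simp add: w_def abs_mult)
  qed
  have w0: "w > 0" using w False by linarith
  have "w \<le> 2" by (simp add: w_def abs_mult)
  hence "ln w \<le> 1" using ln_le_minus_one[OF w0] by simp
  moreover have "- ln w \<le> 1 + 2 * \<bar>t\<bar> powr - (1 / 2)"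
  proof -
    have "ln (\<bar>t\<bar> / 2) \<le> ln w" using w False by (intro ln_mono) auto
    moreover have "ln (\<bar>t\<bar> / 2) = ln \<bar>t\<bar> - ln 2" using False by (simp add: ln_div)
    moreover have "- ln \<bar>t\<bar> / 2 \<le> \<bar>t\<bar> powr - (1 / 2) - 1"
      using ln_le_minus_one[of "\<bar>t\<bar> powr - (1 / 2)"] False by (simp add: ln_powr)
    moreover have "ln (2::real) \<le> 1" using ln_le_minus_one[of "2::real"] by simp
    ultimately show ?thesis by linarith
  qed
  moreover have "0 \<le> \<bar>t\<bar> powr - (1 / 2)" by simp
  ultimately have "\<bar>ln w\<bar> \<le> 1 + 2 * \<bar>t\<bar> powr - (1 / 2)" by linarith
  thus ?thesis by (simp add: log_ker_def w_def)
qed (simp add: log_ker_def)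

lemma log_ker_absolutely_integrable: "log_ker absolutely_integrable_on {-pi..pi}"
proof (rule measurable_bounded_by_integrable_imp_absolutely_integrable)
  show "log_ker \<in> borel_measurable (lebesgue_on {-pi..pi})"
    unfolding log_ker_def by (intro borel_measurable_lebesgue_on) measurable
  show "(\<lambda>t. 1 + 2 * \<bar>t\<bar> powr - (1 / 2)) integrable_on {-pi..pi}"
    using abs_powr_integrable_bound(1)[of "1/2" 0 "-pi" pi]
    by (intro integrable_add integrable_on_mult_right) auto
qed (use log_ker_abs_le in auto)

lemma K_ker_absolutely_integrable: "K_ker absolutely_integrable_on {-pi..pi}"
proof -
  have "(\<lambda>t. log_ker t * (1 / pi)) absolutely_integrable_on {-pi..pi}"
    by (intro absolutely_integrable_mult_continuous log_ker_absolutely_integrable) auto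
  moreover have "smooth_ker absolutely_integrable_on {-pi..pi}"
    by (intro absolutely_integrable_continuous_real smooth_ker_continuous)
  ultimately show ?thesis unfolding K_ker_def by (intro set_integral_diff) auto
qed

section \<open>Numerical bounds, monotonicity and positivity of the kernel\<close>

lemma exp_2_bounds: "7 \<le> exp (2::real)" "exp (2::real) \<le> 37 / 5"
  and exp_4_bounds: "49 \<le> exp (4::real)" "exp (4::real) \<le> 55"
proof -
  have e2: "exp (2::real) = exp 1 ^ 2" and e4: "exp (4::real) = exp 2 ^ 2"
    using exp_double[of "1::real"] exp_double[of "2::real"] by simp_all
  have "(\<Sum>n<5. inverse (fact n) * (1::real) ^ n) \<le> (\<Sum>n. inverse (fact n) * 1 ^ n)"
    by (rule sum_le_suminf) (use summable_exp[of 1] in auto)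
  also have "\<dots> = exp 1" by (simp add: exp_def scaleR_conv_of_real divide_inverse)
  also have "(\<Sum>n<5. inverse (fact n) * (1::real) ^ n) = 65 / 24"
    by (simp add: lessThan_nat_numeral fact_numeral)
  finally have "27 / 10 \<le> exp (1::real)" by simp
  hence "(27 / 10) ^ 2 \<le> exp (1::real) ^ 2" by (intro power_mono) auto
  thus 1: "7 \<le> exp (2::real)" unfolding e2 by (simp add: power2_eq_square)
  have "exp (1::real) ^ 2 \<le> (272 / 100) ^ 2" using e_less_272 by (intro power_mono) auto
  thus 2: "exp (2::real) \<le> 37 / 5" unfolding e2 by (simp add: power2_eq_square)
  have "7 ^ 2 \<le> exp (2::real) ^ 2" using 1 by (intro power_mono) auto
  thus "49 \<le> exp (4::real)" by (simp add: e4)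
  have "exp (2::real) ^ 2 \<le> (37 / 5) ^ 2" using 2 by (intro power_mono) auto
  thus "exp (4::real) \<le> 55" by (simp add: e4 power2_eq_square)
qed

text \<open>From \<open>7 \<le> exp 2\<close>. Such decay makes everything beyond the second term of
  the correction series numerically small, so the shape of the kernel is decided by
  \<open>kw 1\<close> and \<open>kw 2\<close>.\<close>

lemma kw_le_seventh: "real n * kw n \<le> (1 / 7) ^ n"
proof (cases "n = 0")
  case False
  have "7 ^ n \<le> exp (2::real) ^ n" using exp_2_bounds by (intro power_mono) auto
  hence "7 ^ n \<le> exp (2 * real n) + 1" by (simp add: exp_of_nat_mult[symmetric] mult.commute)
  hence "1 / (exp (2 * real n) + 1) \<le> 1 / 7 ^ n" by (intro divide_left_mono) (auto intro!: mult_pos_pos add_pos_pos)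
  thus ?thesis using False by (simp add: kw_def power_one_over)
qed simp

text \<open>The factor \<open>|sin t|\<close> on the right is the point: near \<open>pi\<close> the
  derivative of the logarithmic part vanishes like \<open>sin t\<close>, and the correction series
  has to vanish at the same rate.\<close>

lemma abs_sin_mult_le: "\<bar>sin (real n * t)\<bar> \<le> real n * \<bar>sin t\<bar>"
proof (induction n)
  case (Suc n)
  have "\<bar>sin (real (Suc n) * t)\<bar> = \<bar>sin (real n * t) * cos t + cos (real n * t) * sin t\<bar>"
    by (simp add: algebra_simps sin_add)
  also have "\<dots> \<le> \<bar>sin (real n * t)\<bar> * \<bar>cos t\<bar> + \<bar>cos (real n * t)\<bar> * \<bar>sin t\<bar>"
    by (rule order.trans[OF abs_triangle_ineq]) (simp add: abs_mult)
  also have "\<dots> \<le> \<bar>sin (real n * t)\<bar> * 1 + 1 * \<bar>sin t\<bar>"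
    by (intro add_mono mult_left_mono mult_right_mono) auto
  finally show ?case using Suc by (simp add: algebra_simps)
qed simp

text \<open>The terms 1 and 2 are kept exactly, by the double-angle formula; the tail contributes
  \<open>3 / 343 * (7 / 5) = 3 / 245\<close> times \<open>sin t\<close>.\<close>

lemma kw_sin_series_le:
  assumes "0 \<le> t" "t \<le> pi"
  shows "(\<Sum>n. real n * kw n * sin (real n * t)) \<le>
    sin t * (kw 1 + 4 * kw 2 * cos t + 3 / 245)"
proof -
  define f where "f = (\<lambda>n. real n * kw n * sin (real n * t))"
  have sf: "summable f"
    using kw_series_summable[of 1 t "- (pi / 2)"] by (simp add: f_def cos_diff)
  have s0: "sin t \<ge> 0" using assms by (rule sin_ge_zero)
  have tail: "f (n + 3) \<le> 3 / 343 * sin t * (2 / 7) ^ n" for n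
  proof -
    \<comment> \<open>Absorbing the linear factor into a power of 2 leaves a geometric series of
      ratio \<open>2 / 7\<close>.\<close>
    have n: "real (n + 3) \<le> 3 * 2 ^ n" by (induction n) auto
    have "f (n + 3) \<le> (real (n + 3) * kw (n + 3)) * \<bar>sin (real (n + 3) * t)\<bar>"
      unfolding f_def by (intro mult_left_mono) (auto simp: kw_nonneg)
    also have "\<dots> \<le> (1 / 7) ^ (n + 3) * (real (n + 3) * \<bar>sin t\<bar>)"
      by (intro mult_mono kw_le_seventh abs_sin_mult_le) auto
    also have "\<dots> \<le> (1 / 7) ^ (n + 3) * ((3 * 2 ^ n) * \<bar>sin t\<bar>)"
      using n by (intro mult_left_mono mult_right_mono) auto
    also have "\<dots> = 3 / 343 * sin t * (2 / 7) ^ n"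
      using s0 by (simp add: power_add power_divide field_simps)
    finally show ?thesis .
  qed
  have "suminf f = (\<Sum>n. f (n + 3)) + (\<Sum>n<3. f n)"
    by (rule suminf_split_initial_segment[OF sf])
  also have "(\<Sum>n. f (n + 3)) \<le> (\<Sum>n. 3 / 343 * sin t * (2 / 7) ^ n)"
    using sf by (intro suminf_le tail summable_mult summable_geometric) (auto simp: summable_iff_shift)
  also have "\<dots> = 3 / 245 * sin t"
    using suminf_mult[OF summable_geometric[of "2/7::real"], of "3 / 343 * sin t"]
    by (simp add: suminf_geometric)
  also have "(\<Sum>n<3. f n) = sin t * (kw 1 + 4 * kw 2 * cos t)"
    using sin_double[of t] by (simp add: f_def numeral_3_eq_3 numeral_2_eq_2 algebra_simps)
  finally show ?thesis by (simp add: f_def algebra_simps)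
qed

lemma log_ker_has_derivative:
  assumes "sin (t / 2) \<noteq> 0"
  shows "(log_ker has_real_derivative cos (t / 2) / (2 * sin (t / 2))) (at t)"
proof -
  \<comment> \<open>Half the logarithm of the square has no absolute value to differentiate.\<close>
  have eq: "log_ker = (\<lambda>t. ln ((2 * sin (t / 2))\<^sup>2) / 2)"
  proof
    fix t :: real
    have "ln ((2 * sin (t / 2))\<^sup>2) = 2 * ln \<bar>2 * sin (t / 2)\<bar>"
      using ln_realpow[of "\<bar>2 * sin (t / 2)\<bar>" 2]
      by (cases "sin (t / 2) = 0") auto
    thus "log_ker t = ln ((2 * sin (t / 2))\<^sup>2) / 2" by (simp add: log_ker_def)
  qed
  show ?thesis unfolding eq using assms
    by (auto intro!: derivative_eq_intros simp: power2_eq_square zero_less_mult_iff)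
qed

lemma K_ker_has_derivative:
  assumes "sin (t / 2) \<noteq> 0"
  shows "(K_ker has_real_derivative
     (2 / pi * (\<Sum>n. real n * kw n * sin (real n * t)) - cos (t / 2) / (2 * sin (t / 2)) / pi)) (at t)"
proof -
  have "(K_ker has_real_derivative (0 - 4 * kw_series 1 t) / (2 * pi) - cos (t / 2) / (2 * sin (t / 2)) / pi) (at t)"
    unfolding K_ker_def smooth_ker_def
    using kw_series_has_derivative[of 0 t]
    by (auto intro!: derivative_eq_intros log_ker_has_derivative[OF assms])
  thus ?thesis unfolding kw_series_1 by simp
qed

text \<open>Subtracting a small multiple of the cosine quantifies the strict monotonicity of the kernel.\<close>

lemma K_ker_minus_cos_antimono:
  assumes "0 < s" "s \<le> t" "t \<le> pi"
  shows "K_ker t - cos t / 200 \<le> K_ker s - cos s / 200"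
proof (rule DERIV_nonpos_imp_nonincreasing[OF assms(2)])
  fix x assume x: "s \<le> x" "x \<le> t"
  define \<sigma> where "\<sigma> = (sin (x / 2))\<^sup>2"
  define b where "b = 1 / (exp (4::real) + 1)"
  have sp: "sin (x / 2) > 0" using x assms by (intro sin_gt_zero) auto
  have \<sigma>: "0 < \<sigma>" "\<sigma> \<le> 1" using sp by (auto simp: \<sigma>_def abs_square_le_1)
  have cx: "cos x = 1 - 2 * \<sigma>" using cos_double_sin[of "x / 2"] by (simp add: \<sigma>_def)
  have sx: "sin x = 2 * sin (x / 2) * cos (x / 2)" using sin_double[of "x / 2"] by simp
  have s0: "sin x \<ge> 0" using x assms by (intro sin_ge_zero) auto
  have k1: "kw 1 \<le> 1 / 8" using exp_2_bounds by (simp add: kw_def divide_simps)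
  have k2: "2 * kw 2 = b" by (simp add: kw_def b_def divide_simps)
  have a: "1 / 56 \<le> b" "b \<le> 1 / 50"
    using exp_4_bounds unfolding b_def by (auto simp: divide_simps)
  define p where "p = b * (1 - 2 * \<sigma>)"
  \<comment> \<open>Up to the nonnegative factor \<open>sin x / (4 * \<sigma> * pi)\<close> the
    derivative is at most the left side minus 1, with 16 in place of \<open>4 * pi\<close>. What
    remains is a polynomial inequality in \<open>\<sigma>\<close>. As
    \<open>cos x = 1 - 2 * \<sigma>\<close> changes sign at \<open>1 / 2\<close>, the upper bound on
    \<open>b\<close> counts before that point and the lower bound after it.\<close>
  have main: "8 * \<sigma> * (1 / 8 + 2 * p + 3 / 245) + \<sigma> * 16 / 200 \<le> 1"
  proof (cases "\<sigma> \<le> 1 / 2")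
    case True
    have "p \<le> 1 / 50 * 1" unfolding p_def
      using True \<sigma> a by (intro mult_mono) auto
    moreover have "0 \<le> p" using True a unfolding p_def by (intro mult_nonneg_nonneg) auto
    ultimately have "8 * \<sigma> * (1 / 8 + 2 * p + 3 / 245) \<le> (8 * (1 / 2)) * (1 / 8 + 2 * (1 / 50) + 3 / 245)"
      using True \<sigma> by (intro mult_mono) auto
    thus ?thesis using True by simp
  next
    case False
    have "b * (2 * \<sigma> - 1) \<ge> 1 / 56 * (2 * \<sigma> - 1)"
      using False a by (intro mult_right_mono) auto
    hence "p \<le> - (1 / 56 * (2 * \<sigma> - 1))" by (simp add: p_def algebra_simps)
    hence "8 * \<sigma> * (1 / 8 + 2 * p + 3 / 245) \<le> 8 * \<sigma> * (1 / 8 + 2 * (- (1 / 56 * (2 * \<sigma> - 1))) + 3 / 245)"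
      using \<sigma> by (intro mult_left_mono add_mono) auto
    also have "\<dots> \<le> 9 / 10"
    proof -
      \<comment> \<open>The tangent at \<open>\<sigma> = 1\<close> replaces the square by a linear
        function.\<close>
      have "0 \<le> (1 - \<sigma>) * (1 - \<sigma>)" by simp
      hence "\<sigma> * 2 \<le> 1 + \<sigma> * \<sigma>" by (simp add: algebra_simps)
      moreover have "8 * \<sigma> * (1 / 8 + 2 * (- (1 / 56 * (2 * \<sigma> - 1))) + 3 / 245)
          = 339 / 245 * \<sigma> - 4 / 7 * (\<sigma> * \<sigma>)" by (simp add: field_simps)
      ultimately show ?thesis using \<sigma> by linarith
    qed
    finally show ?thesis using \<sigma> by linarith
  qed
  define S where "S = (\<Sum>n. real n * kw n * sin (real n * x))"
  define q where "q = 1 / 8 + 2 * p + 3 / 245"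
  have "S \<le> sin x * (kw 1 + 4 * kw 2 * cos x + 3 / 245)"
    unfolding S_def using x assms by (intro kw_sin_series_le) auto
  also have "4 * kw 2 * cos x = 2 * p" by (simp add: cx p_def k2[symmetric])
  also have "sin x * (kw 1 + 2 * p + 3 / 245) \<le> sin x * q"
    unfolding q_def using s0 k1 by (intro mult_left_mono add_right_mono) auto
  finally have "2 / pi * S \<le> 2 / pi * (sin x * q)" by (rule mult_left_mono) auto
  hence "2 / pi * S - cos (x / 2) / (2 * sin (x / 2)) / pi + sin x / 200
     \<le> 2 / pi * (sin x * q) - cos (x / 2) / (2 * sin (x / 2)) / pi + sin x / 200" by linarith
  also have e: "cos (x / 2) / (2 * sin (x / 2)) = sin x / (4 * \<sigma>)"
    using sp by (simp add: sx \<sigma>_def power2_eq_square)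
  also have "2 / pi * (sin x * q) - sin x / (4 * \<sigma>) / pi + sin x / 200
      = sin x / (4 * \<sigma> * pi) * (8 * \<sigma> * q - 1 + \<sigma> * (4 * pi) / 200)"
    using \<sigma> by (simp add: field_simps)
  also have "\<dots> \<le> 0"
  proof (intro mult_nonneg_nonpos)
    have "\<sigma> * (4 * pi) / 200 \<le> \<sigma> * 16 / 200" using \<sigma> pi_less_4 by simp
    thus "8 * \<sigma> * q - 1 + \<sigma> * (4 * pi) / 200 \<le> 0"
      using main unfolding q_def[symmetric] by linarith
  qed (use s0 \<sigma> in auto)
  finally have "2 / pi * S - cos (x / 2) / (2 * sin (x / 2)) / pi + sin x / 200 \<le> 0" unfolding e .
  moreover have "((\<lambda>t. K_ker t - cos t / 200) has_real_derivative
      (2 / pi * S - cos (x / 2) / (2 * sin (x / 2)) / pi + sin x / 200)) (at x)"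
    using sp by (auto intro!: derivative_eq_intros K_ker_has_derivative simp: S_def)
  ultimately show "\<exists>y. ((\<lambda>t. K_ker t - cos t / 200) has_real_derivative y) (at x) \<and> y \<le> 0" by blast
qed

lemma K_ker_antimono:
  assumes "0 < s" "s \<le> t" "t \<le> pi"
  shows "K_ker t \<le> K_ker s"
  using K_ker_minus_cos_antimono[OF assms] cos_monotone_0_pi_le[of s t] assms by simp

text \<open>By \<open>K_ker_antimono\<close> the value at \<open>pi\<close> is the least one on
  \<open>(0, pi]\<close>, so this makes the kernel positive off its singularity and the operator
  order preserving. The margin is narrow: about 1.43 against
  \<open>2 * ln 2 \<le> 25 / 18\<close>.\<close>

lemma K_ker_pi_pos: "K_ker pi > 0"
proof -
  define f where "f = (\<lambda>n. kw n * cos (real n * pi))"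
  have sf: "summable f" using kw_series_summable[of 0 pi 0] by (simp add: f_def)
  \<comment> \<open>\<open>1029 = 3 * 7 ^ 3\<close>, where the factor 3 comes from dividing
    \<open>kw_le_seventh\<close> by \<open>n + 3 \<ge> 3\<close>.\<close>
  have tail: "f (n + 3) \<le> 1 / 1029 * (1 / 7) ^ n" for n
  proof -
    have "f (n + 3) \<le> kw (n + 3) * 1" unfolding f_def by (intro mult_left_mono) (auto simp: kw_nonneg)
    also have "3 * kw (n + 3) \<le> real (n + 3) * kw (n + 3)" by (intro mult_right_mono) (auto simp: kw_nonneg)
    hence "kw (n + 3) * 1 \<le> (1 / 7) ^ (n + 3) / 3" using kw_le_seventh[of "n + 3"] by linarith
    also have "\<dots> = 1 / 1029 * (1 / 7) ^ n" by (simp add: power_add field_simps)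
    finally show ?thesis .
  qed
  have "suminf f = (\<Sum>n. f (n + 3)) + (\<Sum>n<3. f n)"
    by (rule suminf_split_initial_segment[OF sf])
  also have "(\<Sum>n. f (n + 3)) \<le> (\<Sum>n. 1 / 1029 * (1 / 7) ^ n)"
    using sf by (intro suminf_le tail summable_mult summable_geometric) (auto simp: summable_iff_shift)
  also have "\<dots> = 1 / 882"
    using suminf_mult[OF summable_geometric[of "1/7::real"], of "1 / 1029"]
    by (simp add: suminf_geometric)
  also have "(\<Sum>n<3. f n) = kw 2 - kw 1"
    by (simp add: f_def eval_nat_numeral)
  finally have "kw_series 0 pi \<le> 1 / 882 + kw 2 - kw 1" by (simp add: f_def kw_series_0)
  moreover have "5 / 42 \<le> kw 1" using exp_2_bounds by (simp add: kw_def divide_simps)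
  moreover have "kw 2 \<le> 1 / 100" using exp_4_bounds by (simp add: kw_def divide_simps)
  ultimately have "1 - 4 * kw_series 0 pi \<ge> 1 + 4 * (5 / 42 - 1 / 100 - 1 / 882)"
    by (simp add: field_simps)
  hence "1 - 4 * kw_series 0 pi - 2 * ln 2 > 0" using ln2_le_25_over_36 by simp
  hence "0 < (1 - 4 * kw_series 0 pi - 2 * ln 2) / (2 * pi)" by simp
  also have "\<dots> = K_ker pi" by (simp add: K_ker_def smooth_ker_def log_ker_def diff_divide_distrib)
  finally show ?thesis .
qed

lemma K_ker_ge:
  assumes "0 < \<bar>t\<bar>" "\<bar>t\<bar> \<le> pi"
  shows "K_ker pi \<le> K_ker t"
  using K_ker_antimono[of "\<bar>t\<bar>" pi] assms K_ker_even[of t] by (cases "t \<ge> 0") auto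

section \<open>Fourier series of the convolution\<close>

text \<open>Normalised as a Fourier coefficient, with \<open>1 / (2 * pi)\<close> for every
  \<open>n\<close>; cosine expansions therefore carry a factor 2 on all modes
  \<open>n > 0\<close>.\<close>

definition fcos :: "(real \<Rightarrow> real) \<Rightarrow> nat \<Rightarrow> real" where
  "fcos f n = integral {-pi..pi} (\<lambda>y. f y * cos (real n * y)) / (2 * pi)"

lemma fourier_coeff_even:
  fixes f :: "real \<Rightarrow> real"
  assumes "continuous_on UNIV f" "\<And>x. f (- x) = f x"
  shows "fourier_coeff (\<lambda>y. complex_of_real (f y)) k = complex_of_real (fcos f (nat \<bar>k\<bar>))"
proof -
  have cf: "continuous_on {-pi..pi} f" using assms(1) continuous_on_subset by blast
  have c: "cos (\<bar>real_of_int k\<bar> * y) = cos (of_int k * y)" for y by (cases "k \<ge> 0") auto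
  have i1: "(\<lambda>y. complex_of_real (f y) * cis (- (of_int k * y))) integrable_on {-pi..pi}"
    using cf by (intro integrable_continuous_interval continuous_intros)
  have i2: "(\<lambda>y. f y * cos (of_int k * y)) integrable_on {-pi..pi}"
    using cf by (intro integrable_continuous_interval continuous_intros)
  have "integral {-pi..pi} (\<lambda>y. complex_of_real (f y) * cis (- (of_int k * y)))
      = integral {0..pi} (\<lambda>y. complex_of_real (f y * cos (of_int k * y) + f (- y) * cos (of_int k * (- y))))"
    unfolding integral_even_half(2)[OF i1 pi_ge_zero]
    by (intro Henstock_Kurzweil_Integration.integral_cong) (auto simp: complex_eq_iff assms(2))
  also have "\<dots> = complex_of_real (integral {0..pi} (\<lambda>y. f y * cos (of_int k * y) + f (- y) * cos (of_int k * (- y))))"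
    using has_integral_linear[OF integrable_integral[OF integral_even_half(1)[OF i2 pi_ge_zero]] bounded_linear_of_real]
    by (intro integral_unique) (simp add: o_def)
  also have "\<dots> = complex_of_real (integral {-pi..pi} (\<lambda>y. f y * cos (of_int k * y)))"
    by (simp only: integral_even_half(2)[OF i2 pi_ge_zero])
  finally show ?thesis by (simp add: fourier_coeff_def fcos_def c)
qed

lemma integral_cos_int:
  assumes "m \<noteq> 0"
  shows "((\<lambda>y. cos (of_int m * y)) has_integral 0) {-pi..pi}"
proof -
  have "((\<lambda>y. cos (of_int m * y)) has_integral (sin (of_int m * pi) / of_int m - sin (of_int m * - pi) / of_int m)) {-pi..pi}"
    using assms
    by (intro fundamental_theorem_of_calculus)
       (auto intro!: derivative_eq_intros simp flip: has_real_derivative_iff_has_vector_derivative)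
  thus ?thesis by (simp add: sin_npi_int mult.commute)
qed

lemma integral_cos_cos:
  fixes j k :: nat
  assumes "k > 0"
  shows "((\<lambda>y. cos (real j * y) * cos (real k * y)) has_integral (if j = k then pi else 0)) {-pi..pi}"
proof -
  have A: "((\<lambda>y. cos (of_int (int j - int k) * y)) has_integral (if j = k then 2 * pi else 0)) {-pi..pi}"
    using integral_cos_int[of "int j - int k"] has_integral_const_real[of "1::real" "-pi" pi] by auto
  have B: "((\<lambda>y. cos (of_int (int j + int k) * y)) has_integral 0) {-pi..pi}"
    using assms by (intro integral_cos_int) auto
  have "((\<lambda>y. (1 / 2) * (cos (of_int (int j - int k) * y) + cos (of_int (int j + int k) * y))) has_integral
      (1 / 2) * ((if j = k then 2 * pi else 0) + 0)) {-pi..pi}"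
    by (intro has_integral_mult_right has_integral_add A B)
  moreover have "(1 / 2) * (cos (of_int (int j - int k) * y) + cos (of_int (int j + int k) * y)) = cos (real j * y) * cos (real k * y)" for y
    by (simp add: cos_add cos_diff algebra_simps)
  ultimately show ?thesis by (auto split: if_splits)
qed

text \<open>Bessel's inequality, from expanding the integral of the square of
  \<open>f y - 2 * (\<Sum>k\<in>A. c k * cos (k * y))\<close>. In the normalisation of
  \<open>fcos\<close> the factor 2 makes the subtracted sum the orthogonal projection; mode 0 has a
  different norm and is left out.\<close>

lemma fcos_bessel:
  fixes f :: "real \<Rightarrow> real"
  assumes "continuous_on UNIV f"
  shows "summable (\<lambda>n. (fcos f n)\<^sup>2)"
proof (subst summable_Suc_iff[symmetric], rule bounded_imp_summable)
  have cf: "continuous_on {-pi..pi} f" using assms(1) continuous_on_subset by blast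
  fix n
  define A where "A = {1..Suc n}"
  define c where "c = fcos f"
  have fin: "finite A" by (simp add: A_def)
  have i0: "((\<lambda>y. f y * f y) has_integral integral {-pi..pi} (\<lambda>y. f y * f y)) {-pi..pi}"
    using cf by (intro integrable_integral integrable_continuous_interval continuous_intros)
  have i1: "((\<lambda>y. f y * cos (real k * y)) has_integral (2 * pi * c k)) {-pi..pi}" for k
  proof -
    have "(\<lambda>y. f y * cos (real k * y)) integrable_on {-pi..pi}"
      using cf by (intro integrable_continuous_interval continuous_intros)
    thus ?thesis by (simp add: c_def fcos_def has_integral_integral)
  qed
  have "((\<lambda>y. f y * f y - 4 * (\<Sum>k\<in>A. c k * (f y * cos (real k * y)))
      + 4 * (\<Sum>j\<in>A. \<Sum>k\<in>A. (c j * c k) * (cos (real j * y) * cos (real k * y)))) has_integral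
      integral {-pi..pi} (\<lambda>y. f y * f y) - 4 * (\<Sum>k\<in>A. c k * (2 * pi * c k))
      + 4 * (\<Sum>j\<in>A. \<Sum>k\<in>A. (c j * c k) * (if j = k then pi else 0))) {-pi..pi}"
    by (intro has_integral_add has_integral_diff has_integral_mult_right has_integral_sum i0 i1 fin integral_cos_cos)
       (auto simp: A_def)
  moreover have "f y * f y - 4 * (\<Sum>k\<in>A. c k * (f y * cos (real k * y)))
      + 4 * (\<Sum>j\<in>A. \<Sum>k\<in>A. (c j * c k) * (cos (real j * y) * cos (real k * y))) = (f y - 2 * (\<Sum>k\<in>A. c k * cos (real k * y)))\<^sup>2" for y
  proof -
    have "(\<Sum>j\<in>A. \<Sum>k\<in>A. (c j * c k) * (cos (real j * y) * cos (real k * y))) = (\<Sum>k\<in>A. c k * cos (real k * y))\<^sup>2"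
      by (simp add: power2_eq_square sum_product mult_ac)
    moreover have "(\<Sum>k\<in>A. c k * (f y * cos (real k * y))) = f y * (\<Sum>k\<in>A. c k * cos (real k * y))"
      by (simp add: sum_distrib_left mult_ac)
    ultimately show ?thesis by (simp add: power2_eq_square algebra_simps)
  qed
  ultimately have h: "((\<lambda>y. (f y - 2 * (\<Sum>k\<in>A. c k * cos (real k * y)))\<^sup>2) has_integral
      integral {-pi..pi} (\<lambda>y. f y * f y) - 4 * (\<Sum>k\<in>A. c k * (2 * pi * c k))
      + 4 * (\<Sum>j\<in>A. \<Sum>k\<in>A. (c j * c k) * (if j = k then pi else 0))) {-pi..pi}" by simp
  have "(\<Sum>j\<in>A. \<Sum>k\<in>A. (c j * c k) * (if j = k then pi else 0)) = pi * (\<Sum>k\<in>A. (c k)\<^sup>2)"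
  proof -
    have "(\<Sum>k\<in>A. (c j * c k) * (if j = k then pi else 0)) = pi * (c j)\<^sup>2" if "j \<in> A" for j
    proof -
      have "(\<Sum>k\<in>A. (c j * c k) * (if j = k then pi else 0)) = (\<Sum>k\<in>A. if j = k then c j * c k * pi else 0)"
        by (rule sum.cong) auto
      thus ?thesis using fin that by (simp add: sum.delta power2_eq_square)
    qed
    thus ?thesis by (simp add: sum_distrib_left)
  qed
  moreover have "(\<Sum>k\<in>A. c k * (2 * pi * c k)) = 2 * pi * (\<Sum>k\<in>A. (c k)\<^sup>2)"
    by (simp add: sum_distrib_left power2_eq_square mult_ac)
  ultimately have "0 \<le> integral {-pi..pi} (\<lambda>y. f y * f y) - 4 * pi * (\<Sum>k\<in>A. (c k)\<^sup>2)"
    using has_integral_nonneg[OF h] by simp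
  moreover have "(\<Sum>k\<in>A. (c k)\<^sup>2) = (\<Sum>k\<le>n. (c (Suc k))\<^sup>2)"
    unfolding A_def using sum.atLeast1_atMost_eq[of "\<lambda>k. (c k)\<^sup>2" "Suc n"] by (simp add: lessThan_Suc_atMost)
  ultimately show "(\<Sum>k\<le>n. (fcos f (Suc k))\<^sup>2) \<le> integral {-pi..pi} (\<lambda>y. f y * f y) / (4 * pi)"
    by (simp add: c_def field_simps)
qed auto

text \<open>The symbol decays only like \<open>1 / n\<close>, which is not summable; the inequality
  \<open>2 a b \<le> a a + b b\<close> pairs it with the square summable coefficients.\<close>

lemma fcos_div_summable:
  fixes f :: "real \<Rightarrow> real"
  assumes "continuous_on UNIV f"
  shows "summable (\<lambda>n. \<bar>fcos f n\<bar> / real n)"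
proof (rule summable_comparison_test')
  show "summable (\<lambda>n. (fcos f n)\<^sup>2 + inverse (real n ^ 2))"
    by (intro summable_add fcos_bessel assms inverse_power_summable) auto
next
  fix n :: nat
  have "2 * (\<bar>fcos f n\<bar> * (1 / real n)) \<le> \<bar>fcos f n\<bar>\<^sup>2 + (1 / real n)\<^sup>2"
    using sum_squares_bound[of "\<bar>fcos f n\<bar>" "1 / real n"] by (simp add: mult.assoc)
  moreover have "0 \<le> \<bar>fcos f n\<bar> * (1 / real n)" by simp
  moreover have "\<bar>fcos f n\<bar>\<^sup>2 = (fcos f n)\<^sup>2" by simp
  ultimately have "\<bar>fcos f n\<bar> * (1 / real n) \<le> (fcos f n)\<^sup>2 + (1 / real n)\<^sup>2"
    by linarith
  thus "norm (\<bar>fcos f n\<bar> / real n) \<le> (fcos f n)\<^sup>2 + inverse (real n ^ 2)"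
    by (simp add: power_one_over inverse_eq_divide)
qed

text \<open>Addition theorem; the sine part drops out because \<open>f\<close> is even.\<close>

lemma fcos_mult_cos:
  assumes "continuous_on UNIV f" "\<And>x. f (- x) = f x"
  shows "fcos f n * cos (real n * x) = integral {-pi..pi} (\<lambda>y. cos (real n * (x - y)) * f y) / (2 * pi)"
proof -
  have cf: "continuous_on {-pi..pi} f" using assms(1) continuous_on_subset by blast
  have i1: "(\<lambda>y. cos (real n * (x - y)) * f y) integrable_on {-pi..pi}"
    using cf by (intro integrable_continuous_interval continuous_intros)
  have i2: "(\<lambda>y. f y * cos (real n * y)) integrable_on {-pi..pi}"
    using cf by (intro integrable_continuous_interval continuous_intros)
  have "integral {-pi..pi} (\<lambda>y. cos (real n * (x - y)) * f y) =
     integral {0..pi} (\<lambda>y. cos (real n * (x - y)) * f y + cos (real n * (x - - y)) * f (- y))"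
    by (rule integral_even_half(2)[OF i1 pi_ge_zero])
  also have "\<dots> = integral {0..pi} (\<lambda>y. cos (real n * x) * (f y * cos (real n * y) + f (- y) * cos (real n * - y)))"
    by (intro Henstock_Kurzweil_Integration.integral_cong)
       (simp add: assms(2) right_diff_distrib ring_distribs cos_add cos_diff)
  also have "\<dots> = cos (real n * x) * integral {0..pi} (\<lambda>y. f y * cos (real n * y) + f (- y) * cos (real n * - y))"
    by (rule Henstock_Kurzweil_Integration.integral_mult_right)
  also have "\<dots> = cos (real n * x) * integral {-pi..pi} (\<lambda>y. f y * cos (real n * y))"
    by (simp only: integral_even_half(2)[OF i2 pi_ge_zero])
  finally show ?thesis by (simp add: fcos_def)
qed

text \<open>Summable weights allow integration term by term, by uniform convergence. The weights
  \<open>1 / n\<close> of the logarithm are not covered and are reached as limits of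
  \<open>r ^ n / n\<close>.\<close>

lemma fcos_series_eq_integral:
  assumes "continuous_on UNIV f" "\<And>x. f (- x) = f x" "summable (\<lambda>n. \<bar>w n\<bar>)"
  shows "(\<lambda>n. w n * (fcos f n * cos (real n * x))) sums
     (integral {-pi..pi} (\<lambda>y. (\<Sum>n. w n * cos (real n * (x - y))) * f y) / (2 * pi))"
proof -
  have cf: "continuous_on {-pi..pi} f" using assms(1) continuous_on_subset by blast
  have "bounded (f ` {-pi..pi})" using cf by (intro compact_imp_bounded compact_continuous_image) auto
  then obtain M where M: "\<And>y. y \<in> {-pi..pi} \<Longrightarrow> \<bar>f y\<bar> \<le> M" unfolding bounded_real by blast
  define g where "g = (\<lambda>n y. w n * cos (real n * (x - y)) * f y)"
  have s: "summable (\<lambda>n. w n * cos (real n * (x - y)))" for y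
  proof (rule summable_comparison_test'[OF assms(3)])
    fix n show "norm (w n * cos (real n * (x - y))) \<le> \<bar>w n\<bar>"
      by (simp add: abs_mult mult_left_le)
  qed
  have "uniform_limit {-pi..pi} (\<lambda>n y. \<Sum>i<n. g i y) (\<lambda>y. \<Sum>i. g i y) sequentially"
  proof (rule Weierstrass_m_test)
    fix n y assume y: "y \<in> {-pi..pi}"
    have "\<bar>w n\<bar> * \<bar>cos (real n * (x - y))\<bar> * \<bar>f y\<bar> \<le> \<bar>w n\<bar> * 1 * M"
      using M[OF y] by (intro mult_mono) auto
    thus "norm (g n y) \<le> \<bar>w n\<bar> * M" by (simp add: g_def abs_mult)
  qed (intro summable_mult2 assms)
  also have "(\<lambda>y. \<Sum>i. g i y) = (\<lambda>y. (\<Sum>i. w i * cos (real i * (x - y))) * f y)"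
    unfolding g_def using s by (intro ext suminf_mult2[symmetric]) auto
  finally obtain I J where IJ: "\<And>n. ((\<lambda>y. \<Sum>i<n. g i y) has_integral I n) {-pi..pi}"
      "((\<lambda>y. (\<Sum>i. w i * cos (real i * (x - y))) * f y) has_integral J) {-pi..pi}" "I \<longlonglongrightarrow> J"
    by (rule uniform_limit_integral) (auto simp: g_def intro!: continuous_intros cf)
  have "I n = (\<Sum>i<n. w i * (fcos f i * cos (real i * x))) * (2 * pi)" for n
  proof -
    have "((\<lambda>y. \<Sum>i<n. w i * (cos (real i * (x - y)) * f y)) has_integral
       (\<Sum>i<n. w i * (fcos f i * cos (real i * x) * (2 * pi)))) {-pi..pi}"
    proof (intro has_integral_sum has_integral_mult_right)
      fix i
      have "(\<lambda>y. cos (real i * (x - y)) * f y) integrable_on {-pi..pi}"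
        using cf by (intro integrable_continuous_interval continuous_intros)
      thus "((\<lambda>y. cos (real i * (x - y)) * f y) has_integral fcos f i * cos (real i * x) * (2 * pi)) {-pi..pi}"
        using fcos_mult_cos[OF assms(1,2), of i x] by (simp add: has_integral_integral)
    qed auto
    hence "((\<lambda>y. \<Sum>i<n. g i y) has_integral
       (\<Sum>i<n. w i * (fcos f i * cos (real i * x))) * (2 * pi)) {-pi..pi}"
      by (simp add: g_def sum_distrib_right mult.assoc)
    thus ?thesis using IJ(1)[of n] by (rule has_integral_unique[symmetric])
  qed
  hence "(\<lambda>n. (\<Sum>i<n. w i * (fcos f i * cos (real i * x)))) = (\<lambda>n. I n / (2 * pi))" by auto
  moreover have "(\<lambda>n. I n / (2 * pi)) \<longlonglongrightarrow> J / (2 * pi)" by (intro tendsto_intros IJ) auto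
  ultimately show ?thesis using integral_unique[OF IJ(2)] by (simp add: sums_def)
qed

text \<open>Real part of the series of \<open>- ln (1 - r * cis t)\<close>; the argument of the
  logarithm on the right is the squared modulus of \<open>1 - r * cis t\<close>. The term at
  \<open>n = 0\<close> is 0, since division by 0 gives 0.\<close>

lemma cos_series_ln:
  fixes r t :: real
  assumes "0 \<le> r" "r < 1"
  shows "(\<lambda>n. r ^ n / real n * cos (real n * t)) sums (- ln ((1 - r)\<^sup>2 + 4 * r * (sin (t / 2))\<^sup>2) / 2)"
proof -
  define z where "z = - (complex_of_real r * cis t)"
  have nz: "cmod z < 1" using assms by (simp add: z_def norm_mult)
  have "(\<lambda>n. - ((- z) ^ n) / of_nat n) sums ln (1 + z)" by (rule Ln_series'[OF nz])
  hence "(\<lambda>n. Re (- ((- z) ^ n) / of_nat n)) sums Re (ln (1 + z))"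
    by (rule bounded_linear.sums[OF bounded_linear_Re])
  moreover have "Re (- ((- z) ^ n) / of_nat n) = - (r ^ n / real n * cos (real n * t))" for n
    by (simp add: z_def power_mult_distrib Complex.DeMoivre)
  moreover have "Re (ln (1 + z)) = ln ((1 - r)\<^sup>2 + 4 * r * (sin (t / 2))\<^sup>2) / 2"
  proof -
    have "1 + z \<noteq> 0"
    proof
      assume "1 + z = 0"
      hence "z = -1" by (simp add: add_eq_0_iff)
      thus False using nz by simp
    qed
    hence "Re (ln (1 + z)) = ln (cmod (1 + z))" by (rule Re_Ln)
    also have "\<dots> = ln (sqrt ((1 - r)\<^sup>2 + 4 * r * (sin (t / 2))\<^sup>2))"
    proof -
      have "(cmod (1 + z))\<^sup>2 = (1 - r * cos t)\<^sup>2 + (r * sin t)\<^sup>2"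
        by (simp add: cmod_power2 z_def)
      also have "\<dots> = 1 - 2 * r * cos t + r\<^sup>2"
        using sin_cos_squared_add[of t] by algebra
      also have "\<dots> = (1 - r)\<^sup>2 + 4 * r * (sin (t / 2))\<^sup>2"
        using cos_double_sin[of "t / 2"] by (simp add: power2_diff right_diff_distrib)
      finally have "cmod (1 + z) = sqrt ((1 - r)\<^sup>2 + 4 * r * (sin (t / 2))\<^sup>2)"
        using real_sqrt_unique[of "cmod (1 + z)"] by simp
      thus ?thesis by simp
    qed
    also have "\<dots> = ln ((1 - r)\<^sup>2 + 4 * r * (sin (t / 2))\<^sup>2) / 2"
    proof (rule ln_sqrt)
    qed (use assms in \<open>auto intro!: add_pos_nonneg\<close>)
    finally show ?thesis .
  qed
  ultimately have "(\<lambda>n. - (r ^ n / real n * cos (real n * t))) sums (ln ((1 - r)\<^sup>2 + 4 * r * (sin (t / 2))\<^sup>2) / 2)" by (simp only:)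
  from sums_minus[OF this] show ?thesis by simp
qed

text \<open>Dominated convergence as \<open>r\<close> tends to 1, the integral half of Abel
  summation.\<close>

lemma log_integral_regularized_tendsto:
  fixes g :: "real \<Rightarrow> real"
  assumes "continuous_on {-pi..pi} g"
  defines "r \<equiv> \<lambda>k::nat. 1 - 1 / (real k + 2)"
  shows "(\<lambda>k. integral {-pi..pi} (\<lambda>t. - ln ((1 - r k)\<^sup>2 + 4 * r k * (sin (t / 2))\<^sup>2) / 2 * g t))
     \<longlonglongrightarrow> integral {-pi..pi} (\<lambda>t. - log_ker t * g t)"
proof -
  define L where "L = (\<lambda>k t. - ln ((1 - r k)\<^sup>2 + 4 * r k * (sin (t / 2))\<^sup>2) / 2)"
  \<comment> \<open>\<open>r k \<ge> 1 / 2\<close> gives \<open>4 * r k \<ge> 1\<close>, which keeps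
    the regularised argument above \<open>(sin (t / 2))\<^sup>2\<close>. The majorant
    \<open>2 + |log_ker t|\<close> is thus independent of \<open>k\<close>.\<close>
  have r: "1 / 2 \<le> r k" "r k < 1" for k by (auto simp: r_def field_simps)
  have rlim: "r \<longlonglongrightarrow> 1" unfolding r_def by real_asymp
  have "bounded (g ` {-pi..pi})" using assms by (intro compact_imp_bounded compact_continuous_image) auto
  then obtain M where M: "\<And>y. y \<in> {-pi..pi} \<Longrightarrow> \<bar>g y\<bar> \<le> M" unfolding bounded_real by blast
  have M0: "0 \<le> M" using M[of 0] by auto
  have L: "\<bar>L k t\<bar> \<le> 2 + \<bar>log_ker t\<bar>" if t: "t \<in> {-pi..pi}" "t \<noteq> 0" for k t
  proof -
    define s where "s = (sin (t / 2))\<^sup>2"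
    define q where "q = (1 - r k)\<^sup>2 + 4 * r k * s"
    have "sin (t / 2) \<noteq> 0" using t sin_half_eq_0_iff[of t] pi_gt_zero by (auto simp: abs_if)
    hence s: "0 < s" "s \<le> 1" by (auto simp: s_def abs_square_le_1)
    have "1 * s \<le> 4 * r k * s" using r[of k] s by (intro mult_right_mono) auto
    hence q1: "s \<le> q" unfolding q_def by (smt (verit) zero_le_power2)
    have "4 * r k * s \<le> 4 * r k * 1" using r[of k] s by (intro mult_left_mono) auto
    hence "q \<le> (1 + r k)\<^sup>2" by (simp add: q_def power2_eq_square algebra_simps)
    also have "\<dots> \<le> 2\<^sup>2" using r[of k] by (intro power_mono) auto
    finally have q2: "q \<le> 4" by simp
    have "ln q \<le> ln 4" using q1 q2 s by (intro ln_mono) auto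
    also have "ln 4 \<le> (3::real)" using ln_le_minus_one[of "4::real"] by simp
    finally have 1: "ln q \<le> 3" .
    have "ln s \<le> ln q" using q1 s by (intro ln_mono) auto
    moreover have "log_ker t = ln 2 + ln s / 2"
      using \<open>sin (t / 2) \<noteq> 0\<close> ln_realpow[of "\<bar>sin (t / 2)\<bar>" 2]
      by (simp add: log_ker_def s_def abs_mult ln_mult)
    moreover have "ln (2::real) \<le> 1" using ln_le_minus_one[of "2::real"] by simp
    ultimately have 2: "- ln q / 2 \<le> 1 + \<bar>log_ker t\<bar>" by linarith
    show ?thesis unfolding L_def s_def[symmetric] q_def[symmetric] using 1 2 by linarith
  qed
  define F where "F = (\<lambda>k t. if t = 0 then 0 else L k t * g t)"
  have spike: "integral {-pi..pi} (\<lambda>t. L k t * g t) = integral {-pi..pi} (F k)" for k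
    by (rule integral_spike[of "{0}"]) (auto simp: F_def)
  have spike': "integral {-pi..pi} (\<lambda>t. - log_ker t * g t) = integral {-pi..pi} (\<lambda>t. if t = 0 then 0 else - log_ker t * g t)"
    by (rule integral_spike[of "{0}"]) auto
  have "(\<lambda>k. integral {-pi..pi} (F k)) \<longlonglongrightarrow> integral {-pi..pi} (\<lambda>t. if t = 0 then 0 else - log_ker t * g t)"
  proof (rule dominated_convergence(2)[where h = "\<lambda>t. (2 + \<bar>log_ker t\<bar>) * M"])
    fix k
    have pos: "(1 - r k)\<^sup>2 + 4 * r k * (sin (t / 2))\<^sup>2 \<noteq> 0" for t
      using r[of k] by (intro less_imp_neq[THEN not_sym] add_pos_nonneg) (auto simp del: zero_le_mult_iff intro!: mult_nonneg_nonneg)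
    have "(\<lambda>t. L k t * g t) integrable_on {-pi..pi}"
      unfolding L_def using assms(1) pos
      by (intro integrable_continuous_interval continuous_intros) auto
    thus "F k integrable_on {-pi..pi}"
      by (rule integrable_spike[of _ _ "{0}"]) (auto simp: F_def)
  next
    have "(\<lambda>t. \<bar>log_ker t\<bar>) integrable_on {-pi..pi}"
      using log_ker_absolutely_integrable by (auto simp: absolutely_integrable_on_def intro: integrable_neg)
    thus "(\<lambda>t. (2 + \<bar>log_ker t\<bar>) * M) integrable_on {-pi..pi}"
      by (intro integrable_on_mult_left integrable_add) auto
  next
    fix k t assume t: "t \<in> {-pi..pi}"
    show "norm (F k t) \<le> (2 + \<bar>log_ker t\<bar>) * M"
      using L[OF t, of k] M[OF t] M0 by (auto simp: F_def abs_mult intro!: mult_mono)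
  next
    fix t assume t: "t \<in> {-pi..pi}"
    show "(\<lambda>k. F k t) \<longlonglongrightarrow> (if t = 0 then 0 else - log_ker t * g t)"
    proof (cases "t = 0")
      case False
      hence s0: "sin (t / 2) \<noteq> 0" using t sin_half_eq_0_iff[of t] pi_gt_zero by (auto simp: abs_if)
      have "(\<lambda>k. - ln ((1 - r k)\<^sup>2 + 4 * r k * (sin (t / 2))\<^sup>2) / 2 * g t) \<longlonglongrightarrow>
          - ln ((1 - 1)\<^sup>2 + 4 * 1 * (sin (t / 2))\<^sup>2) / 2 * g t"
        using s0 by (intro tendsto_intros rlim) auto
      moreover have "ln ((1 - 1)\<^sup>2 + 4 * 1 * (sin (t / 2))\<^sup>2) / 2 = log_ker t"
        using ln_realpow[of "\<bar>2 * sin (t / 2)\<bar>" 2] s0 by (simp add: log_ker_def power_mult_distrib)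
      ultimately show ?thesis using False by (simp add: F_def L_def)
    qed (simp add: F_def)
  qed
  thus ?thesis unfolding spike' spike[symmetric] L_def .
qed

text \<open>Abel summation: for \<open>r < 1\<close> the identity is
  \<open>fcos_series_eq_integral\<close>. As \<open>r\<close> tends to 1 the series converges by
  Tannery's theorem with majorant \<open>|fcos f n| / n\<close>, and the integral by
  \<open>log_integral_regularized_tendsto\<close>.\<close>

lemma fcos_div_series_eq_integral:
  assumes f: "continuous_on UNIV f" "circle_periodic f" "\<And>x. f (- x) = f x"
  shows "(\<lambda>n. 1 / real n * (fcos f n * cos (real n * x))) sums (circ_conv (\<lambda>t. - log_ker t) f x / (2 * pi))"
proof -
  define r where "r = (\<lambda>k::nat. 1 - 1 / (real k + 2))"
  define c where "c = (\<lambda>n. fcos f n * cos (real n * x))"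
  have r: "0 \<le> r k" "r k < 1" for k by (auto simp: r_def field_simps)
  have rlim: "r \<longlonglongrightarrow> 1" unfolding r_def by real_asymp
  have per_log: "circle_periodic (\<lambda>t. - log_ker t)" using log_ker_periodic by (simp add: circle_periodic_def)
  have int_log: "(\<lambda>t. - log_ker t) absolutely_integrable_on {-pi..pi}"
    using log_ker_absolutely_integrable by (auto simp: absolutely_integrable_on_def intro: integrable_neg)
  have fc: "continuous_on {-pi..pi} (\<lambda>t. f (x - t))"
    by (rule continuous_on_compose2[OF f(1)]) (auto intro!: continuous_intros)
  have 1: "(\<lambda>n. (r k ^ n / real n) * c n) sums
     (integral {-pi..pi} (\<lambda>t. - ln ((1 - r k)\<^sup>2 + 4 * r k * (sin (t / 2))\<^sup>2) / 2 * f (x - t)) / (2 * pi))" for k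
  proof -
    define q where "q = (\<lambda>t. - ln ((1 - r k)\<^sup>2 + 4 * r k * (sin (t / 2))\<^sup>2) / 2)"
    have q: "(\<Sum>n. r k ^ n / real n * cos (real n * t)) = q t" for t
      unfolding q_def by (rule sums_unique[symmetric], rule cos_series_ln[OF r])
    have "summable (\<lambda>n. \<bar>r k ^ n / real n\<bar>)"
    proof (rule summable_comparison_test')
      show "summable (\<lambda>n. r k ^ n)" using r[of k] by (intro summable_geometric) auto
      fix n :: nat
      show "norm \<bar>r k ^ n / real n\<bar> \<le> r k ^ n"
        using r[of k] by (cases "n = 0") (auto simp: divide_le_eq mult_le_cancel_left1)
    qed
    from fcos_series_eq_integral[OF f(1,3) this, of x]
    have "(\<lambda>n. (r k ^ n / real n) * c n) sums (circ_conv q f x / (2 * pi))"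
      unfolding q c_def circ_conv_def by simp
    also have "circ_conv q f x = integral {-pi..pi} (\<lambda>t. q t * f (x - t))"
    proof (rule circ_conv_commute[OF _ _ f(1,2)])
      show "circle_periodic q"
        by (simp add: circle_periodic_def q_def add_divide_distrib sin_add)
      show "q absolutely_integrable_on {-pi..pi}"
        unfolding q_def using r[of k]
        by (intro absolutely_integrable_continuous_real continuous_intros)
           (auto intro!: add_pos_nonneg less_imp_neq[THEN not_sym])
    qed
    finally show ?thesis by (simp add: q_def)
  qed
  have 2: "(\<lambda>k. \<Sum>n. (r k ^ n / real n) * c n) \<longlonglongrightarrow> (\<Sum>n. 1 / real n * c n)"
    and 3: "summable (\<lambda>n. norm (1 / real n * c n))"
  proof -
    have cb: "\<bar>c n\<bar> \<le> \<bar>fcos f n\<bar>" for n by (simp add: c_def abs_mult mult_left_le)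
    have "eventually (\<lambda>k. summable (\<lambda>n. norm ((r k ^ n / real n) * c n))) sequentially \<and>
       summable (\<lambda>n. norm (1 / real n * c n)) \<and>
       (\<lambda>k. \<Sum>n. (r k ^ n / real n) * c n) \<longlonglongrightarrow> (\<Sum>n. 1 / real n * c n)"
    proof (rule tannerys_theorem[where M = "\<lambda>n. \<bar>fcos f n\<bar> / real n"])
      fix n
      have "(\<lambda>k. (r k ^ n / real n) * c n) \<longlonglongrightarrow> (1 ^ n / real n) * c n"
        by (cases "n = 0") (simp, intro tendsto_mult tendsto_divide tendsto_power rlim tendsto_const, simp)
      thus "(\<lambda>k. (r k ^ n / real n) * c n) \<longlonglongrightarrow> 1 / real n * c n" by simp
    next
      have "norm (r k ^ n / real n * c n) \<le> \<bar>fcos f n\<bar> / real n" for k n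
      proof -
        have "\<bar>r k ^ n\<bar> * \<bar>c n\<bar> \<le> 1 * \<bar>fcos f n\<bar>"
          using r[of k] cb[of n] by (intro mult_mono) (auto simp: power_le_one)
        thus ?thesis by (auto simp: abs_mult intro!: divide_right_mono)
      qed
      thus "\<forall>\<^sub>F (n, k) in sequentially \<times>\<^sub>F sequentially. norm (r k ^ n / real n * c n) \<le> \<bar>fcos f n\<bar> / real n"
        by (intro always_eventually) auto
    qed (use fcos_div_summable[OF f(1)] in auto)
    thus "(\<lambda>k. \<Sum>n. (r k ^ n / real n) * c n) \<longlonglongrightarrow> (\<Sum>n. 1 / real n * c n)"
      "summable (\<lambda>n. norm (1 / real n * c n))" by auto
  qed
  have "(\<lambda>k. \<Sum>n. (r k ^ n / real n) * c n) \<longlonglongrightarrow> integral {-pi..pi} (\<lambda>t. - log_ker t * f (x - t)) / (2 * pi)"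
    unfolding sums_unique[OF 1, symmetric] unfolding r_def
    by (intro tendsto_divide log_integral_regularized_tendsto fc) auto
  hence "(\<Sum>n. 1 / real n * c n) = integral {-pi..pi} (\<lambda>t. - log_ker t * f (x - t)) / (2 * pi)"
    using 2 LIMSEQ_unique by blast
  also have "\<dots> = circ_conv (\<lambda>t. - log_ker t) f x / (2 * pi)"
    by (simp add: circ_conv_commute[OF per_log int_log f(1,2)])
  finally show ?thesis using summable_norm_cancel[OF 3] unfolding c_def by (simp add: sums_iff)
qed

lemma circ_conv_linear:
  assumes "circle_periodic k1" "k1 absolutely_integrable_on {-pi..pi}"
    "circle_periodic k2" "k2 absolutely_integrable_on {-pi..pi}" "continuous_on UNIV f"
  shows "circ_conv (\<lambda>t. a * k1 t + b * k2 t) f x = a * circ_conv k1 f x + b * circ_conv k2 f x"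
proof -
  have i: "(\<lambda>y. k1 (x - y) * f y) integrable_on {-pi..pi}" "(\<lambda>y. k2 (x - y) * f y) integrable_on {-pi..pi}"
    using circ_conv_integrable assms unfolding absolutely_integrable_on_def by blast+
  have "((\<lambda>y. a * (k1 (x - y) * f y) + b * (k2 (x - y) * f y)) has_integral
      a * circ_conv k1 f x + b * circ_conv k2 f x) {-pi..pi}"
    unfolding circ_conv_def by (intro has_integral_add has_integral_mult_right integrable_integral i)
  thus ?thesis unfolding circ_conv_def by (intro integral_unique) (simp add: algebra_simps)
qed

lemma K_ker_series:
  assumes f: "continuous_on UNIV f" "circle_periodic f" "\<And>x. f (- x) = f x"
  defines "T \<equiv> \<lambda>n. tanh_symbol (real n) * fcos f n"
  shows "(\<lambda>n. 2 * (T (Suc n) * cos (real (Suc n) * x))) sums (circ_conv K_ker f x - T 0)"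
proof -
  define c where "c = (\<lambda>n. fcos f n * cos (real n * x))"
  have S1: "(\<lambda>n. 1 / real n * c n) sums (circ_conv (\<lambda>t. - log_ker t) f x / (2 * pi))"
    unfolding c_def by (rule fcos_div_series_eq_integral[OF f])
  have "summable (\<lambda>n. \<bar>kw n\<bar>)" using kw_power_summable[of 0] by (simp add: kw_nonneg)
  from fcos_series_eq_integral[OF f(1,3) this, of x]
  have S2: "(\<lambda>n. kw n * c n) sums (circ_conv (kw_series 0) f x / (2 * pi))"
    by (simp add: c_def circ_conv_def kw_series_0)
  have "(\<lambda>n. 2 * (1 / real n * c n) - 4 * (kw n * c n)) sums
    (2 * (circ_conv (\<lambda>t. - log_ker t) f x / (2 * pi)) - 4 * (circ_conv (kw_series 0) f x / (2 * pi)))"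
    by (intro sums_diff sums_mult S1 S2)
  \<comment> \<open>Dropping index 0 changes nothing, since \<open>1 / 0 = 0\<close> and
    \<open>kw 0 = 0\<close>. The constant mode of the operator is supplied by the summand 1 in
    \<open>smooth_ker\<close>, which accounts for \<open>T 0\<close>.\<close>
  hence "(\<lambda>n. 2 * (1 / real (Suc n) * c (Suc n)) - 4 * (kw (Suc n) * c (Suc n))) sums
    (2 * (circ_conv (\<lambda>t. - log_ker t) f x / (2 * pi)) - 4 * (circ_conv (kw_series 0) f x / (2 * pi)))"
    by (subst sums_Suc_iff) simp
  moreover have "2 * (1 / real (Suc n) * c (Suc n)) - 4 * (kw (Suc n) * c (Suc n)) = 2 * (T (Suc n) * cos (real (Suc n) * x))" for n
    unfolding T_def c_def by (subst tanh_symbol_kw) (simp_all add: algebra_simps)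
  moreover have "2 * (circ_conv (\<lambda>t. - log_ker t) f x / (2 * pi)) - 4 * (circ_conv (kw_series 0) f x / (2 * pi))
     = circ_conv K_ker f x - T 0"
  proof -
    have int_log: "(\<lambda>t. - log_ker t) absolutely_integrable_on {-pi..pi}"
      using log_ker_absolutely_integrable by (auto simp: absolutely_integrable_on_def intro: integrable_neg)
    have per_log: "circle_periodic (\<lambda>t. - log_ker t)" using log_ker_periodic by (simp add: circle_periodic_def)
    have ints: "smooth_ker absolutely_integrable_on {-pi..pi}"
      by (intro absolutely_integrable_continuous_real smooth_ker_continuous)
    have eq: "kw_series 0 = (\<lambda>t. (1 / 4) * 1 + (- pi / 2) * smooth_ker t)"
      by (auto simp: smooth_ker_def field_simps)
    have "circ_conv (kw_series 0) f x = (1 / 4) * circ_conv (\<lambda>_. 1) f x + (- pi / 2) * circ_conv smooth_ker f x"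
      unfolding eq by (rule circ_conv_linear[OF _ _ smooth_ker_periodic ints f(1)]) (auto simp: circle_periodic_def)
    moreover have "circ_conv K_ker f x = 1 * circ_conv smooth_ker f x + (1 / pi) * circ_conv (\<lambda>t. - log_ker t) f x"
      unfolding circ_conv_linear[OF smooth_ker_periodic ints per_log int_log f(1), symmetric] by (simp add: K_ker_def[abs_def])
    moreover have "T 0 = circ_conv (\<lambda>_. 1) f x / (2 * pi)"
      by (simp add: T_def tanh_symbol_def fcos_def circ_conv_def)
    ultimately show ?thesis by (simp add: field_simps)
  qed
  ultimately show ?thesis by simp
qed

text \<open>The coefficients of an even function depend on \<open>|k|\<close> only, so the unordered
  sum over the integers, split into its nonnegative and negative halves, pairs up into the cosine
  series of \<open>K_ker_series\<close>.\<close>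

theorem K_op_eq_circ_conv:
  assumes f: "continuous_on UNIV f" "circle_periodic f" "\<And>x. f (- x) = f x"
  shows "K_op (\<lambda>y. complex_of_real (f y)) x = complex_of_real (circ_conv K_ker f x)"
proof -
  define T where "T = (\<lambda>n. tanh_symbol (real n) * fcos f n)"
  define F where "F = (\<lambda>k::int. complex_of_real (T (nat \<bar>k\<bar>)) * cis (of_int k * x))"
  have ts: "tanh_symbol (of_int k) = tanh_symbol (real (nat \<bar>k\<bar>))" for k :: int
    by (cases "k \<ge> 0") (auto simp: tanh_symbol_def)
  have trm: "complex_of_real (tanh_symbol (of_int k)) * fourier_coeff (\<lambda>y. complex_of_real (f y)) k * cis (of_int k * x) = F k" for k
    unfolding F_def T_def fourier_coeff_even[OF f(1,3)] ts[of k] by simp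
  have sT: "summable (\<lambda>n. \<bar>T n\<bar>)"
  proof (subst summable_Suc_iff[symmetric], rule summable_comparison_test')
    show "summable (\<lambda>n. \<bar>fcos f (Suc n)\<bar> / real (Suc n))"
      using fcos_div_summable[OF f(1)] by (subst summable_Suc_iff)
    fix n :: nat
    have "\<bar>tanh_symbol (real (Suc n))\<bar> \<le> 1 / real (Suc n)"
      using tanh_real_bounds[of "real (Suc n)"] by (auto simp: tanh_symbol_def divide_simps)
    thus "norm \<bar>T (Suc n)\<bar> \<le> \<bar>fcos f (Suc n)\<bar> / real (Suc n)"
      using mult_right_mono[of "\<bar>tanh_symbol (real (Suc n))\<bar>" "1 / real (Suc n)" "\<bar>fcos f (Suc n)\<bar>"]
      by (simp add: T_def abs_mult)
  qed
  define A where "A = (\<Sum>n. F (int n))"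
  define B where "B = (\<Sum>n. F (- int (Suc n)))"
  have nA: "summable (\<lambda>n. norm (F (int n)))" using sT by (simp add: F_def norm_mult)
  have nB: "summable (\<lambda>n. norm (F (- int (Suc n))))"
    using sT by (subst (asm) summable_Suc_iff[symmetric]) (simp add: F_def norm_mult nat_add_distrib del: of_nat_Suc)
  have "(F has_sum A) (range int)"
    using norm_summable_imp_has_sum[OF nA summable_sums[OF summable_norm_cancel[OF nA]]]
    by (subst has_sum_reindex) (auto simp: A_def o_def inj_on_def)
  moreover have "(F has_sum B) (range (\<lambda>n. - int (Suc n)))"
    using norm_summable_imp_has_sum[OF nB summable_sums[OF summable_norm_cancel[OF nB]]]
    by (subst has_sum_reindex) (auto simp: B_def o_def inj_on_def)
  moreover have "range int \<inter> range (\<lambda>n. - int (Suc n)) = {}" by auto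
  ultimately have "(F has_sum (A + B)) (range int \<union> range (\<lambda>n. - int (Suc n)))" by (rule has_sum_Un_disjoint)
  also have "range int \<union> range (\<lambda>n. - int (Suc n)) = UNIV"
  proof -
    have "k \<in> range int \<union> range (\<lambda>n. - int (Suc n))" for k by (cases k rule: int_cases) auto
    thus ?thesis by auto
  qed
  finally have "infsum F UNIV = A + B" by (rule infsumI)
  also have "A = F 0 + (\<Sum>n. F (int (Suc n)))"
    unfolding A_def using suminf_split_head[OF summable_norm_cancel[OF nA]] by simp
  also have "F 0 + (\<Sum>n. F (int (Suc n))) + B = complex_of_real (T 0) + (\<Sum>n. F (int (Suc n)) + F (- int (Suc n)))"
    unfolding B_def using suminf_add[of "\<lambda>n. F (int (Suc n))" "\<lambda>n. F (- int (Suc n))"]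
      summable_norm_cancel[OF nA] summable_norm_cancel[OF nB] summable_Suc_iff[of "\<lambda>n. F (int n)"]
    by (simp add: F_def)
  also have "(\<lambda>n. F (int (Suc n)) + F (- int (Suc n))) = (\<lambda>n. complex_of_real (2 * (T (Suc n) * cos (real (Suc n) * x))))"
  proof
    fix n
    have "nat \<bar>int (Suc n)\<bar> = Suc n" "nat \<bar>- int (Suc n)\<bar> = Suc n" by auto
    thus "F (int (Suc n)) + F (- int (Suc n)) = complex_of_real (2 * (T (Suc n) * cos (real (Suc n) * x)))"
      unfolding F_def by (simp add: complex_eq_iff del: of_nat_Suc)
  qed
  also have "complex_of_real (T 0) + (\<Sum>n. complex_of_real (2 * (T (Suc n) * cos (real (Suc n) * x)))) = complex_of_real (circ_conv K_ker f x)"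
  proof -
    have "(\<lambda>n. complex_of_real (2 * (T (Suc n) * cos (real (Suc n) * x)))) sums complex_of_real (circ_conv K_ker f x - T 0)"
      using K_ker_series[OF f, of x] unfolding T_def by (rule sums_of_real)
    hence "(\<Sum>n. complex_of_real (2 * (T (Suc n) * cos (real (Suc n) * x)))) = complex_of_real (circ_conv K_ker f x - T 0)"
      by (rule sums_unique[symmetric])
    thus ?thesis by (simp only:) simp
  qed
  finally show ?thesis unfolding K_op_def trm .
qed

text \<open>The kernel has total mass 1, read off from \<open>K_op_const\<close> without computing
  the integral of the logarithm.\<close>

lemma circ_conv_K_const: "circ_conv K_ker (\<lambda>_. a) x = a"
  using K_op_eq_circ_conv[of "\<lambda>_. a" x] K_op_const[of "complex_of_real a" x]
  by (simp add: circle_periodic_def)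

lemma circ_conv_K_diff:
  assumes "continuous_on UNIV f" "continuous_on UNIV g"
  shows "circ_conv K_ker (\<lambda>y. f y - g y) x = circ_conv K_ker f x - circ_conv K_ker g x"
proof -
  have "(\<lambda>y. K_ker (x - y) * f y) integrable_on {-pi..pi}" "(\<lambda>y. K_ker (x - y) * g y) integrable_on {-pi..pi}"
    using circ_conv_integrable[OF K_ker_periodic K_ker_absolutely_integrable] assms
    unfolding absolutely_integrable_on_def by blast+
  thus ?thesis unfolding circ_conv_def
    by (subst Henstock_Kurzweil_Integration.integral_diff[symmetric]) (auto simp: right_diff_distrib)
qed

lemma negligible_sin_half_zero: "negligible {y \<in> {-pi..pi}. sin ((x - y) / 2) = 0}"
proof -
  have "countable {y \<in> {-pi..pi}. sin ((x - y) / 2) = 0}"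
  proof (rule countable_subset)
    show "{y \<in> {-pi..pi}. sin ((x - y) / 2) = 0} \<subseteq> range (\<lambda>k::int. x - 2 * (of_int k * pi))"
      by (auto simp: sin_zero_iff_int2 field_simps)
  qed auto
  thus ?thesis
    by (simp add: negligible_iff_null_sets countable_imp_null_set_lborel null_sets_completionI)
qed

text \<open>At the zeros of the sine the kernel takes the value given by \<open>ln 0 = 0\<close>, so the bound fails there.\<close>

lemma K_ker_ge_pi:
  assumes "sin (t / 2) \<noteq> 0"
  shows "K_ker pi \<le> K_ker t"
proof -
  define k where "k = round (t / (2 * pi))"
  define s where "s = t - 2 * pi * of_int k"
  have "\<bar>of_int k - t / (2 * pi)\<bar> \<le> 1 / 2" unfolding k_def by (rule of_int_round_abs_le)
  hence "\<bar>s\<bar> \<le> pi" by (auto simp: s_def abs_le_iff field_simps)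
  moreover have "s \<noteq> 0" using assms by (auto simp: s_def sin_zero_iff_int2)
  moreover have "K_ker t = K_ker s"
    using circle_periodic_int[OF K_ker_periodic, of s k] by (simp add: s_def)
  ultimately show ?thesis using K_ker_ge[of s] by simp
qed

text \<open>Positivity of the kernel together with its total mass 1.\<close>

lemma circ_conv_K_ge:
  assumes "continuous_on UNIV f" "\<And>y. m \<le> f y"
  shows "m \<le> circ_conv K_ker f x"
proof -
  have c: "continuous_on UNIV (\<lambda>y. f y - m)" using assms by (intro continuous_intros)
  have "0 \<le> circ_conv K_ker (\<lambda>y. f y - m) x" unfolding circ_conv_def
  proof (rule integral_ge_0_spike[OF _ negligible_sin_half_zero])
    show "(\<lambda>y. K_ker (x - y) * (f y - m)) integrable_on {-pi..pi}"
      using circ_conv_integrable[OF K_ker_periodic K_ker_absolutely_integrable c]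
      unfolding absolutely_integrable_on_def by blast
    fix y assume "y \<in> {-pi..pi} - {y \<in> {-pi..pi}. sin ((x - y) / 2) = 0}"
    hence "0 \<le> K_ker (x - y)" using K_ker_ge_pi[of "x - y"] K_ker_pi_pos by auto
    thus "0 \<le> K_ker (x - y) * (f y - m)" using assms by simp
  qed
  thus ?thesis using circ_conv_K_diff[OF assms(1), of "\<lambda>_. m" x] by (simp add: circ_conv_K_const)
qed

section \<open>Monotonicity of the profile\<close>

definition crest_F :: "real \<Rightarrow> real \<Rightarrow> real" where
  "crest_F c w = w\<^sup>2 * (sqrt 3 * c + w) / 2"

text \<open>Expansion at a critical point: the linear term carries the factor
  \<open>1 - 3 * (s * s)\<close> with \<open>s = 1 / sqrt 3\<close> and vanishes, which leaves
  \<open>crest_F\<close> quadratic at 0.\<close>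

lemma N_nonlin_gamma: "N_nonlin c (gamma_crit c) - N_nonlin c y = crest_F c (gamma_crit c - y)"
proof -
  define s where "s = 1 / sqrt 3"
  define w where "w = gamma_crit c - y"
  have s: "s * s = 1 / 3" "sqrt 3 = 3 * s" by (auto simp: s_def real_div_sqrt)
  have y: "y = c * (1 - s) - w" by (simp add: w_def gamma_crit_def s_def)
  have "N_nonlin c (gamma_crit c) - N_nonlin c y - w\<^sup>2 * (3 * s * c + w) / 2 = (1 / 2) * c\<^sup>2 * w * (1 - 3 * (s * s))"
    unfolding N_nonlin_def y using s(1)
    by (simp add: gamma_crit_def s_def[symmetric] power2_eq_square field_simps)
  thus ?thesis using s by (simp add: crest_F_def w_def)
qed

lemma sqrt3_bounds: "1 \<le> sqrt 3" "sqrt 3 \<le> (2::real)"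
  by (auto intro: real_le_lsqrt)

text \<open>Only the quadratic part is kept, with \<open>p \<le> p + q\<close>. The factor
  \<open>p\<close> records the degeneracy at 0: recovering \<open>p - q\<close> needs a lower bound
  on \<open>p\<close>.\<close>

lemma crest_F_diff_ge:
  assumes "0 \<le> c" "0 \<le> q" "q \<le> p"
  shows "c / 2 * ((p - q) * p) \<le> crest_F c p - crest_F c q"
proof -
  have "c / 2 * ((p - q) * p) \<le> sqrt 3 * c / 2 * ((p - q) * (p + q))"
    using assms sqrt3_bounds(1) mult_right_mono[OF sqrt3_bounds(1), of c] by (intro mult_mono) auto
  also have "\<dots> \<le> sqrt 3 * c / 2 * ((p - q) * (p + q)) + (p ^ 3 - q ^ 3) / 2"
    using power_mono[of q p 3] assms by simp
  also have "\<dots> = crest_F c p - crest_F c q"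
    by (simp add: crest_F_def power2_eq_square power3_eq_cube field_simps)
  finally show ?thesis .
qed

text \<open>The bound \<open>p \<le> c + 2\<close> is the range of \<open>u\<close>
  (\<open>u_le\<close>). It makes the cubic part comparable to the quadratic one: the remaining
  factor is at most \<open>2 * c * p + 3 / 2 * (c + 2) * p\<close>.\<close>

lemma crest_F_diff_le:
  assumes "0 \<le> c" "0 \<le> q" "q \<le> p" "p \<le> c + 2"
  shows "crest_F c p - crest_F c q \<le> (4 * c + 3) * ((p - q) * p)"
proof -
  have "crest_F c p - crest_F c q = (p - q) * (sqrt 3 * c / 2 * (p + q) + (p * p + p * q + q * q) / 2)"
    by (simp add: crest_F_def power2_eq_square field_simps)
  also have "\<dots> \<le> (p - q) * ((4 * c + 3) * p)"
  proof (rule mult_left_mono)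
    have "sqrt 3 * c / 2 * (p + q) \<le> 2 * c / 2 * (p + p)"
      using assms sqrt3_bounds by (intro mult_mono divide_right_mono) auto
    moreover have "p * q \<le> p * p" "q * q \<le> p * p" using assms by (auto intro!: mult_mono)
    moreover have "p * p \<le> (c + 2) * p" using assms by (intro mult_right_mono) auto
    moreover have "0 \<le> c * p" using assms by simp
    moreover have "2 * c / 2 * (p + p) = 2 * (c * p)" "(c + 2) * p = c * p + 2 * p" "(4 * c + 3) * p = 4 * (c * p) + 3 * p"
      by (simp_all add: algebra_simps)
    moreover have "X + (P + Q + R) / 2 \<le> 4 * C + 3 * p"
      if "X \<le> 2 * C" "Q \<le> P" "R \<le> P" "P \<le> C + 2 * p" "0 \<le> C" for X P Q R C :: real
      using that by (simp add: field_simps)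
    ultimately show "sqrt 3 * c / 2 * (p + q) + (p * p + p * q + q * q) / 2 \<le> (4 * c + 3) * p"
      by metis
  qed (use assms in auto)
  finally show ?thesis by (simp add: mult_ac)
qed

lemma crest_F_0 [simp]: "crest_F c 0 = 0"
  by (simp add: crest_F_def)

lemma gamma_crit_bounds:
  assumes "0 \<le> c"
  shows "0 \<le> gamma_crit c" "gamma_crit c \<le> c"
  using assms sqrt3_bounds by (auto simp: gamma_crit_def mult_le_cancel_left1 divide_simps mult_left_mono)

locale crest =
  fixes c :: real and \<phi> :: "real \<Rightarrow> real"
  assumes c_nonneg: "0 \<le> c" and sol: "crest_solution c \<phi>"
begin

lemma cont: "continuous_on S \<phi>"
  and per: "circle_periodic \<phi>"
  and even: "\<phi> (- x) = \<phi> x"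
  and crest_val: "\<phi> 0 = gamma_crit c"
  using sol by (auto simp: crest_solution_def periodic_solution_def intro: continuous_on_subset)

lemma K_eq: "circ_conv K_ker \<phi> x = N_nonlin c (\<phi> x)"
proof -
  have "complex_of_real (circ_conv K_ker \<phi> x) = complex_of_real (N_nonlin c (\<phi> x))"
    using K_op_eq_circ_conv[OF cont per even] sol by (simp add: crest_solution_def periodic_solution_def)
  thus ?thesis by (simp only: of_real_eq_iff)
qed

lemma antimono_open:
  assumes "0 < s" "s \<le> t" "t < pi"
  shows "\<phi> t \<le> \<phi> s"
proof -
  have "mono_on {-pi<..<0} \<phi>" using sol by (simp add: crest_solution_def)
  hence "\<phi> (- t) \<le> \<phi> (- s)" by (rule mono_onD) (use assms in auto)
  thus ?thesis by (simp add: even)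
qed

lemma antimono:
  assumes "0 \<le> s" "s \<le> t" "t \<le> pi"
  shows "\<phi> t \<le> \<phi> s"
proof -
  \<comment> \<open>Both points are contracted towards \<open>pi / 2\<close> by the same factor,
    which preserves their order and moves them into the open interval; continuity then gives the
    closed one.\<close>
  define sn where "sn = (\<lambda>n::nat. s + (pi / 2 - s) / (real n + 2))"
  define tn where "tn = (\<lambda>n::nat. t + (pi / 2 - t) / (real n + 2))"
  have c: "isCont \<phi> x" for x using cont[of UNIV] by (simp add: continuous_on_eq_continuous_at)
  have le: "\<phi> (tn n) \<le> \<phi> (sn n)" for n
  proof (rule antimono_open)
    define e where "e = 1 / (real n + 2)"
    have e: "0 < e" "e < 1" by (auto simp: e_def)
    have s: "sn n = (1 - e) * s + e * (pi / 2)" and t: "tn n = (1 - e) * t + e * (pi / 2)"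
      by (auto simp: sn_def tn_def e_def algebra_simps diff_divide_distrib)
    show "0 < sn n" unfolding s using e assms by (intro add_nonneg_pos) auto
    show "sn n \<le> tn n" unfolding s t using e assms by (intro add_right_mono mult_left_mono) auto
    have "(1 - e) * t \<le> (1 - e) * pi" using e assms by (intro mult_left_mono) auto
    moreover have "e * (pi / 2) < e * pi" using e by simp
    moreover have "(1 - e) * pi + e * pi = pi" by (simp add: algebra_simps)
    ultimately show "tn n < pi" unfolding t by linarith
  qed
  have "sn \<longlonglongrightarrow> s" "tn \<longlonglongrightarrow> t" unfolding sn_def tn_def by real_asymp+
  hence "(\<lambda>n. \<phi> (sn n)) \<longlonglongrightarrow> \<phi> s" "(\<lambda>n. \<phi> (tn n)) \<longlonglongrightarrow> \<phi> t"
    using c by (auto intro: isCont_tendsto_compose)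
  thus ?thesis using le by (intro LIMSEQ_le) auto
qed

lemma fold_ex: "\<exists>t\<in>{0..pi}. \<phi> x = \<phi> t"
proof -
  define k where "k = round (x / (2 * pi))"
  define s where "s = x - 2 * pi * of_int k"
  have "\<bar>of_int k - x / (2 * pi)\<bar> \<le> 1 / 2" unfolding k_def by (rule of_int_round_abs_le)
  hence "\<bar>s\<bar> \<le> pi" by (auto simp: s_def abs_le_iff field_simps)
  moreover have "\<phi> x = \<phi> \<bar>s\<bar>"
    using circle_periodic_int[OF per, of s k] even[of s] by (cases "s \<ge> 0") (auto simp: s_def)
  ultimately show ?thesis by (intro bexI[of _ "\<bar>s\<bar>"]) auto
qed

lemma phi_ge_pi: "\<phi> pi \<le> \<phi> x" and phi_le_crest: "\<phi> x \<le> \<phi> 0"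
  using fold_ex[of x] antimono by force+

text \<open>At its minimum \<open>\<phi> pi\<close> the profile is at most its convolution, whereas
  for \<open>m = - \<phi> pi > 2\<close> the nonlinearity there is
  \<open>- m * ((c + m / 2) * (c + m)) \<le> - 2 * m\<close>. The bound is common to all
  solutions.\<close>

lemma phi_pi_ge: "- 2 \<le> \<phi> pi"
proof (rule ccontr)
  define m where "m = - \<phi> pi"
  assume "\<not> - 2 \<le> \<phi> pi"
  hence m: "2 < m" by (simp add: m_def)
  have "\<phi> pi \<le> N_nonlin c (\<phi> pi)"
    using circ_conv_K_ge[OF cont phi_ge_pi, of pi] by (simp add: K_eq)
  also have "\<dots> = - m * ((c + m / 2) * (c + m))" by (simp add: N_nonlin_def m_def algebra_simps)
  finally have "m * ((c + m / 2) * (c + m)) \<le> m * 1" by (simp add: m_def)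
  hence "(c + m / 2) * (c + m) \<le> 1" using m by (simp add: mult_le_cancel_left)
  moreover have "1 * 2 \<le> (c + m / 2) * (c + m)" using m c_nonneg by (intro mult_mono) auto
  ultimately show False by simp
qed

definition u :: "real \<Rightarrow> real" where "u x = gamma_crit c - \<phi> x"

lemma u_cont: "continuous_on S u"
  unfolding u_def by (intro continuous_intros cont)

lemma u_per: "circle_periodic u"
  using per by (simp add: circle_periodic_def u_def)

lemma u_even: "u (- x) = u x"
  by (simp add: u_def even)

lemma u_0 [simp]: "u 0 = 0"
  by (simp add: u_def crest_val)

lemma u_nonneg: "0 \<le> u x"
  using phi_le_crest[of x] by (simp add: u_def crest_val)

lemma u_le_pi: "u x \<le> u pi"
  using phi_ge_pi[of x] by (simp add: u_def)

lemma u_mono: "0 \<le> s \<Longrightarrow> s \<le> t \<Longrightarrow> t \<le> pi \<Longrightarrow> u s \<le> u t"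
  using antimono[of s t] by (simp add: u_def)

lemma u_le: "u x \<le> c + 2"
  using u_le_pi[of x] phi_pi_ge gamma_crit_bounds[OF c_nonneg] by (simp add: u_def)

lemma F_u: "crest_F c (u x) = circ_conv K_ker \<phi> 0 - circ_conv K_ker \<phi> x"
  using N_nonlin_gamma[of c "\<phi> x"] by (simp add: K_eq crest_val u_def)

text \<open>The operator fixes constants, so \<open>k\<close> is free. The upper estimate near the
  crest takes \<open>k = 0\<close>, the lower one \<open>k = u x\<close>.\<close>

lemma F_u_diff: "crest_F c (u y) - crest_F c (u x) = circ_conv K_ker (\<lambda>z. u z - k) y - circ_conv K_ker (\<lambda>z. u z - k) x"
proof -
  have "circ_conv K_ker (\<lambda>z. u z - k) x = gamma_crit c - k - circ_conv K_ker \<phi> x" for x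
    using circ_conv_K_diff[of "\<lambda>_. gamma_crit c - k" \<phi> x] cont[of UNIV]
    by (simp add: u_def circ_conv_K_const algebra_simps)
  thus ?thesis by (simp add: F_u)
qed

text \<open>The first cosine moment of the profile, positive exactly through its deviation from a
  constant. It is not the integral for which the overview uses this letter.\<close>

definition J :: real where "J = integral {-pi..pi} (\<lambda>y. \<phi> y * cos y)"

lemma circ_conv_cos: "circ_conv cos \<phi> x = cos x * J"
  using fcos_mult_cos[OF cont even, of 1 x] by (simp add: circ_conv_def J_def fcos_def mult.commute)

text \<open>Convolution with \<open>K_ker t - cos t / 200\<close> still preserves monotonicity, and
  its action on \<open>\<phi>\<close> is that of \<open>K_ker\<close> minus
  \<open>cos x * J / 200\<close>. The slack of the kernel thus becomes the explicit gain on the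
  left.\<close>

lemma F_u_diff_ge:
  assumes "0 \<le> x" "x \<le> y" "y \<le> pi"
  shows "(cos x - cos y) * J / 200 \<le> crest_F c (u y) - crest_F c (u x)"
proof -
  define k where "k = (\<lambda>t. 1 * K_ker t + (- 1 / 200) * cos t)"
  have pc: "circle_periodic (cos :: real \<Rightarrow> real)" by (simp add: circle_periodic_def)
  have ic: "(cos :: real \<Rightarrow> real) absolutely_integrable_on {-pi..pi}"
    by (intro absolutely_integrable_continuous_real continuous_intros)
  have eq: "circ_conv k \<phi> x = circ_conv K_ker \<phi> x - cos x * J / 200" for x
    unfolding k_def using circ_conv_linear[OF K_ker_periodic K_ker_absolutely_integrable pc ic cont, of 1 "-1/200" x]
    by (simp add: circ_conv_cos)
  have "circ_conv k \<phi> y \<le> circ_conv k \<phi> x"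
  proof (rule circ_conv_antimono)
    show "circle_periodic k" using K_ker_periodic by (simp add: k_def circle_periodic_def)
    have "(\<lambda>t. K_ker t - cos t * (1 / 200)) absolutely_integrable_on {-pi..pi}"
      by (intro set_integral_diff K_ker_absolutely_integrable absolutely_integrable_mult_continuous ic continuous_intros)
    thus "k absolutely_integrable_on {-pi..pi}" by (simp add: k_def)
    show "k (- x) = k x" for x by (simp add: k_def K_ker_even)
    show "k t \<le> k s" if "0 < s" "s \<le> t" "t \<le> pi" for s t
      using K_ker_minus_cos_antimono[OF that] by (simp add: k_def)
  qed (use cont per even antimono assms in auto)
  thus ?thesis unfolding F_u eq by (simp add: algebra_simps diff_divide_distrib)
qed

text \<open>Folding at \<open>pi / 2\<close>, where the cosine changes sign, exhibits the moment as
  the integral of a nonnegative function, \<open>u\<close> being nondecreasing.\<close>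

lemma J_eq: "((\<lambda>z. 2 * ((u (pi - z) - u z) * cos z)) has_integral J) {0..pi / 2}"
proof -
  have i: "(\<lambda>y. \<phi> y * cos y) integrable_on {-pi..pi}"
    by (intro integrable_continuous_interval continuous_intros cont)
  have i2: "(\<lambda>y. 2 * (\<phi> y * cos y)) integrable_on {a..b}" for a b
    by (intro integrable_continuous_interval continuous_intros cont)
  have "J = integral {0..pi} (\<lambda>y. 2 * (\<phi> y * cos y))"
    unfolding J_def integral_even_half(2)[OF i pi_ge_zero]
    by (intro Henstock_Kurzweil_Integration.integral_cong) (simp add: even)
  also have "\<dots> = integral {0..pi / 2} (\<lambda>y. 2 * (\<phi> y * cos y)) + integral {pi / 2..pi} (\<lambda>y. 2 * (\<phi> y * cos y))"
    by (intro Henstock_Kurzweil_Integration.integral_combine[symmetric] i2) auto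
  finally have J: "J = integral {0..pi / 2} (\<lambda>y. 2 * (\<phi> y * cos y)) + integral {pi / 2..pi} (\<lambda>y. 2 * (\<phi> y * cos y))" .
  have "((\<lambda>y. 2 * (\<phi> y * cos y)) has_integral integral {pi / 2..pi} (\<lambda>y. 2 * (\<phi> y * cos y))) {pi / 2..pi}"
    by (intro integrable_integral i2)
  from has_integral_shift_real_ivl[OF this, of pi]
  have "((\<lambda>y. - (2 * (\<phi> (y + pi) * cos y))) has_integral integral {pi / 2..pi} (\<lambda>y. 2 * (\<phi> y * cos y))) {- (pi / 2)..0}"
    by simp
  hence "((\<lambda>y. - (2 * (\<phi> (- y + pi) * cos (- y)))) has_integral integral {pi / 2..pi} (\<lambda>y. 2 * (\<phi> y * cos y))) {0..pi / 2}"
    by (subst (asm) has_integral_reflect_real[symmetric]) simp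
  hence "((\<lambda>y. 2 * (\<phi> y * cos y) + - (2 * (\<phi> (- y + pi) * cos (- y)))) has_integral J) {0..pi / 2}"
    unfolding J by (intro has_integral_add) (rule integrable_integral[OF i2])
  thus ?thesis by (rule has_integral_eq[rotated]) (simp add: u_def algebra_simps)
qed

lemma J_ge:
  assumes "0 \<le> e" "e \<le> pi / 2" "\<And>z. z \<in> {0..e} \<Longrightarrow> d \<le> u (pi - z) - u z"
  shows "2 * d * sin e \<le> J"
proof -
  have 1: "((\<lambda>z. 2 * d * cos z) has_integral (2 * d * sin e - 2 * d * sin 0)) {0..e}"
    using assms(1) by (intro fundamental_theorem_of_calculus)
      (auto intro!: derivative_eq_intros simp flip: has_real_derivative_iff_has_vector_derivative)
  have i: "(\<lambda>z. 2 * ((u (pi - z) - u z) * cos z)) integrable_on {a..b}" for a b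
    by (intro integrable_continuous_interval continuous_intros u_cont continuous_on_compose2[OF u_cont[of UNIV]]) auto
  have "2 * d * sin e \<le> integral {0..e} (\<lambda>z. 2 * ((u (pi - z) - u z) * cos z))"
  proof (rule has_integral_le[OF _ integrable_integral[OF i]])
    show "((\<lambda>z. 2 * d * cos z) has_integral 2 * d * sin e) {0..e}" using 1 by simp
    fix z assume z: "z \<in> {0..e}"
    hence "0 \<le> cos z" using assms by (intro cos_ge_zero) auto
    thus "2 * d * cos z \<le> 2 * ((u (pi - z) - u z) * cos z)"
      using assms(3)[OF z] by (simp add: mult_right_mono)
  qed
  also have "\<dots> \<le> integral {0..pi / 2} (\<lambda>z. 2 * ((u (pi - z) - u z) * cos z))"
  proof (rule integral_subset_le[OF _ i i])
    have "0 \<le> 2 * ((u (pi - z) - u z) * cos z)" if z: "z \<in> {0..pi / 2}" for z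
    proof -
      have "0 \<le> cos z" using z by (intro cos_ge_zero) auto
      moreover have "u z \<le> u (pi - z)" using z by (intro u_mono) auto
      ultimately show ?thesis by simp
    qed
    thus "\<forall>z\<in>{0..pi / 2}. 0 \<le> 2 * ((u (pi - z) - u z) * cos z)" by blast
  qed (use assms in auto)
  also have "\<dots> = J" using J_eq by (rule integral_unique)
  finally show ?thesis .
qed

lemma u_pi_pos:
  assumes "\<not> \<phi> constant_on UNIV"
  shows "0 < u pi"
proof (rule ccontr)
  assume "\<not> 0 < u pi"
  hence "u x = 0" for x using u_le_pi[of x] u_nonneg[of x] by linarith
  hence "\<phi> x = gamma_crit c" for x by (simp add: u_def)
  thus False using assms by (auto simp: constant_on_def)
qed

lemma J_pos:
  assumes "\<not> \<phi> constant_on UNIV"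
  shows "0 < J"
proof -
  have "isCont (\<lambda>z. u (pi - z) - u z) 0"
    using u_cont[of UNIV]
    by (intro continuous_intros continuous_at_compose[unfolded o_def, of _ "\<lambda>z. pi - z" u])
       (auto simp: continuous_on_eq_continuous_at)
  moreover have "u pi / 2 < u (pi - 0) - u 0" using u_pi_pos[OF assms] by simp
  ultimately have "\<forall>\<^sub>F z in at 0. u pi / 2 < u (pi - z) - u z"
    unfolding isCont_def by (rule order_tendstoD(1))
  then obtain e where e: "e > 0" "\<And>z. z \<noteq> 0 \<Longrightarrow> dist z 0 < e \<Longrightarrow> u pi / 2 < u (pi - z) - u z"
    by (auto simp: eventually_at)
  define e' where "e' = min (e / 2) (pi / 2)"
  have e': "0 < e'" "e' \<le> pi / 2" "e' < e" using e by (auto simp: e'_def min_def)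
  have "2 * (u pi / 2) * sin e' \<le> J"
  proof (rule J_ge)
    fix z assume "z \<in> {0..e'}"
    thus "u pi / 2 \<le> u (pi - z) - u z"
      using e(2)[of z] e' u_pi_pos[OF assms] by (cases "z = 0") (auto simp: dist_real_def)
  qed (use e' in auto)
  moreover have "0 < sin e'" using e' by (intro sin_gt_zero) auto
  moreover have "0 < 2 * (u pi / 2) * sin e'" using calculation(2) u_pi_pos[OF assms] by simp
  ultimately show ?thesis by linarith
qed

lemma u_strict_mono:
  assumes "\<not> \<phi> constant_on UNIV" "0 \<le> x" "x < y" "y \<le> pi"
  shows "u x < u y"
proof -
  have "cos y < cos x" using assms by (intro cos_monotone_0_pi) auto
  hence "0 < (cos x - cos y) * J / 200" using J_pos[OF assms(1)] by simp
  hence "crest_F c (u x) \<noteq> crest_F c (u y)" using F_u_diff_ge[of x y] assms by auto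
  moreover have "u x \<le> u y" using assms by (intro u_mono) auto
  ultimately show ?thesis by (metis less_le)
qed

text \<open>For \<open>c = 0\<close> also \<open>gamma_crit c = 0\<close>, and the equation at the
  crest says that the nonnegative \<open>u\<close> integrates to 0 against a positive kernel.
  Nonconstant profiles therefore have \<open>0 < c\<close>, which the lower bounds on
  \<open>crest_F\<close> require to be effective.\<close>

lemma constant_if_c_0:
  assumes "c = 0"
  shows "\<phi> constant_on UNIV"
proof (rule ccontr)
  assume nc: "\<not> \<phi> constant_on UNIV"
  have "gamma_crit c = 0" using assms by (simp add: gamma_crit_def)
  hence phi: "\<phi> y = - u y" for y by (simp add: u_def)
  have "circ_conv K_ker u 0 = 0"
    using circ_conv_K_diff[of "\<lambda>_. 0" \<phi> 0] cont[of UNIV] K_eq[of 0]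
    by (simp add: phi circ_conv_K_const N_nonlin_def)
  moreover have "K_ker pi * integral {-pi..pi} u \<le> circ_conv K_ker u 0"
  proof -
    have "integral {-pi..pi} (\<lambda>y. K_ker pi * u y) \<le> integral {-pi..pi} (\<lambda>y. K_ker (0 - y) * u y)"
    proof (rule integral_le_spike[OF _ _ negligible_sin_half_zero])
      show "(\<lambda>y. K_ker pi * u y) integrable_on {-pi..pi}"
        by (intro integrable_continuous_interval continuous_intros u_cont)
      show "(\<lambda>y. K_ker (0 - y) * u y) integrable_on {-pi..pi}"
        using circ_conv_integrable[OF K_ker_periodic K_ker_absolutely_integrable u_cont]
        unfolding absolutely_integrable_on_def by blast
      fix y assume "y \<in> {-pi..pi} - {y \<in> {-pi..pi}. sin ((0 - y) / 2) = 0}"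
      thus "K_ker pi * u y \<le> K_ker (0 - y) * u y"
        using K_ker_ge_pi[of "0 - y"] u_nonneg[of y] by (intro mult_right_mono) auto
    qed
    thus ?thesis by (simp add: circ_conv_def)
  qed
  ultimately have "integral {-pi..pi} u \<le> 0" using K_ker_pi_pos by (simp add: mult_le_0_iff)
  moreover have "0 \<le> integral {-pi..pi} u"
    by (intro Henstock_Kurzweil_Integration.integral_nonneg integrable_continuous_interval u_cont) (use u_nonneg in auto)
  ultimately have "integral {-pi..pi} u = 0" by simp
  hence "u pi = 0" using integral_eq_0_iff[OF u_cont, of "-pi" pi] u_nonneg by auto
  thus False using u_pi_pos[OF nc] by simp
qed

text \<open>The gain of \<open>F_u_diff_ge\<close> between \<open>z\<close> and
  \<open>pi - z\<close> is tested against \<open>2 * cos z\<close> on \<open>{0..pi / 2}\<close>: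
  the left side integrates the square of the cosine, the right side reproduces \<open>J\<close>
  through \<open>J_eq\<close>. For nonconstant profiles \<open>J > 0\<close> cancels, so
  \<open>u pi\<close> cannot be small (\<open>u_pi_ge\<close>): a gap to the constant solutions that
  depends on \<open>c\<close> only.\<close>

lemma J_le: "pi * J / 200 \<le> (4 * c + 3) * u pi * J"
proof -
  define B where "B = (4 * c + 3) * u pi"
  have B: "0 \<le> B" using c_nonneg u_nonneg by (simp add: B_def)
  have 1: "((\<lambda>z. 2 * (2 * cos z * J / 200 * cos z)) has_integral
     (J / 100 * (pi / 2 + sin (pi / 2) * cos (pi / 2)) - J / 100 * (0 + sin 0 * cos 0))) {0..pi / 2}"
  proof (rule fundamental_theorem_of_calculus)
    fix z :: real
    have "((\<lambda>z. J / 100 * (z + sin z * cos z)) has_real_derivative J / 100 * (1 + (cos z * cos z - sin z * sin z))) (at z within {0..pi / 2})"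
      by (auto intro!: derivative_eq_intros)
    moreover have "1 + (cos z * cos z - sin z * sin z) = 2 * (cos z * cos z)"
      using sin_cos_squared_add[of z] by (simp add: power2_eq_square)
    ultimately show "((\<lambda>z. J / 100 * (z + sin z * cos z)) has_vector_derivative 2 * (2 * cos z * J / 200 * cos z)) (at z within {0..pi / 2})"
      by (simp add: has_real_derivative_iff_has_vector_derivative[symmetric] mult_ac)
  qed auto
  have "J / 100 * (pi / 2 + sin (pi / 2) * cos (pi / 2)) - J / 100 * (0 + sin 0 * cos 0) \<le> B * J"
  proof (rule has_integral_le[OF 1 has_integral_mult_right[OF J_eq]])
    fix z assume z: "z \<in> {0..pi / 2}"
    have cz: "0 \<le> cos z" using z by (intro cos_ge_zero) auto
    have le: "u z \<le> u (pi - z)" using z by (intro u_mono) auto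
    have "2 * cos z * J / 200 = (cos z - cos (pi - z)) * J / 200" by simp
    also have "\<dots> \<le> crest_F c (u (pi - z)) - crest_F c (u z)" using z by (intro F_u_diff_ge) auto
    also have "\<dots> \<le> (4 * c + 3) * ((u (pi - z) - u z) * u (pi - z))"
      by (intro crest_F_diff_le c_nonneg u_nonneg le u_le)
    also have "\<dots> \<le> (4 * c + 3) * ((u (pi - z) - u z) * u pi)"
      using c_nonneg le u_le_pi by (intro mult_left_mono) auto
    finally have "2 * cos z * J / 200 \<le> B * (u (pi - z) - u z)" by (simp add: B_def mult_ac)
    hence "2 * (2 * cos z * J / 200 * cos z) \<le> 2 * (B * (u (pi - z) - u z) * cos z)"
      using cz by (intro mult_left_mono mult_right_mono) auto
    thus "2 * (2 * cos z * J / 200 * cos z) \<le> B * (2 * ((u (pi - z) - u z) * cos z))" by (simp add: mult_ac)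
  qed
  thus ?thesis by (simp add: B_def mult_ac)
qed

lemma u_pi_ge:
  assumes "\<not> \<phi> constant_on UNIV"
  shows "pi / (200 * (4 * c + 3)) \<le> u pi"
proof -
  have "pi / 200 * J \<le> (4 * c + 3) * u pi * J" using J_le by simp
  hence "pi / 200 \<le> (4 * c + 3) * u pi" using J_pos[OF assms] by (simp only: mult_le_cancel_right)
  thus ?thesis using c_nonneg by (simp add: field_simps)
qed

end

section \<open>Hoelder continuity of the convolution\<close>

lemma abs_two_sin_half_ge:
  assumes "\<bar>t\<bar> \<le> pi"
  shows "\<bar>t\<bar> / 2 \<le> \<bar>2 * sin (t / 2)\<bar>"
proof -
  have "\<bar>t\<bar> / 4 \<le> \<bar>t\<bar> / pi" using pi_less_4 by (intro divide_left_mono) auto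
  also have "\<dots> \<le> \<bar>sin (t / 2)\<bar>" by (rule abs_sin_half_ge[OF assms])
  finally show ?thesis by (simp add: abs_mult)
qed

lemma sin_powr_absolutely_integrable:
  assumes "0 \<le> \<beta>" "\<beta> < 1"
  shows "(\<lambda>t. \<bar>2 * sin (t / 2)\<bar> powr - \<beta>) absolutely_integrable_on {-pi..pi}"
proof (rule measurable_bounded_by_integrable_imp_absolutely_integrable)
  show "(\<lambda>t. \<bar>2 * sin (t / 2)\<bar> powr - \<beta>) \<in> borel_measurable (lebesgue_on {-pi..pi})"
    by (intro borel_measurable_lebesgue_on) measurable
  show "(\<lambda>t. 2 powr \<beta> * \<bar>t\<bar> powr - \<beta>) integrable_on {-pi..pi}"
    using abs_powr_integrable_bound(1)[OF assms, of 0 "-pi" pi]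
    by (intro integrable_on_mult_right) auto
  fix t :: real assume "t \<in> {-pi..pi}"
  hence "\<bar>t\<bar> / 2 \<le> \<bar>2 * sin (t / 2)\<bar>" by (intro abs_two_sin_half_ge) auto
  hence "\<bar>2 * sin (t / 2)\<bar> powr - \<beta> \<le> (\<bar>t\<bar> / 2) powr - \<beta>" if "t \<noteq> 0"
    using that assms by (intro powr_mono2') auto
  moreover have "(\<bar>t\<bar> / 2) powr - \<beta> = 2 powr \<beta> * \<bar>t\<bar> powr - \<beta>"
    by (simp add: powr_divide powr_minus field_simps)
  ultimately show "norm (\<bar>2 * sin (t / 2)\<bar> powr - \<beta>) \<le> 2 powr \<beta> * \<bar>t\<bar> powr - \<beta>"
    by (cases "t = 0") auto
qed auto

lemma sin_powr_periodic: "circle_periodic (\<lambda>t. \<bar>2 * sin (t / 2)\<bar> powr - \<beta>)"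
  by (simp add: circle_periodic_def add_divide_distrib sin_add)

lemma abs_sin_diff_le: "\<bar>sin p - sin q\<bar> \<le> \<bar>p - q\<bar>" for p q :: real
proof -
  have "norm (sin p - sin q) \<le> 1 * norm (p - q)"
    by (rule field_differentiable_bound[of UNIV _ cos]) (auto intro!: derivative_eq_intros)
  thus ?thesis by simp
qed

lemma log_ker_diff_le:
  assumes "0 < \<beta>" "\<beta> < 1" "sin (p / 2) \<noteq> 0" "sin (q / 2) \<noteq> 0"
  shows "\<bar>log_ker p - log_ker q\<bar> \<le>
    2 / \<beta> * \<bar>p - q\<bar> powr \<beta> * (\<bar>2 * sin (p / 2)\<bar> powr - \<beta> + \<bar>2 * sin (q / 2)\<bar> powr - \<beta>)"
proof -
  have "\<bar>log_ker p - log_ker q\<bar> \<le> 2 / \<beta> * \<bar>\<bar>2 * sin (p / 2)\<bar> - \<bar>2 * sin (q / 2)\<bar>\<bar> powr \<beta> *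
     (\<bar>2 * sin (p / 2)\<bar> powr - \<beta> + \<bar>2 * sin (q / 2)\<bar> powr - \<beta>)"
    unfolding log_ker_def using assms by (intro ln_diff_powr_le) auto
  also have "\<dots> \<le> 2 / \<beta> * \<bar>p - q\<bar> powr \<beta> * (\<bar>2 * sin (p / 2)\<bar> powr - \<beta> + \<bar>2 * sin (q / 2)\<bar> powr - \<beta>)"
  proof (intro mult_right_mono mult_left_mono powr_mono2)
    have "\<bar>\<bar>2 * sin (p / 2)\<bar> - \<bar>2 * sin (q / 2)\<bar>\<bar> \<le> \<bar>2 * sin (p / 2) - 2 * sin (q / 2)\<bar>" by linarith
    also have "\<dots> = 2 * \<bar>sin (p / 2) - sin (q / 2)\<bar>"
      using abs_mult[of 2 "sin (p / 2) - sin (q / 2)"] by (simp only: right_diff_distrib abs_numeral)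
    also have "\<dots> \<le> 2 * \<bar>p / 2 - q / 2\<bar>" using abs_sin_diff_le[of "p / 2" "q / 2"] by simp
    also have "\<dots> = \<bar>p - q\<bar>" by (simp flip: diff_divide_distrib)
    finally show "\<bar>\<bar>2 * sin (p / 2)\<bar> - \<bar>2 * sin (q / 2)\<bar>\<bar> \<le> \<bar>p - q\<bar>" .
  qed (use assms in auto)
  finally show ?thesis .
qed

lemma log_ker_shift_absolutely_integrable:
  "(\<lambda>z. log_ker (x - z)) absolutely_integrable_on {-pi..pi}"
  by (rule circle_periodic_reflect_shift(1)[OF log_ker_periodic log_ker_absolutely_integrable])

lemma log_ker_shift_diff_integrable:
  "(\<lambda>z. \<bar>log_ker (x - z) - log_ker (y - z)\<bar>) integrable_on {-pi..pi}"
  using set_integral_diff(1)[OF log_ker_shift_absolutely_integrable log_ker_shift_absolutely_integrable, of x y]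
  by (simp add: absolutely_integrable_on_def)

text \<open>Integrates \<open>log_ker_diff_le\<close>; by periodicity the two singular integrals do
  not depend on \<open>x\<close> and \<open>y\<close>, hence neither does the constant.\<close>

lemma log_ker_L1_modulus:
  assumes "0 < \<beta>" "\<beta> < 1"
  obtains C where "0 \<le> C"
    "\<And>x y. integral {-pi..pi} (\<lambda>z. \<bar>log_ker (x - z) - log_ker (y - z)\<bar>) \<le> C * \<bar>x - y\<bar> powr \<beta>"
proof
  define S where "S = (\<lambda>t. \<bar>2 * sin (t / 2)\<bar> powr - \<beta>)"
  define I where "I = integral {-pi..pi} S"
  have Sa: "S absolutely_integrable_on {-pi..pi}" "circle_periodic S"
    unfolding S_def using sin_powr_absolutely_integrable[of \<beta>] sin_powr_periodic assms by auto
  note Ssh = circle_periodic_reflect_shift[OF Sa(2,1)]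
  have Si: "(\<lambda>z. S (x - z)) integrable_on {-pi..pi}" for x
    using Ssh(1)[of x] by (simp add: absolutely_integrable_on_def)
  have "0 \<le> I"
    using Sa(1) unfolding I_def absolutely_integrable_on_def
    by (intro Henstock_Kurzweil_Integration.integral_nonneg) (auto simp: S_def)
  thus "0 \<le> 2 / \<beta> * (I + I)" using assms by simp
  fix x y
  have "integral {-pi..pi} (\<lambda>z. \<bar>log_ker (x - z) - log_ker (y - z)\<bar>)
     \<le> integral {-pi..pi} (\<lambda>z. 2 / \<beta> * \<bar>x - y\<bar> powr \<beta> * (S (x - z) + S (y - z)))"
  proof (rule integral_le_spike)
    show "negligible ({z \<in> {-pi..pi}. sin ((x - z) / 2) = 0} \<union> {z \<in> {-pi..pi}. sin ((y - z) / 2) = 0})"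
      by (intro negligible_Un negligible_sin_half_zero)
    show "(\<lambda>z. 2 / \<beta> * \<bar>x - y\<bar> powr \<beta> * (S (x - z) + S (y - z))) integrable_on {-pi..pi}"
      by (intro integrable_on_mult_right integrable_add Si)
    fix z assume z: "z \<in> {-pi..pi} - ({z \<in> {-pi..pi}. sin ((x - z) / 2) = 0} \<union> {z \<in> {-pi..pi}. sin ((y - z) / 2) = 0})"
    show "\<bar>log_ker (x - z) - log_ker (y - z)\<bar> \<le> 2 / \<beta> * \<bar>x - y\<bar> powr \<beta> * (S (x - z) + S (y - z))"
      using log_ker_diff_le[OF assms, of "x - z" "y - z"] z by (simp add: S_def)
  qed (rule log_ker_shift_diff_integrable)
  also have "\<dots> = 2 / \<beta> * \<bar>x - y\<bar> powr \<beta> * (I + I)"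
    using Si by (simp add: Henstock_Kurzweil_Integration.integral_add Ssh(2) I_def)
  finally show "integral {-pi..pi} (\<lambda>z. \<bar>log_ker (x - z) - log_ker (y - z)\<bar>) \<le> 2 / \<beta> * (I + I) * \<bar>x - y\<bar> powr \<beta>"
    by (simp add: mult_ac)
qed

lemma smooth_ker_lipschitz:
  obtains L where "0 \<le> L" "\<And>p q. \<bar>smooth_ker p - smooth_ker q\<bar> \<le> L * \<bar>p - q\<bar>"
proof
  define A where "A = (\<Sum>n. real n ^ 1 * kw n)"
  have A0: "0 \<le> A" unfolding A_def by (intro suminf_nonneg kw_power_summable) (auto simp: kw_nonneg)
  show "0 \<le> 4 * A / (2 * pi)" using A0 by simp
  have b: "\<bar>kw_series 1 t\<bar> \<le> A" for t
  proof -
    have n: "norm (real n ^ 1 * kw n * cos (real n * t + real 1 * (pi / 2))) \<le> real n ^ 1 * kw n" for n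
      using mult_left_mono[OF abs_cos_le_one, of "real n ^ 1 * kw n"] by (simp add: abs_mult kw_nonneg)
    have "norm (kw_series 1 t) \<le> A" unfolding kw_series_def A_def
      by (rule norm_suminf_le[OF n kw_power_summable])
    thus ?thesis by simp
  qed
  fix p q
  have "norm (smooth_ker p - smooth_ker q) \<le> 4 * A / (2 * pi) * norm (p - q)"
  proof (rule field_differentiable_bound[of UNIV])
    fix t
    show "(smooth_ker has_field_derivative (0 - 4 * kw_series 1 t) / (2 * pi)) (at t within UNIV)"
      unfolding smooth_ker_def using kw_series_has_derivative[of 0 t]
      by (auto intro!: derivative_eq_intros)
    show "norm ((0 - 4 * kw_series 1 t) / (2 * pi)) \<le> 4 * A / (2 * pi)"
      using b[of t] by (simp add: divide_right_mono)
  qed auto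
  thus "\<bar>smooth_ker p - smooth_ker q\<bar> \<le> 4 * A / (2 * pi) * \<bar>p - q\<bar>" by simp
qed

text \<open>The constant depends on \<open>\<beta>\<close> alone, so the bound is uniform over all
  profiles and speeds with a common \<open>M\<close>.\<close>

lemma circ_conv_K_hoelder:
  assumes "0 < \<beta>" "\<beta> < 1"
  obtains C where "0 \<le> C"
    "\<And>f M x y. continuous_on UNIV f \<Longrightarrow> (\<And>z. \<bar>f z\<bar> \<le> M) \<Longrightarrow> \<bar>x - y\<bar> \<le> pi \<Longrightarrow>
       \<bar>circ_conv K_ker f x - circ_conv K_ker f y\<bar> \<le> C * M * \<bar>x - y\<bar> powr \<beta>"
proof -
  obtain C1 where C1: "0 \<le> C1"
    "\<And>x y. integral {-pi..pi} (\<lambda>z. \<bar>log_ker (x - z) - log_ker (y - z)\<bar>) \<le> C1 * \<bar>x - y\<bar> powr \<beta>"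
    using log_ker_L1_modulus[OF assms] by blast
  obtain L where L: "0 \<le> L" "\<And>p q. \<bar>smooth_ker p - smooth_ker q\<bar> \<le> L * \<bar>p - q\<bar>"
    using smooth_ker_lipschitz by blast
  define C where "C = 2 * pi * (L * pi powr (1 - \<beta>)) + C1 / pi"
  show ?thesis
  proof (rule that[of C])
    show "0 \<le> C" using C1 L by (simp add: C_def)
    fix f :: "real \<Rightarrow> real" and M x y :: real
    assume f: "continuous_on UNIV f" and M: "\<And>z. \<bar>f z\<bar> \<le> M" and xy: "\<bar>x - y\<bar> \<le> pi"
    have M0: "0 \<le> M" using M[of 0] by linarith
    define D where "D = (\<lambda>z. K_ker (x - z) - K_ker (y - z))"
    define G where "G = (\<lambda>z. (L * \<bar>x - y\<bar> + 1 / pi * \<bar>log_ker (x - z) - log_ker (y - z)\<bar>) * M)"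
    have i: "(\<lambda>z. K_ker (x - z) * f z) integrable_on {-pi..pi}" for x
      using circ_conv_integrable[OF K_ker_periodic K_ker_absolutely_integrable f]
      unfolding absolutely_integrable_on_def by blast
    have Gi: "G integrable_on {-pi..pi}"
      unfolding G_def by (intro integrable_on_mult_left integrable_add integrable_on_mult_right log_ker_shift_diff_integrable) auto
    have "circ_conv K_ker f x - circ_conv K_ker f y = integral {-pi..pi} (\<lambda>z. D z * f z)"
      unfolding circ_conv_def D_def using i
      by (subst Henstock_Kurzweil_Integration.integral_diff[symmetric]) (auto simp: algebra_simps)
    moreover have "norm (integral {-pi..pi} (\<lambda>z. D z * f z)) \<le> integral {-pi..pi} G"
    proof (rule integral_norm_bound_integral)
      show "(\<lambda>z. D z * f z) integrable_on {-pi..pi}"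
        unfolding D_def using integrable_diff[OF i i, of x y] by (simp add: left_diff_distrib)
      fix z
      have "D z = (smooth_ker (x - z) - smooth_ker (y - z)) - 1 / pi * (log_ker (x - z) - log_ker (y - z))"
        by (simp add: D_def K_ker_def diff_divide_distrib)
      hence "\<bar>D z\<bar> \<le> \<bar>smooth_ker (x - z) - smooth_ker (y - z)\<bar> + \<bar>1 / pi * (log_ker (x - z) - log_ker (y - z))\<bar>"
        by (simp only: abs_triangle_ineq4)
      also have "\<bar>1 / pi * (log_ker (x - z) - log_ker (y - z))\<bar> = 1 / pi * \<bar>log_ker (x - z) - log_ker (y - z)\<bar>"
        by (simp add: abs_mult)
      also have "\<bar>smooth_ker (x - z) - smooth_ker (y - z)\<bar> + 1 / pi * \<bar>log_ker (x - z) - log_ker (y - z)\<bar>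
          \<le> L * \<bar>x - y\<bar> + 1 / pi * \<bar>log_ker (x - z) - log_ker (y - z)\<bar>"
        using L(2)[of "x - z" "y - z"] by simp
      finally show "norm (D z * f z) \<le> G z"
        unfolding G_def using M[of z] by (simp add: abs_mult mult_mono')
    qed (use Gi in auto)
    moreover have "integral {-pi..pi} G = (2 * pi * (L * \<bar>x - y\<bar>) + 1 / pi * integral {-pi..pi} (\<lambda>z. \<bar>log_ker (x - z) - log_ker (y - z)\<bar>)) * M"
    proof -
      have "((\<lambda>z. (L * \<bar>x - y\<bar> + 1 / pi * \<bar>log_ker (x - z) - log_ker (y - z)\<bar>) * M) has_integral
        (2 * pi * (L * \<bar>x - y\<bar>) + 1 / pi * integral {-pi..pi} (\<lambda>z. \<bar>log_ker (x - z) - log_ker (y - z)\<bar>)) * M) {-pi..pi}"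
        using has_integral_const_real[of "L * \<bar>x - y\<bar>" "-pi" pi]
        by (intro has_integral_mult_left has_integral_add has_integral_mult_right integrable_integral log_ker_shift_diff_integrable) auto
      thus ?thesis unfolding G_def by (rule integral_unique)
    qed
    moreover have "\<dots> \<le> (2 * pi * (L * (pi powr (1 - \<beta>) * \<bar>x - y\<bar> powr \<beta>)) + 1 / pi * (C1 * \<bar>x - y\<bar> powr \<beta>)) * M"
    proof (intro mult_right_mono add_mono mult_left_mono C1 L M0)
      have "\<bar>x - y\<bar> = \<bar>x - y\<bar> powr (1 - \<beta>) * \<bar>x - y\<bar> powr \<beta>"
        by (simp flip: powr_add)
      also have "\<dots> \<le> pi powr (1 - \<beta>) * \<bar>x - y\<bar> powr \<beta>"
        using xy assms by (intro mult_right_mono powr_mono2) auto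
      finally show "\<bar>x - y\<bar> \<le> pi powr (1 - \<beta>) * \<bar>x - y\<bar> powr \<beta>" .
    qed auto
    moreover have "\<dots> = C * M * \<bar>x - y\<bar> powr \<beta>" by (simp add: C_def algebra_simps)
    ultimately show "\<bar>circ_conv K_ker f x - circ_conv K_ker f y\<bar> \<le> C * M * \<bar>x - y\<bar> powr \<beta>"
      unfolding real_norm_def by linarith
  qed
qed

section \<open>Differences of the convolution, folded by evenness\<close>

definition smooth_diff :: "real \<Rightarrow> real \<Rightarrow> real \<Rightarrow> real" where
  "smooth_diff x y z = smooth_ker (y - z) + smooth_ker (y + z) - smooth_ker (x - z) - smooth_ker (x + z)"

lemma cos_diff_le:
  fixes x y :: real
  shows "\<bar>cos x - cos y\<bar> \<le> \<bar>x - y\<bar> * \<bar>x + y\<bar> / 2"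
proof -
  have "\<bar>cos x - cos y\<bar> = 2 * (\<bar>sin ((x + y) / 2)\<bar> * \<bar>sin ((y - x) / 2)\<bar>)"
    by (simp add: cos_diff_cos abs_mult)
  also have "\<dots> \<le> 2 * (\<bar>(x + y) / 2\<bar> * \<bar>(y - x) / 2\<bar>)"
    by (intro mult_left_mono mult_mono abs_sin_x_le_abs_x) auto
  also have "\<dots> = \<bar>x - y\<bar> * \<bar>x + y\<bar> / 2" by (simp add: abs_minus_commute)
  finally show ?thesis .
qed

text \<open>In the folded difference each mode becomes a multiple of
  \<open>cos (n * z) * (cos (n * x) - cos (n * y))\<close>, which is of second order rather than
  first. At \<open>x = 0\<close> the resulting factor is \<open>y\<^sup>2\<close>, as small as the
  remainder near the crest has to be.\<close>

lemma smooth_diff_bound: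
  obtains R where "0 \<le> R" "\<And>x y z. 0 \<le> x \<Longrightarrow> 0 \<le> y \<Longrightarrow> \<bar>smooth_diff x y z\<bar> \<le> R * ((x + y) * \<bar>x - y\<bar>)"
proof
  define A where "A = (\<Sum>n. real n ^ 2 * kw n)"
  have A0: "0 \<le> A" unfolding A_def by (intro suminf_nonneg kw_power_summable) (auto simp: kw_nonneg)
  show "0 \<le> 2 * A / pi" using A0 by simp
  fix x y z :: real assume xy: "0 \<le> x" "0 \<le> y"
  have s: "summable (\<lambda>n. kw n * cos (real n * t))" for t
    using kw_series_summable[of 0 t 0] by simp
  define q where "q = (\<lambda>n. kw n * cos (real n * (x - z)) + kw n * cos (real n * (x + z)) - kw n * cos (real n * (y - z)) - kw n * cos (real n * (y + z)))"
  have qs: "summable q" unfolding q_def by (intro summable_diff summable_add s)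
  have "smooth_diff x y z = 2 / pi * (kw_series 0 (x - z) + kw_series 0 (x + z) - kw_series 0 (y - z) - kw_series 0 (y + z))"
    by (simp add: smooth_diff_def smooth_ker_def field_simps)
  also have "kw_series 0 (x - z) + kw_series 0 (x + z) - kw_series 0 (y - z) - kw_series 0 (y + z) = suminf q"
    unfolding q_def kw_series_0
    by (simp add: suminf_add suminf_diff s summable_add summable_diff)
  finally have eq: "smooth_diff x y z = 2 / pi * suminf q" .
  have qb: "norm (q n) \<le> real n ^ 2 * kw n * ((x + y) * \<bar>x - y\<bar>)" for n
  proof -
    have "q n = 2 * kw n * cos (real n * z) * (cos (real n * x) - cos (real n * y))"
      by (simp add: q_def cos_add cos_diff algebra_simps)
    hence "\<bar>q n\<bar> = 2 * kw n * \<bar>cos (real n * z)\<bar> * \<bar>cos (real n * x) - cos (real n * y)\<bar>"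
      by (simp add: abs_mult kw_nonneg)
    also have "\<dots> \<le> 2 * kw n * 1 * (\<bar>real n * x - real n * y\<bar> * \<bar>real n * x + real n * y\<bar> / 2)"
      by (intro mult_mono cos_diff_le) (auto simp: kw_nonneg)
    also have "\<dots> = real n ^ 2 * kw n * ((x + y) * \<bar>x - y\<bar>)"
      using xy by (simp add: abs_mult power2_eq_square flip: right_diff_distrib distrib_left)
    finally show ?thesis by simp
  qed
  have "norm (suminf q) \<le> (\<Sum>n. real n ^ 2 * kw n * ((x + y) * \<bar>x - y\<bar>))"
    by (rule norm_suminf_le[OF qb]) (intro summable_mult2 kw_power_summable)
  also have "\<dots> = A * ((x + y) * \<bar>x - y\<bar>)"
    unfolding A_def by (rule suminf_mult2[OF kw_power_summable, symmetric])
  finally show "\<bar>smooth_diff x y z\<bar> \<le> 2 * A / pi * ((x + y) * \<bar>x - y\<bar>)"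
    unfolding eq by (simp add: abs_mult divide_right_mono mult.assoc)
qed

text \<open>Both singular terms combine by \<open>2 sin ((y - z) / 2) sin ((y + z) / 2) = cos z - cos y\<close>.\<close>

lemma circ_conv_K_diff_formula:
  assumes f: "continuous_on UNIV f" "\<And>z. f (- z) = f z" and xy: "x \<in> {0..pi}" "y \<in> {0..pi}"
  defines "D \<equiv> \<lambda>z. ((ln \<bar>cos z - cos x\<bar> - ln \<bar>cos z - cos y\<bar>) / pi + smooth_diff x y z) * f z"
  shows "(D has_integral (circ_conv K_ker f y - circ_conv K_ker f x)) {0..pi}"
proof -
  have i: "(\<lambda>z. K_ker (x - z) * f z) integrable_on {-pi..pi}" for x
    using circ_conv_integrable[OF K_ker_periodic K_ker_absolutely_integrable f(1)]
    unfolding absolutely_integrable_on_def by blast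
  have h: "((\<lambda>z. (K_ker (x - z) + K_ker (x + z)) * f z) has_integral circ_conv K_ker f x) {0..pi}" for x
    using integral_even_half[OF i[of x] pi_ge_zero]
    by (simp add: has_integral_integral circ_conv_def f(2) ring_distribs)
  have hd: "((\<lambda>z. (K_ker (y - z) + K_ker (y + z)) * f z - (K_ker (x - z) + K_ker (x + z)) * f z) has_integral
     (circ_conv K_ker f y - circ_conv K_ker f x)) {0..pi}"
    by (intro has_integral_diff h)
  have K: "K_ker (y - z) + K_ker (y + z) = smooth_ker (y - z) + smooth_ker (y + z) - (ln 2 + ln \<bar>cos z - cos y\<bar>) / pi"
    if "y \<in> {0..pi}" "z \<in> {0..pi} - {0, pi, y}" for y z
  proof -
    have 1: "sin ((y + z) / 2) \<noteq> 0" using that sin_gt_zero[of "(y + z) / 2"] by auto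
    have 2: "sin ((y - z) / 2) \<noteq> 0" using that by (subst sin_half_eq_0_iff) auto
    have "log_ker (y - z) + log_ker (y + z) = ln (\<bar>2 * sin ((y - z) / 2)\<bar> * \<bar>2 * sin ((y + z) / 2)\<bar>)"
      unfolding log_ker_def using 1 2 by (subst ln_mult) auto
    also have "\<bar>2 * sin ((y - z) / 2)\<bar> * \<bar>2 * sin ((y + z) / 2)\<bar> = 2 * \<bar>cos z - cos y\<bar>"
      by (simp add: cos_diff_cos abs_mult add.commute)
    also have "ln (2 * \<bar>cos z - cos y\<bar>) = ln 2 + ln \<bar>cos z - cos y\<bar>"
      using 1 2 by (subst ln_mult) (auto simp: cos_diff_cos add.commute)
    finally show ?thesis by (simp add: K_ker_def add_divide_distrib[symmetric] field_simps)
  qed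
  show ?thesis
  proof (rule has_integral_spike[OF _ _ hd])
    show "negligible {0, pi, x, y}" by auto
    fix z assume "z \<in> {0..pi} - {0, pi, x, y}"
    hence z: "z \<in> {0..pi} - {0, pi, x}" "z \<in> {0..pi} - {0, pi, y}" by auto
    show "D z = (K_ker (y - z) + K_ker (y + z)) * f z - (K_ker (x - z) + K_ker (x + z)) * f z"
      unfolding D_def K[OF xy(1) z(1)] K[OF xy(2) z(2)] smooth_diff_def
      by (simp add: field_simps)
  qed
qed

context crest
begin

lemma F_u_diff_formula:
  assumes "x \<in> {0..pi}" "y \<in> {0..pi}"
  shows "((\<lambda>z. ((ln \<bar>cos z - cos x\<bar> - ln \<bar>cos z - cos y\<bar>) / pi + smooth_diff x y z) * (u z - k))
     has_integral (crest_F c (u y) - crest_F c (u x))) {0..pi}"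
  unfolding F_u_diff[where k = k]
  by (rule circ_conv_K_diff_formula) (use assms u_even in \<open>auto intro!: continuous_intros u_cont\<close>)

end

text \<open>Combines \<open>crest_F_diff_ge\<close> with Hoelder continuity of the convolution. As
  \<open>u y \<ge> u y - u x\<close>, this already gives \<open>u\<close> itself the exponent
  \<open>\<beta> / 2\<close>, with a constant common to all speeds in the range.\<close>

lemma crest_F_diff_hoelder:
  assumes "0 < \<beta>" "\<beta> < 1" "0 < c1"
  obtains C where "0 \<le> C"
    "\<And>c \<phi> x y. crest c \<phi> \<Longrightarrow> c \<in> {c1..c2} \<Longrightarrow> 0 \<le> x \<Longrightarrow> x \<le> y \<Longrightarrow> y \<le> pi \<Longrightarrow>
       (crest.u c \<phi> y - crest.u c \<phi> x) * crest.u c \<phi> y \<le> C * (y - x) powr \<beta>"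
proof -
  obtain K where K: "0 \<le> K"
    "\<And>f M x y. continuous_on UNIV f \<Longrightarrow> (\<And>z. \<bar>f z\<bar> \<le> M) \<Longrightarrow> \<bar>x - y\<bar> \<le> pi \<Longrightarrow>
       \<bar>circ_conv K_ker f x - circ_conv K_ker f y\<bar> \<le> K * M * \<bar>x - y\<bar> powr \<beta>"
    using circ_conv_K_hoelder[OF assms(1,2)] by blast
  show ?thesis
  proof (rule that[of "2 / c1 * (K * \<bar>c2 + 2\<bar>)"])
    show "0 \<le> 2 / c1 * (K * \<bar>c2 + 2\<bar>)" using K assms by simp
    fix c \<phi> and x y :: real assume "crest c \<phi>" and c: "c \<in> {c1..c2}" and xy: "0 \<le> x" "x \<le> y" "y \<le> pi"
    then interpret crest c \<phi> by simp
    define D where "D = (u y - u x) * u y"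
    have D0: "0 \<le> D" using u_mono[OF xy] u_nonneg by (simp add: D_def)
    have "c1 / 2 * D \<le> c / 2 * D" using c D0 by (intro mult_right_mono) auto
    also have "\<dots> \<le> crest_F c (u y) - crest_F c (u x)"
      unfolding D_def by (intro crest_F_diff_ge c_nonneg u_nonneg u_mono xy)
    also have "\<dots> = circ_conv K_ker (\<lambda>z. u z - 0) y - circ_conv K_ker (\<lambda>z. u z - 0) x" by (rule F_u_diff)
    also have "\<dots> \<le> \<bar>circ_conv K_ker u y - circ_conv K_ker u x\<bar>" by simp
    also have "\<dots> \<le> K * \<bar>c2 + 2\<bar> * \<bar>y - x\<bar> powr \<beta>"
    proof (rule K(2)[OF u_cont])
      fix z show "\<bar>u z\<bar> \<le> \<bar>c2 + 2\<bar>" using u_nonneg[of z] u_le[of z] c by auto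
    qed (use xy in auto)
    finally show "D \<le> 2 / c1 * (K * \<bar>c2 + 2\<bar>) * (y - x) powr \<beta>"
      using xy assms by (simp add: field_simps)
  qed
qed

text \<open>\<open>u\<close> climbs from 0 to at least \<open>w\<close> (\<open>u_pi_ge\<close>)
  with a modulus of continuity common to all profiles, so
  \<open>u (pi - z) - u z \<ge> w / 2\<close> on a common interval \<open>{0..e}\<close>, and
  \<open>J_ge\<close> applies.\<close>

lemma crest_J_uniform_lower:
  assumes "0 < c1"
  obtains j where "0 < j"
    "\<And>c \<phi>. crest c \<phi> \<Longrightarrow> c \<in> {c1..c2} \<Longrightarrow> \<not> \<phi> constant_on UNIV \<Longrightarrow> j \<le> crest.J \<phi>"
proof (cases "c1 \<le> c2")
  case True
  obtain C where C: "0 \<le> C"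
    "\<And>c \<phi> x y. crest c \<phi> \<Longrightarrow> c \<in> {c1..c2} \<Longrightarrow> 0 \<le> x \<Longrightarrow> x \<le> y \<Longrightarrow> y \<le> pi \<Longrightarrow>
       (crest.u c \<phi> y - crest.u c \<phi> x) * crest.u c \<phi> y \<le> C * (y - x) powr (1 / 2)"
    using crest_F_diff_hoelder[of "1 / 2" c1 c2] assms by auto
  define w where "w = pi / (200 * (4 * c2 + 3))"
  have w: "0 < w" using assms True by (simp add: w_def)
  \<comment> \<open>Chosen such that \<open>C * sqrt e \<le> (w / 4)\<^sup>2\<close>; by
    \<open>(u y - u x)\<^sup>2 \<le> (u y - u x) * u y\<close> this limits the variation of
    \<open>u\<close> over a length \<open>e\<close> to \<open>w / 4\<close>.\<close>
  define e where "e = min (pi / 2) (((w / 4)\<^sup>2 / (C + 1)) powr 2)"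
  have e: "0 < e" "e \<le> pi / 2" "e \<le> ((w / 4)\<^sup>2 / (C + 1)) powr 2" using w C by (auto simp: e_def)
  show ?thesis
  proof (rule that[of "2 * (w / 2) * sin e"])
    show "0 < 2 * (w / 2) * sin e" using w e by (auto intro!: mult_pos_pos sin_gt_zero)
    fix c \<phi> assume cr: "crest c \<phi>" and c: "c \<in> {c1..c2}" and nc: "\<not> \<phi> constant_on UNIV"
    interpret crest c \<phi> by fact
    have small: "u y - u x \<le> w / 4" if xy: "0 \<le> x" "x \<le> y" "y \<le> pi" "y - x \<le> e" for x y
    proof (rule power2_le_imp_le)
      have "(u y - u x)\<^sup>2 \<le> (u y - u x) * u y"
        using u_mono[OF xy(1-3)] u_nonneg[of x] by (auto simp: power2_eq_square intro!: mult_left_mono)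
      also have "\<dots> \<le> C * (y - x) powr (1 / 2)" by (rule C(2)[OF cr c xy(1-3)])
      also have "\<dots> \<le> (C + 1) * (((w / 4)\<^sup>2 / (C + 1)) powr 2) powr (1 / 2)"
        using C xy e by (intro mult_mono powr_mono2) auto
      also have "\<dots> = (w / 4)\<^sup>2" using C w by (simp add: powr_powr)
      finally show "(u y - u x)\<^sup>2 \<le> (w / 4)\<^sup>2" .
    qed (use w in auto)
    have "w \<le> pi / (200 * (4 * c + 3))"
      unfolding w_def using c assms by (intro divide_left_mono mult_left_mono add_right_mono) (auto intro!: mult_pos_pos)
    also have "\<dots> \<le> u pi" by (rule u_pi_ge[OF nc])
    finally have wp: "w \<le> u pi" .
    show "2 * (w / 2) * sin e \<le> J"
    proof (rule J_ge)
      fix z assume z: "z \<in> {0..e}"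
      have "u pi - u (pi - z) \<le> w / 4" using z e by (intro small) auto
      moreover have "u z - u 0 \<le> w / 4" using z e by (intro small) auto
      ultimately show "w / 2 \<le> u (pi - z) - u z" using wp by simp
    qed (use e in auto)
  qed
qed (use that[of 1] in auto)

text \<open>By \<open>F_u_diff_ge\<close> from the crest, \<open>(1 - cos x) * J / 200\<close>,
  which is at least a multiple of \<open>x\<^sup>2\<close>, is at most
  \<open>crest_F c (u x)\<close>, hence at most a multiple of \<open>(u x)\<^sup>2\<close>. This
  precedes the logarithmic asymptotics, whose lower half relies on it.\<close>

lemma crest_u_uniform_lower:
  assumes "0 < c1"
  obtains a where "0 < a"
    "\<And>c \<phi> x. crest c \<phi> \<Longrightarrow> c \<in> {c1..c2} \<Longrightarrow> \<not> \<phi> constant_on UNIV \<Longrightarrow> 0 \<le> x \<Longrightarrow> x \<le> pi \<Longrightarrow> a * x \<le> crest.u c \<phi> x"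
proof (cases "c1 \<le> c2")
  case True
  obtain j where j: "0 < j"
    "\<And>c \<phi>. crest c \<phi> \<Longrightarrow> c \<in> {c1..c2} \<Longrightarrow> \<not> \<phi> constant_on UNIV \<Longrightarrow> j \<le> crest.J \<phi>"
    using crest_J_uniform_lower[OF assms, of c2] by blast
  define q where "q = j / (100 * pi\<^sup>2 * (4 * c2 + 3))"
  have q: "0 < q" using j assms True by (simp add: q_def)
  show ?thesis
  proof (rule that[of "sqrt q"])
    show "0 < sqrt q" using q by simp
    fix c \<phi> x assume cr: "crest c \<phi>" and c: "c \<in> {c1..c2}" and nc: "\<not> \<phi> constant_on UNIV"
      and x: "0 \<le> x" "x \<le> pi"
    interpret crest c \<phi> by fact
    have "x / pi \<le> sin (x / 2)" using abs_sin_half_ge[of x] x sin_ge_zero[of "x / 2"] by simp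
    hence "(x / pi)\<^sup>2 \<le> (sin (x / 2))\<^sup>2" using x by (intro power_mono) auto
    hence "2 * (x / pi)\<^sup>2 \<le> cos 0 - cos x" using cos_double_sin[of "x / 2"] by simp
    hence "2 * (x / pi)\<^sup>2 * j / 200 \<le> (cos 0 - cos x) * J / 200"
      using j(2)[OF cr c nc] j(1) by (intro divide_right_mono mult_mono) auto
    also have "\<dots> \<le> crest_F c (u x) - crest_F c (u 0)" using x by (intro F_u_diff_ge) auto
    also have "\<dots> \<le> (4 * c + 3) * ((u x - u 0) * u x)"
      using u_nonneg u_le by (intro crest_F_diff_le c_nonneg) auto
    also have "\<dots> \<le> (4 * c2 + 3) * ((u x - u 0) * u x)"
      using c by (intro mult_right_mono) (auto simp: u_nonneg)
    also have "2 * (x / pi)\<^sup>2 * j / 200 = (4 * c2 + 3) * (q * x\<^sup>2)"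
    proof -
      define d where "d = 4 * c2 + 3"
      have "0 < d" using True assms by (simp add: d_def)
      thus ?thesis unfolding q_def d_def[symmetric] by (simp add: power_divide)
    qed
    finally have "q * x\<^sup>2 \<le> (u x)\<^sup>2"
      using True assms by (simp add: power2_eq_square)
    hence "(sqrt q * x)\<^sup>2 \<le> (u x)\<^sup>2" using q by (simp add: power_mult_distrib)
    thus "sqrt q * x \<le> u x" by (rule power2_le_imp_le) (rule u_nonneg)
  qed
qed (use that[of 1] in auto)

section \<open>Logarithmic asymptotics at the crest\<close>

lemma one_minus_cos_bounds:
  fixes x :: real
  shows "1 - cos x \<le> x\<^sup>2 / 2" and "\<bar>x\<bar> \<le> pi \<Longrightarrow> x\<^sup>2 / 8 \<le> 1 - cos x"
proof -
  have "\<bar>cos 0 - cos x\<bar> \<le> \<bar>0 - x\<bar> * \<bar>0 + x\<bar> / 2" by (rule cos_diff_le)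
  thus "1 - cos x \<le> x\<^sup>2 / 2" by (simp add: power2_eq_square flip: abs_mult)
  assume "\<bar>x\<bar> \<le> pi"
  hence "(\<bar>x\<bar> / 2)\<^sup>2 \<le> \<bar>2 * sin (x / 2)\<bar>\<^sup>2" by (intro power_mono abs_two_sin_half_ge) auto
  thus "x\<^sup>2 / 8 \<le> 1 - cos x"
    using cos_double_sin[of "x / 2"] by (simp add: power_divide power_mult_distrib)
qed

lemma abs_cos_diff_ge:
  assumes "0 \<le> x" "0 \<le> z" "x + z \<le> pi"
  shows "(x + z) * \<bar>x - z\<bar> / 8 \<le> \<bar>cos x - cos z\<bar>"
proof -
  have "(x + z) / 2 \<le> \<bar>2 * sin ((x + z) / 2)\<bar>" using abs_two_sin_half_ge[of "x + z"] assms by simp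
  moreover have "\<bar>x - z\<bar> / 2 \<le> \<bar>2 * sin ((x - z) / 2)\<bar>" using assms by (intro abs_two_sin_half_ge) auto
  ultimately have "(x + z) / 2 * (\<bar>x - z\<bar> / 2) \<le> \<bar>2 * sin ((x + z) / 2)\<bar> * \<bar>2 * sin ((x - z) / 2)\<bar>"
    using assms by (intro mult_mono) auto
  also have "\<dots> = 2 * \<bar>cos z - cos x\<bar>" by (simp add: cos_diff_cos abs_mult add.commute)
  finally show ?thesis by (simp add: abs_minus_commute)
qed

text \<open>With \<open>s = 1 - cos x\<close> and \<open>t = 1 - cos z\<close> the quotient is
  \<open>1 / (1 - s / t)\<close>; \<open>4 * x \<le> z\<close> forces
  \<open>s / t \<le> 1 / 4\<close>, so its logarithm is at most
  \<open>4 / 3 * (s / t)\<close>.\<close>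

lemma log_quotient_far:
  assumes "0 < x" "4 * x \<le> z" "z \<le> pi"
  shows "ln \<bar>cos z - 1\<bar> - ln \<bar>cos z - cos x\<bar> \<le> 6 * x\<^sup>2 / z\<^sup>2"
proof -
  define s where "s = 1 - cos x"
  define t where "t = 1 - cos z"
  have t: "z\<^sup>2 / 8 \<le> t" unfolding t_def using assms by (intro one_minus_cos_bounds) auto
  have z2: "0 < z\<^sup>2" using assms by simp
  have t0: "0 < t" using t z2 by linarith
  have s: "0 \<le> s" "s \<le> x\<^sup>2 / 2" using one_minus_cos_bounds(1)[of x] by (auto simp: s_def)
  have st: "s / t \<le> 4 * x\<^sup>2 / z\<^sup>2"
  proof -
    have "s / t \<le> (x\<^sup>2 / 2) / (z\<^sup>2 / 8)" using s t z2 by (intro frac_le) auto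
    thus ?thesis by simp
  qed
  have "(4 * x)\<^sup>2 \<le> z\<^sup>2" using assms by (intro power_mono) auto
  hence "4 * x\<^sup>2 / z\<^sup>2 \<le> 1 / 4" using z2 by (simp add: power_mult_distrib divide_le_eq)
  hence st4: "s / t \<le> 1 / 4" using st by linarith
  have pos: "0 < t - s" using st4 t0 by (simp add: divide_le_eq)
  have "ln \<bar>cos z - 1\<bar> - ln \<bar>cos z - cos x\<bar> = ln (t / (t - s))"
    using pos t0 by (simp add: ln_div t_def s_def)
  also have "\<dots> \<le> t / (t - s) - 1" using pos t0 by (intro ln_le_minus_one) auto
  also have "\<dots> = (s / t) / (1 - s / t)" using pos t0 by (simp add: field_simps)
  also have "\<dots> \<le> (s / t) / (3 / 4)"
  proof (rule divide_left_mono)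
    show "0 < (1 - s / t) * (3 / 4)" using st4 by (intro mult_pos_pos) linarith+
    show "3 / 4 \<le> 1 - s / t" using st4 by linarith
  qed (use s t0 in auto)
  also have "\<dots> \<le> (4 * x\<^sup>2 / z\<^sup>2) / (3 / 4)" using st by (intro divide_right_mono) auto
  also have "\<dots> = 16 / 3 * (x\<^sup>2 / z\<^sup>2)" by simp
  also have "\<dots> \<le> 6 * (x\<^sup>2 / z\<^sup>2)" by (intro mult_right_mono) auto
  also have "\<dots> = 6 * x\<^sup>2 / z\<^sup>2" by simp
  finally show ?thesis .
qed

text \<open>Here the quotient is only bounded by \<open>16 * x / |x - z|\<close>;
  \<open>ln y \<le> 2 * sqrt y\<close> makes the singularity at \<open>z = x\<close> integrable,
  with an integral of order \<open>x\<close> over \<open>{0..4 * x}\<close>. The bound on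
  \<open>x\<close> keeps \<open>x + z\<close> below \<open>pi\<close>.\<close>

lemma log_quotient_near:
  assumes "0 < x" "x \<le> 1 / 4" "0 < z" "z \<le> 4 * x" "z \<noteq> x"
  shows "ln \<bar>cos z - 1\<bar> - ln \<bar>cos z - cos x\<bar> \<le> 8 * sqrt x * \<bar>x - z\<bar> powr - (1 / 2)"
proof -
  have pi: "2 \<le> pi" by (rule pi_ge_two)
  have d: "0 < \<bar>x - z\<bar>" using assms by simp
  have 1: "(x + z) * \<bar>x - z\<bar> / 8 \<le> \<bar>cos z - cos x\<bar>"
    using abs_cos_diff_ge[of x z] assms pi by (simp add: abs_minus_commute)
  have p1: "0 < (x + z) * \<bar>x - z\<bar> / 8" using assms d by simp
  have c1: "0 < \<bar>cos z - 1\<bar>" "\<bar>cos z - 1\<bar> = 1 - cos z"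
    using one_minus_cos_bounds(2)[of z] assms pi by (auto simp: power2_eq_square)
      (smt (verit) mult_pos_pos divide_pos_pos)
  define y where "y = \<bar>cos z - 1\<bar> / \<bar>cos z - cos x\<bar>"
  have "\<bar>cos z - 1\<bar> \<le> z * (x + z) / 2"
  proof -
    have "\<bar>cos z - 1\<bar> \<le> z\<^sup>2 / 2" unfolding c1(2) by (rule one_minus_cos_bounds)
    also have "\<dots> \<le> z * (x + z) / 2" using assms by (simp add: power2_eq_square algebra_simps)
    finally show ?thesis .
  qed
  hence "y \<le> (z * (x + z) / 2) / ((x + z) * \<bar>x - z\<bar> / 8)"
    unfolding y_def using 1 p1 assms by (intro frac_le) auto
  also have "\<dots> = 4 * z / \<bar>x - z\<bar>"
  proof -
    define p where "p = x + z"
    define e where "e = \<bar>x - z\<bar>"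
    have "0 < p" "0 < e" using assms d by (auto simp: p_def e_def)
    thus ?thesis unfolding p_def[symmetric] e_def[symmetric] by simp
  qed
  also have "\<dots> \<le> 16 * x / \<bar>x - z\<bar>" using assms by (intro divide_right_mono) auto
  finally have y: "y \<le> 16 * (x / \<bar>x - z\<bar>)" by simp
  have y0: "0 < y" unfolding y_def using c1 1 p1 by (intro divide_pos_pos) auto
  have "ln \<bar>cos z - 1\<bar> - ln \<bar>cos z - cos x\<bar> = ln y" unfolding y_def using c1 1 p1 by (subst ln_div) auto
  also have "\<dots> = 2 * ln (sqrt y)" using y0 by (simp add: ln_sqrt)
  also have "\<dots> \<le> 2 * sqrt y" using ln_le_minus_one[of "sqrt y"] y0 by simp
  also have "\<dots> \<le> 2 * sqrt (16 * (x / \<bar>x - z\<bar>))" using y by simp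
  also have "\<dots> = 2 * (4 * (sqrt x / sqrt \<bar>x - z\<bar>))"
    by (simp only: real_sqrt_mult real_sqrt_divide) simp
  also have "\<dots> = 8 * sqrt x * \<bar>x - z\<bar> powr - (1 / 2)"
  proof -
    have "\<bar>x - z\<bar> powr - (1 / 2) = 1 / sqrt \<bar>x - z\<bar>"
      unfolding powr_minus_divide by (subst powr_half_sqrt) auto
    thus ?thesis by (simp only:) simp
  qed
  finally show ?thesis .
qed

text \<open>For \<open>s = 1 - cos x\<close> and \<open>t = 1 - cos z\<close> this is
  \<open>s / t \<le> - ln (1 - s / t)\<close>.\<close>

lemma log_quotient_ge:
  assumes "0 < x" "x < z" "z \<le> pi"
  shows "x\<^sup>2 / (4 * z\<^sup>2) \<le> ln \<bar>cos z - 1\<bar> - ln \<bar>cos z - cos x\<bar>"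
proof -
  define s where "s = 1 - cos x"
  define t where "t = 1 - cos z"
  have ts: "s < t" using cos_monotone_0_pi[of x z] assms by (simp add: s_def t_def)
  have s: "x\<^sup>2 / 8 \<le> s" unfolding s_def using assms by (intro one_minus_cos_bounds) auto
  have s0: "0 < s" using s assms by (smt (verit) divide_pos_pos zero_less_power)
  have t: "t \<le> z\<^sup>2 / 2" unfolding t_def by (rule one_minus_cos_bounds)
  have "x\<^sup>2 / (4 * z\<^sup>2) = (x\<^sup>2 / 8) / (z\<^sup>2 / 2)" by simp
  also have "\<dots> \<le> s / t" using s t s0 ts by (intro frac_le) auto
  also have "\<dots> = 1 - (t - s) / t" using s0 ts by (simp add: field_simps)
  also have "\<dots> \<le> - ln ((t - s) / t)"
    using ln_le_minus_one[of "(t - s) / t"] s0 ts by simp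
  also have "\<dots> = ln \<bar>cos z - 1\<bar> - ln \<bar>cos z - cos x\<bar>"
    using s0 ts by (simp add: ln_div s_def t_def)
  finally show ?thesis .
qed

text \<open>Denoted \<open>J\<close> in the overview.\<close>

definition tail_integral :: "(real \<Rightarrow> real) \<Rightarrow> real \<Rightarrow> real" where
  "tail_integral u x = integral {x..pi} (\<lambda>z. u z / z\<^sup>2)"

lemma tail_integrand_continuous:
  fixes u :: "real \<Rightarrow> real"
  assumes "continuous_on UNIV u" "0 < x"
  shows "continuous_on {x..b} (\<lambda>z. u z / z\<^sup>2)"
  using assms by (intro continuous_intros continuous_on_subset[OF assms(1)]) auto

lemma tail_integrand_integrable:
  fixes u :: "real \<Rightarrow> real"
  assumes "continuous_on UNIV u" "0 < x"
  shows "(\<lambda>z. u z / z\<^sup>2) integrable_on {x..b}"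
  by (intro integrable_continuous_interval tail_integrand_continuous assms)

lemma tail_integral_has_derivative:
  assumes "continuous_on UNIV u" "0 < x" "x < pi"
  shows "(tail_integral u has_real_derivative - (u x / x\<^sup>2)) (at x)"
proof -
  define g where "g = (\<lambda>z. u z / z\<^sup>2)"
  have c: "continuous_on {x / 2..pi} g" unfolding g_def using assms by (intro tail_integrand_continuous) auto
  \<comment> \<open>The fundamental theorem differentiates in the upper limit, so the integral is
    rewritten with the fixed lower limit \<open>x / 2\<close>.\<close>
  have "((\<lambda>t. integral {x / 2..t} g) has_real_derivative g x) (at x within {x / 2..pi})"
    using assms by (intro integral_has_real_derivative c) auto
  hence "((\<lambda>t. integral {x / 2..t} g) has_real_derivative g x) (at x)"
    using assms by (subst (asm) at_within_interior) (auto simp: interior_atLeastAtMost_real)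
  hence "((\<lambda>t. integral {x / 2..pi} g - integral {x / 2..t} g) has_real_derivative 0 - g x) (at x)"
    by (intro derivative_intros)
  moreover have "\<forall>\<^sub>F t in nhds x. integral {x / 2..pi} g - integral {x / 2..t} g = tail_integral u t"
  proof -
    have "\<forall>\<^sub>F t in nhds x. t \<in> {x / 2<..<pi}" using assms by (intro eventually_nhds_in_open) auto
    thus ?thesis
    proof eventually_elim
      case (elim t)
      have "integral {x / 2..t} g + integral {t..pi} g = integral {x / 2..pi} g"
        using elim by (intro Henstock_Kurzweil_Integration.integral_combine integrable_continuous_interval c) auto
      thus ?case by (simp add: tail_integral_def g_def)
    qed
  qed
  ultimately show ?thesis by (subst (asm) DERIV_cong_ev[OF refl _ refl]) (auto simp: g_def)
qed

lemma tail_integral_nonneg: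
  assumes "continuous_on UNIV u" "\<And>z. 0 \<le> u z" "0 < x"
  shows "0 \<le> tail_integral u x"
  unfolding tail_integral_def
  by (intro Henstock_Kurzweil_Integration.integral_nonneg tail_integrand_integrable assms)
     (use assms in auto)

lemma tail_integral_mono:
  assumes "continuous_on UNIV u" "\<And>z. 0 \<le> u z" "0 < x" "x \<le> y"
  shows "tail_integral u y \<le> tail_integral u x"
  unfolding tail_integral_def
  by (rule integral_subset_le) (use assms in \<open>auto intro!: tail_integrand_integrable\<close>)

lemma has_integral_inverse_square:
  fixes a b :: real
  assumes "0 < a" "a \<le> b"
  shows "((\<lambda>z. 1 / z\<^sup>2) has_integral (1 / a - 1 / b)) {a..b}"
proof -
  have "((\<lambda>z. 1 / z\<^sup>2) has_integral (- 1 / b - (- 1 / a))) {a..b}"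
    using assms
    by (intro fundamental_theorem_of_calculus)
       (auto intro!: derivative_eq_intros simp: power2_eq_square simp flip: has_real_derivative_iff_has_vector_derivative)
  thus ?thesis by simp
qed

lemma tail_integral_ge:
  assumes "continuous_on UNIV u" "0 < x" "x \<le> pi" "\<And>z. x \<le> z \<Longrightarrow> z \<le> pi \<Longrightarrow> m \<le> u z"
  shows "m * (1 / x - 1 / pi) \<le> tail_integral u x"
  unfolding tail_integral_def
proof (rule has_integral_le[OF has_integral_mult_right integrable_integral])
  show "((\<lambda>z. 1 / z\<^sup>2) has_integral (1 / x - 1 / pi)) {x..pi}" by (intro has_integral_inverse_square assms)
  show "(\<lambda>z. u z / z\<^sup>2) integrable_on {x..pi}" by (intro tail_integrand_integrable assms)
  fix z assume "z \<in> {x..pi}"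
  thus "m * (1 / z\<^sup>2) \<le> u z / z\<^sup>2" using assms(4)[of z] by (simp add: divide_right_mono)
qed

lemma tail_integral_le:
  assumes "continuous_on UNIV u" "0 < x" "x \<le> pi" "\<And>z. u z \<le> m" "0 \<le> m"
  shows "tail_integral u x \<le> m / x"
proof -
  have "tail_integral u x \<le> m * (1 / x - 1 / pi)"
    unfolding tail_integral_def
  proof (rule has_integral_le[OF integrable_integral has_integral_mult_right])
    show "((\<lambda>z. 1 / z\<^sup>2) has_integral (1 / x - 1 / pi)) {x..pi}" by (intro has_integral_inverse_square assms)
    show "(\<lambda>z. u z / z\<^sup>2) integrable_on {x..pi}" by (intro tail_integrand_integrable assms)
    fix z assume "z \<in> {x..pi}"
    thus "u z / z\<^sup>2 \<le> m * (1 / z\<^sup>2)" using assms(4)[of z] by (simp add: divide_right_mono)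
  qed
  also have "\<dots> \<le> m * (1 / x)" using assms by (intro mult_left_mono) auto
  finally show ?thesis by simp
qed

text \<open>The hypothesis is a differential inequality. With
  \<open>G = 1 + tail_integral u y\<close> it bounds \<open>u y\<close> by
  \<open>sqrt C * y * sqrt G\<close>, while \<open>sqrt G\<close> has derivative
  \<open>- u y / (2 * y\<^sup>2 * sqrt G)\<close>; hence \<open>sqrt G + sqrt C / 2 * ln y\<close>
  is nondecreasing. The summand 1 keeps \<open>G\<close> positive and absorbs errors of order
  \<open>y\<^sup>2\<close>.\<close>

lemma sqrt_tail_upper:
  assumes u: "continuous_on UNIV u" "\<And>z. 0 \<le> u z" and x: "0 < x" "x \<le> d" "d < pi"
    and C: "0 \<le> C" "\<And>y. 0 < y \<Longrightarrow> y \<le> d \<Longrightarrow> (u y)\<^sup>2 \<le> C * y\<^sup>2 * (1 + tail_integral u y)"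
  shows "sqrt (1 + tail_integral u x) \<le> sqrt (1 + tail_integral u d) + sqrt C / 2 * ln (d / x)"
proof -
  define h where "h = (\<lambda>y. sqrt (1 + tail_integral u y) + sqrt C / 2 * ln y)"
  have "h x \<le> h d"
  proof (rule DERIV_nonneg_imp_nondecreasing[OF x(2)])
    fix y assume y: "x \<le> y" "y \<le> d"
    define G where "G = 1 + tail_integral u y"
    have G: "1 \<le> G" using tail_integral_nonneg[OF u, of y] x y by (simp add: G_def)
    have y0: "0 < y" using x y by linarith
    have "(h has_real_derivative (inverse (sqrt G) / 2 * - (u y / y\<^sup>2) + sqrt C / 2 * (1 / y))) (at y)"
      unfolding h_def using x y G
      by (auto intro!: derivative_eq_intros tail_integral_has_derivative[OF u(1)] simp: G_def)
    moreover have "0 \<le> inverse (sqrt G) / 2 * - (u y / y\<^sup>2) + sqrt C / 2 * (1 / y)"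
    proof -
      have "u y \<le> sqrt (C * y\<^sup>2 * G)"
        unfolding G_def using C(2)[OF y0 y(2)] by (intro real_le_rsqrt)
      also have "\<dots> = sqrt C * y * sqrt G" using y0 by (simp add: real_sqrt_mult)
      finally have "u y \<le> sqrt C * y * sqrt G" .
      thus ?thesis using G y0 by (simp add: field_simps power2_eq_square)
    qed
    ultimately show "\<exists>z. (h has_real_derivative z) (at y) \<and> 0 \<le> z" by blast
  qed
  thus ?thesis using x by (simp add: h_def ln_div algebra_simps diff_divide_distrib)
qed

text \<open>The reverse differential inequality: the root of the tail plus
  \<open>ln y / (2 * sqrt C)\<close> is nonincreasing. Positivity of the tail makes the root
  differentiable.\<close>

lemma sqrt_tail_lower:
  assumes u: "continuous_on UNIV u" "\<And>z. 0 \<le> u z" and x: "0 < x" "x \<le> d" "d < pi"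
    and G: "\<And>y. 0 < y \<Longrightarrow> y \<le> d \<Longrightarrow> 0 < tail_integral u y"
    and C: "0 < C" "\<And>y. 0 < y \<Longrightarrow> y \<le> d \<Longrightarrow> y\<^sup>2 * tail_integral u y \<le> C * (u y)\<^sup>2"
  shows "ln (d / x) / (2 * sqrt C) \<le> sqrt (tail_integral u x)"
proof -
  define k where "k = 1 / (2 * sqrt C)"
  define h where "h = (\<lambda>y. sqrt (tail_integral u y) + k * ln y)"
  have "h d \<le> h x"
  proof (rule DERIV_nonpos_imp_nonincreasing[OF x(2)])
    fix y assume y: "x \<le> y" "y \<le> d"
    define G where "G = tail_integral u y"
    have y0: "0 < y" using x y by linarith
    have G0: "0 < G" using G[OF y0 y(2)] by (simp add: G_def)
    have "(h has_real_derivative (inverse (sqrt G) / 2 * - (u y / y\<^sup>2) + k * (1 / y))) (at y)"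
      unfolding h_def using x y G0 C(1)
      by (auto intro!: derivative_eq_intros tail_integral_has_derivative[OF u(1)] simp: G_def)
    moreover have "inverse (sqrt G) / 2 * - (u y / y\<^sup>2) + k * (1 / y) \<le> 0"
    proof -
      have "sqrt (y\<^sup>2 * G) \<le> sqrt (C * (u y)\<^sup>2)" unfolding G_def using C(2)[OF y0 y(2)] by simp
      hence "y * sqrt G \<le> sqrt C * u y" using y0 u(2)[of y] by (simp add: real_sqrt_mult)
      thus ?thesis using G0 y0 C(1) by (simp add: k_def field_simps power2_eq_square)
    qed
    ultimately show "\<exists>z. (h has_real_derivative z) (at y) \<and> z \<le> 0" by blast
  qed
  moreover have "sqrt (tail_integral u d) \<ge> 0" using G[of d] x by simp
  ultimately have "k * ln d - k * ln x \<le> sqrt (tail_integral u x)" unfolding h_def by linarith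
  thus ?thesis using x by (simp add: k_def ln_div diff_divide_distrib)
qed

text \<open>Near the crest \<open>u\<^sup>2\<close> is bounded by \<open>x\<^sup>2\<close> times the tail integral: the contribution of \<open>z < 4x\<close>
  is controlled by \<open>u (4x)\<close>, which by monotonicity the tail integral also dominates.\<close>

lemma crest_square_le_tail:
  assumes "0 < c1"
  obtains C where "0 \<le> C"
    "\<And>c \<phi> x. crest c \<phi> \<Longrightarrow> c \<in> {c1..c2} \<Longrightarrow> 0 < x \<Longrightarrow> x \<le> 1 / 4 \<Longrightarrow>
       (crest.u c \<phi> x)\<^sup>2 \<le> C * x\<^sup>2 * (1 + tail_integral (crest.u c \<phi>) x)"
proof -
  obtain R where R: "0 \<le> R" "\<And>x y z. 0 \<le> x \<Longrightarrow> 0 \<le> y \<Longrightarrow> \<bar>smooth_diff x y z\<bar> \<le> R * ((x + y) * \<bar>x - y\<bar>)"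
    using smooth_diff_bound by blast
  define m where "m = \<bar>c2 + 2\<bar>"
  show ?thesis
  proof (rule that[of "2 / c1 * (259 + pi * R * m)"])
    show "0 \<le> 2 / c1 * (259 + pi * R * m)" using assms R by (simp add: m_def)
    fix c \<phi> and x :: real assume "crest c \<phi>" and c: "c \<in> {c1..c2}" and x: "0 < x" "x \<le> 1 / 4"
    then interpret crest c \<phi> by simp
    have xpi: "4 * x \<le> pi" "x \<le> pi" using x pi_ge_two by linarith+
    have um: "u z \<le> m" for z using u_le[of z] c by (auto simp: m_def)
    define D where "D = (\<lambda>z. ((ln \<bar>cos z - cos 0\<bar> - ln \<bar>cos z - cos x\<bar>) / pi + smooth_diff 0 x z) * u z)"
    have D: "(D has_integral (crest_F c (u x))) {0..pi}"
      using F_u_diff_formula[of 0 x 0] x xpi by (simp add: D_def)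
    have Di: "D integrable_on {a..b}" if "{a..b} \<subseteq> {0..pi}" for a b
      using integrable_subinterval_real[OF has_integral_integrable[OF D] that] .
    have sd: "smooth_diff 0 x z * u z \<le> R * x\<^sup>2 * m" for z
    proof -
      have "smooth_diff 0 x z * u z \<le> \<bar>smooth_diff 0 x z\<bar> * u z" using u_nonneg by (intro mult_right_mono) auto
      also have "\<dots> \<le> (R * x\<^sup>2) * m"
        using R(2)[of 0 x z] x um[of z] u_nonneg[of z] R(1) by (intro mult_mono) (auto simp: power2_eq_square)
      finally show ?thesis .
    qed
    \<comment> \<open>Majorants for the two regions: \<open>g1\<close> for
      \<open>z \<le> 4 * x\<close> uses \<open>log_quotient_near\<close> and
      \<open>u z \<le> u (4 * x)\<close>, \<open>g2\<close> beyond it uses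
      \<open>log_quotient_far\<close>. Both carry the smooth remainder.\<close>
    define g1 where "g1 = (\<lambda>z. (8 * sqrt x * u (4 * x) / pi) * \<bar>x - z\<bar> powr - (1 / 2) + R * x\<^sup>2 * m)"
    define g2 where "g2 = (\<lambda>z. (6 * x\<^sup>2 / pi) * (u z / z\<^sup>2) + R * x\<^sup>2 * m)"
    have pw: "(\<lambda>z. \<bar>x - z\<bar> powr - (1 / 2)) integrable_on {0..4 * x}"
      "integral {0..4 * x} (\<lambda>z. \<bar>x - z\<bar> powr - (1 / 2)) \<le> 8 * sqrt x"
      using abs_powr_integrable_bound[of "1/2" x 0 "4 * x"] x
      by (auto simp: powr_half_sqrt real_sqrt_mult)
    have "integral {0..4 * x} D \<le> integral {0..4 * x} g1"
    proof (rule integral_le_spike[where N = "{0, x}"])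
      show "g1 integrable_on {0..4 * x}"
        unfolding g1_def by (intro integrable_add integrable_on_mult_right pw) auto
      fix z assume z: "z \<in> {0..4 * x} - {0, x}"
      have "(ln \<bar>cos z - 1\<bar> - ln \<bar>cos z - cos x\<bar>) / pi * u z \<le> (8 * sqrt x * \<bar>x - z\<bar> powr - (1 / 2)) / pi * u (4 * x)"
      proof -
        have "(ln \<bar>cos z - 1\<bar> - ln \<bar>cos z - cos x\<bar>) / pi * u z \<le> (8 * sqrt x * \<bar>x - z\<bar> powr - (1 / 2)) / pi * u z"
          using z x by (intro mult_right_mono divide_right_mono log_quotient_near u_nonneg) auto
        also have "\<dots> \<le> (8 * sqrt x * \<bar>x - z\<bar> powr - (1 / 2)) / pi * u (4 * x)"
          using z x xpi by (intro mult_left_mono u_mono) auto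
        finally show ?thesis .
      qed
      also have "(8 * sqrt x * \<bar>x - z\<bar> powr - (1 / 2)) / pi * u (4 * x) = (8 * sqrt x * u (4 * x) / pi) * \<bar>x - z\<bar> powr - (1 / 2)"
        by simp
      finally show "D z \<le> g1 z" using sd[of z] unfolding D_def g1_def distrib_right cos_zero by linarith
    qed (use Di[of 0 "4 * x"] xpi in auto)
    also have "integral {0..4 * x} g1 \<le> 32 * x * u (4 * x) + 4 * x * (R * x\<^sup>2 * m)"
    proof -
      have "integral {0..4 * x} g1 = (8 * sqrt x * u (4 * x) / pi) * integral {0..4 * x} (\<lambda>z. \<bar>x - z\<bar> powr - (1 / 2)) + 4 * x * (R * x\<^sup>2 * m)"
        unfolding g1_def using pw(1) x
        by (subst Henstock_Kurzweil_Integration.integral_add) (auto intro: integrable_on_mult_right)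
      also have "(8 * sqrt x * u (4 * x) / pi) * integral {0..4 * x} (\<lambda>z. \<bar>x - z\<bar> powr - (1 / 2)) \<le> (8 * sqrt x * u (4 * x) / 2) * (8 * sqrt x)"
        using x pw u_nonneg pi_ge_two
        by (intro mult_mono divide_left_mono Henstock_Kurzweil_Integration.integral_nonneg) auto
      also have "(8 * sqrt x * u (4 * x) / 2) * (8 * sqrt x) = 32 * x * u (4 * x)" using x by simp
      finally show ?thesis by simp
    qed
    finally have I1: "integral {0..4 * x} D \<le> 32 * x * u (4 * x) + 4 * x * (R * x\<^sup>2 * m)" .
    have i2: "(\<lambda>z. u z / z\<^sup>2) integrable_on {4 * x..pi}" using x by (intro tail_integrand_integrable u_cont) auto
    have "integral {4 * x..pi} D \<le> integral {4 * x..pi} g2"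
    proof (rule integral_le)
      show "g2 integrable_on {4 * x..pi}"
        unfolding g2_def by (intro integrable_add integrable_on_mult_right i2) auto
      fix z assume z: "z \<in> {4 * x..pi}"
      have "(ln \<bar>cos z - 1\<bar> - ln \<bar>cos z - cos x\<bar>) / pi * u z \<le> (6 * x\<^sup>2 / z\<^sup>2) / pi * u z"
        using z x by (intro mult_right_mono divide_right_mono log_quotient_far u_nonneg) auto
      also have "(6 * x\<^sup>2 / z\<^sup>2) / pi * u z = (6 * x\<^sup>2 / pi) * (u z / z\<^sup>2)" by simp
      finally show "D z \<le> g2 z" using sd[of z] unfolding D_def g2_def distrib_right cos_zero by linarith
    qed (use Di[of "4 * x" pi] xpi x in auto)
    also have "\<dots> = (6 * x\<^sup>2 / pi) * tail_integral u (4 * x) + (pi - 4 * x) * (R * x\<^sup>2 * m)"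
      unfolding g2_def tail_integral_def
      using has_integral_const_real[of "R * x\<^sup>2 * m" "4 * x" pi] xpi
      by (intro integral_unique has_integral_add has_integral_mult_right integrable_integral i2) auto
    also have "(6 * x\<^sup>2 / pi) * tail_integral u (4 * x) \<le> (6 * x\<^sup>2 / 2) * tail_integral u (4 * x)"
      using x pi_ge_two by (intro mult_right_mono divide_left_mono tail_integral_nonneg u_cont u_nonneg) auto
    finally have I2: "integral {4 * x..pi} D \<le> 3 * x\<^sup>2 * tail_integral u (4 * x) + (pi - 4 * x) * (R * x\<^sup>2 * m)" by simp
    have "integral {0..4 * x} D + integral {4 * x..pi} D = crest_F c (u x)"
      using Henstock_Kurzweil_Integration.integral_combine[of 0 "4 * x" pi D] D x xpi
      by (auto simp: integral_unique)
    hence F: "crest_F c (u x) \<le> 32 * x * u (4 * x) + 3 * x\<^sup>2 * tail_integral u (4 * x) + pi * (R * x\<^sup>2 * m)"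
      using I1 I2 by (simp add: algebra_simps)
    have "u (4 * x) * (1 / (4 * x) - 1 / pi) \<le> tail_integral u (4 * x)"
      using x xpi by (intro tail_integral_ge u_cont u_mono) auto
    moreover have "1 / (8 * x) \<le> 1 / (4 * x) - 1 / pi"
    proof -
      have "1 / pi \<le> 1 / 2" using pi_ge_two by (intro divide_left_mono) auto
      also have "\<dots> \<le> 1 / (8 * x)" using x by (simp add: field_simps)
      also have "1 / (8 * x) + 1 / (8 * x) = 1 / (4 * x)" using x by (simp add: field_simps)
      finally show ?thesis by linarith
    qed
    ultimately have "u (4 * x) * (1 / (8 * x)) \<le> tail_integral u (4 * x)"
      using mult_left_mono[OF \<open>1 / (8 * x) \<le> 1 / (4 * x) - 1 / pi\<close> u_nonneg[of "4 * x"]] by linarith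
    \<comment> \<open>The tail gives \<open>u (4 * x) \<le> 8 * x * tail_integral u (4 * x)\<close>,
      whence \<open>32 * 8 = 256\<close>; with the 3 from the far region this makes 259.\<close>
    hence "32 * x * u (4 * x) \<le> 256 * x\<^sup>2 * tail_integral u (4 * x)"
      using x by (simp add: field_simps power2_eq_square)
    hence "crest_F c (u x) \<le> 259 * x\<^sup>2 * tail_integral u (4 * x) + pi * (R * x\<^sup>2 * m)" using F by linarith
    also have "\<dots> \<le> 259 * x\<^sup>2 * tail_integral u x + pi * (R * x\<^sup>2 * m)"
      using x by (intro add_right_mono mult_left_mono tail_integral_mono u_cont u_nonneg) auto
    also have "\<dots> \<le> (259 + pi * R * m) * (x\<^sup>2 * (1 + tail_integral u x))"
    proof -
      define T where "T = tail_integral u x"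
      have "0 \<le> T" unfolding T_def using x by (intro tail_integral_nonneg u_cont u_nonneg)
      hence "0 \<le> pi * R * m * (x\<^sup>2 * T)" using R by (simp add: m_def)
      thus ?thesis unfolding T_def[symmetric] by (simp add: algebra_simps)
    qed
    finally have "crest_F c (u x) \<le> (259 + pi * R * m) * (x\<^sup>2 * (1 + tail_integral u x))" .
    moreover have "c1 / 2 * (u x)\<^sup>2 \<le> crest_F c (u x)"
    proof -
      have "c1 / 2 * (u x)\<^sup>2 \<le> c / 2 * ((u x - 0) * u x)" using c by (simp add: power2_eq_square mult_right_mono)
      also have "\<dots> \<le> crest_F c (u x) - crest_F c 0" by (intro crest_F_diff_ge c_nonneg u_nonneg) auto
      finally show ?thesis by simp
    qed
    ultimately have "c1 / 2 * (u x)\<^sup>2 \<le> (259 + pi * R * m) * (x\<^sup>2 * (1 + tail_integral u x))" by linarith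
    hence "2 / c1 * (c1 / 2 * (u x)\<^sup>2) \<le> 2 / c1 * ((259 + pi * R * m) * (x\<^sup>2 * (1 + tail_integral u x)))"
      using assms by (intro mult_left_mono) auto
    moreover have "2 / c1 * (c1 / 2 * (u x)\<^sup>2) = (u x)\<^sup>2" using assms by simp
    ultimately show "(u x)\<^sup>2 \<le> 2 / c1 * (259 + pi * R * m) * x\<^sup>2 * (1 + tail_integral u x)"
      by (simp only: mult.assoc)
  qed
qed

text \<open>\<open>sqrt_tail_upper\<close> on \<open>{x..1 / 4}\<close>, fed back into
  \<open>crest_square_le_tail\<close>. The expression \<open>1 + ln (pi / x)\<close> is at least 1
  on all of \<open>(0, pi]\<close>, so it also covers \<open>x > 1 / 4\<close>, where boundedness of
  \<open>u\<close> is enough.\<close>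

lemma crest_upper:
  assumes "0 < c1"
  obtains C where "0 \<le> C"
    "\<And>c \<phi> x. crest c \<phi> \<Longrightarrow> c \<in> {c1..c2} \<Longrightarrow> 0 < x \<Longrightarrow> x \<le> pi \<Longrightarrow>
       crest.u c \<phi> x \<le> C * (x * (1 + ln (pi / x)))"
proof -
  obtain C where C: "0 \<le> C"
    "\<And>c \<phi> x. crest c \<phi> \<Longrightarrow> c \<in> {c1..c2} \<Longrightarrow> 0 < x \<Longrightarrow> x \<le> 1 / 4 \<Longrightarrow>
       (crest.u c \<phi> x)\<^sup>2 \<le> C * x\<^sup>2 * (1 + tail_integral (crest.u c \<phi>) x)"
    using crest_square_le_tail[OF assms, of c2] by blast
  define m where "m = \<bar>c2 + 2\<bar>"
  define q where "q = sqrt (1 + 4 * m)"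
  have m0: "0 \<le> m" by (simp add: m_def)
  have q0: "0 \<le> q" using m0 by (simp add: q_def)
  define A where "A = sqrt C * (q + sqrt C / 2) + 4 * m"
  show ?thesis
  proof (rule that[of A])
    show "0 \<le> A" using C m0 q0 by (simp add: A_def)
    fix c \<phi> and x :: real assume cr: "crest c \<phi>" and c: "c \<in> {c1..c2}" and x: "0 < x" "x \<le> pi"
    interpret crest c \<phi> by fact
    have um: "u z \<le> m" for z using u_le[of z] c by (auto simp: m_def)
    have l0: "0 \<le> ln (pi / x)" using x by (intro ln_ge_zero) auto
    have pos: "0 \<le> x * (1 + ln (pi / x))" using x l0 by simp
    show "u x \<le> A * (x * (1 + ln (pi / x)))"
    proof (cases "x \<le> 1 / 4")
      case True
      have "sqrt (1 + tail_integral u x) \<le> sqrt (1 + tail_integral u (1 / 4)) + sqrt C / 2 * ln (1 / 4 / x)"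
        using C(2)[OF cr c] True x pi_ge_two by (intro sqrt_tail_upper u_cont u_nonneg C(1)) auto
      also have "\<dots> \<le> q + sqrt C / 2 * ln (pi / x)"
      proof (intro add_mono mult_left_mono ln_mono)
        have "tail_integral u (1 / 4) \<le> m / (1 / 4)" using pi_ge_two by (intro tail_integral_le u_cont um m0) auto
        thus "sqrt (1 + tail_integral u (1 / 4)) \<le> q" by (simp add: q_def)
        show "1 / 4 / x \<le> pi / x" using x pi_ge_two by (intro divide_right_mono) auto
      qed (use x C in auto)
      also have "\<dots> \<le> (q + sqrt C / 2) * (1 + ln (pi / x))"
      proof -
        have "0 \<le> q * ln (pi / x)" "0 \<le> sqrt C / 2" using q0 C(1) l0 by auto
        thus ?thesis by (simp add: ring_distribs)
      qed
      finally have s: "sqrt (1 + tail_integral u x) \<le> (q + sqrt C / 2) * (1 + ln (pi / x))" .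
      have "u x \<le> sqrt (C * x\<^sup>2 * (1 + tail_integral u x))"
        using C(2)[OF cr c x(1) True] by (intro real_le_rsqrt)
      also have "\<dots> = sqrt C * x * sqrt (1 + tail_integral u x)" using x by (simp add: real_sqrt_mult)
      also have "\<dots> \<le> sqrt C * x * ((q + sqrt C / 2) * (1 + ln (pi / x)))"
        using s C x by (intro mult_left_mono) auto
      also have "\<dots> \<le> A * (x * (1 + ln (pi / x)))"
      proof -
        define p where "p = x * (1 + ln (pi / x))"
        have "0 \<le> 4 * m * p" using pos m0 by (simp add: p_def)
        moreover have "sqrt C * x * ((q + sqrt C / 2) * (1 + ln (pi / x))) = sqrt C * (q + sqrt C / 2) * p"
          by (simp add: p_def)
        ultimately show ?thesis unfolding p_def[symmetric] A_def distrib_right by linarith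
      qed
      finally show ?thesis .
    next
      case False
      have "u x \<le> m * 1" using um by simp
      also have "\<dots> \<le> m * (4 * (x * (1 + ln (pi / x))))"
      proof (rule mult_left_mono[OF _ m0])
        have "x * 1 \<le> x * (1 + ln (pi / x))" using x l0 by (intro mult_left_mono) auto
        thus "1 \<le> 4 * (x * (1 + ln (pi / x)))" using False by linarith
      qed
      also have "\<dots> \<le> A * (x * (1 + ln (pi / x)))"
      proof -
        define p where "p = x * (1 + ln (pi / x))"
        have "0 \<le> sqrt C * (q + sqrt C / 2) * p" using pos q0 C by (simp add: p_def)
        thus ?thesis unfolding p_def[symmetric] A_def distrib_right by linarith
      qed
      finally show ?thesis .
    qed
  qed
qed

text \<open>The counterpart of \<open>crest_square_le_tail\<close>, now with
  \<open>u z - u x\<close> under the integral. This is nonnegative for \<open>z > x\<close>, where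
  \<open>log_quotient_ge\<close> produces the tail, and at most \<open>u x\<close> in size for
  \<open>z < x\<close>, so the near region costs only a multiple of \<open>x * u x\<close>. Linear
  growth of \<open>u\<close> absorbs that and the remainder of order \<open>x\<^sup>2\<close> into
  \<open>(u x)\<^sup>2\<close>.\<close>

lemma crest_tail_le_square:
  assumes "crest c \<phi>" "0 < c" "\<not> \<phi> constant_on UNIV"
  obtains C where "0 < C"
    "\<And>x. 0 < x \<Longrightarrow> x \<le> 1 / 4 \<Longrightarrow> x\<^sup>2 * tail_integral (crest.u c \<phi>) x \<le> C * (crest.u c \<phi> x)\<^sup>2"
proof -
  interpret crest c \<phi> by fact
  obtain R where R: "0 \<le> R" "\<And>x y z. 0 \<le> x \<Longrightarrow> 0 \<le> y \<Longrightarrow> \<bar>smooth_diff x y z\<bar> \<le> R * ((x + y) * \<bar>x - y\<bar>)"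
    using smooth_diff_bound by blast
  obtain a where a: "0 < a" "\<And>x. 0 \<le> x \<Longrightarrow> x \<le> pi \<Longrightarrow> a * x \<le> u x"
    using crest_u_uniform_lower[OF assms(2), of c] assms by (metis atLeastAtMost_iff order_refl)
  define S where "S = R * (c + 2)"
  have S0: "0 \<le> S" using R c_nonneg by (simp add: S_def)
  \<comment> \<open>The summands account, in units of \<open>(u x)\<^sup>2\<close>, for
    \<open>crest_F c (u x)\<close>, for the terms in \<open>x * u x\<close> (16 from the near
    region, 1 from the constant \<open>u x\<close> subtracted in the tail) and for the smooth
    remainder.\<close>
  define C0 where "C0 = (4 * c + 3) + 17 / a + pi * S / a\<^sup>2"
  have C0: "0 < C0"
  proof -
    have "0 \<le> 17 / a" "0 \<le> pi * S / a\<^sup>2" using a(1) S0 by auto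
    thus ?thesis using c_nonneg unfolding C0_def by linarith
  qed
  show ?thesis
  proof (rule that[of "4 * pi * C0"])
    show "0 < 4 * pi * C0" using C0 by simp
    fix x :: real assume x: "0 < x" "x \<le> 1 / 4"
    have xpi: "x \<le> pi" "x < pi" using x pi_ge_two by linarith+
    define D where "D = (\<lambda>z. ((ln \<bar>cos z - cos 0\<bar> - ln \<bar>cos z - cos x\<bar>) / pi + smooth_diff 0 x z) * (u z - u x))"
    have D: "(D has_integral (crest_F c (u x))) {0..pi}"
      using F_u_diff_formula[of 0 x "u x"] x xpi by (simp add: D_def)
    have Di: "D integrable_on {a..b}" if "{a..b} \<subseteq> {0..pi}" for a b
      using integrable_subinterval_real[OF has_integral_integrable[OF D] that] .
    have sd: "- (S * x\<^sup>2) \<le> smooth_diff 0 x z * (u z - u x)" for z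
    proof -
      have "\<bar>smooth_diff 0 x z * (u z - u x)\<bar> \<le> (R * x\<^sup>2) * (c + 2)"
        unfolding abs_mult using R(2)[of 0 x z] x u_nonneg[of z] u_nonneg[of x] u_le[of z] u_le[of x] R(1)
        by (intro mult_mono) (auto simp: power2_eq_square)
      thus ?thesis by (simp add: S_def mult_ac abs_le_iff)
    qed
    define g1 where "g1 = (\<lambda>z. (- (8 * sqrt x * u x / pi)) * \<bar>x - z\<bar> powr - (1 / 2) + (- (S * x\<^sup>2)))"
    define g2 where "g2 = (\<lambda>z. (x\<^sup>2 / (4 * pi)) * (u z / z\<^sup>2 - u x * (1 / z\<^sup>2)) + (- (S * x\<^sup>2)))"
    have pw: "(\<lambda>z. \<bar>x - z\<bar> powr - (1 / 2)) integrable_on {0..x}"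
      "integral {0..x} (\<lambda>z. \<bar>x - z\<bar> powr - (1 / 2)) \<le> 4 * sqrt x"
      using abs_powr_integrable_bound[of "1/2" x 0 x] x by (auto simp: powr_half_sqrt)
    have g1: "(g1 has_integral ((- (8 * sqrt x * u x / pi)) * integral {0..x} (\<lambda>z. \<bar>x - z\<bar> powr - (1 / 2)) + x * (- (S * x\<^sup>2)))) {0..x}"
      unfolding g1_def using has_integral_const_real[of "- (S * x\<^sup>2)" 0 x] x
      by (intro has_integral_add has_integral_mult_right integrable_integral pw) auto
    have "(8 * sqrt x * u x / pi) * integral {0..x} (\<lambda>z. \<bar>x - z\<bar> powr - (1 / 2)) \<le> (8 * sqrt x * u x / 2) * (4 * sqrt x)"
      using x pw u_nonneg pi_ge_two
      by (intro mult_mono divide_left_mono Henstock_Kurzweil_Integration.integral_nonneg) auto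
    also have "\<dots> = 16 * x * u x" using x by simp
    finally have "- (16 * x * u x) - x * (S * x\<^sup>2) \<le> integral {0..x} g1"
      using integral_unique[OF g1] by simp
    also have "\<dots> \<le> integral {0..x} D"
    proof (rule integral_le_spike[where N = "{0, x}"])
      show "g1 integrable_on {0..x}" using g1 by blast
      fix z assume z: "z \<in> {0..x} - {0, x}"
      define l where "l = (ln \<bar>cos z - 1\<bar> - ln \<bar>cos z - cos x\<bar>) / pi"
      define b where "b = (8 * sqrt x * \<bar>x - z\<bar> powr - (1 / 2)) / pi"
      have lb: "l \<le> b" unfolding l_def b_def
        using z x by (intro divide_right_mono log_quotient_near) auto
      have b0: "0 \<le> b" using x by (simp add: b_def)
      \<comment> \<open>Only an upper bound on \<open>l\<close> is known; multiplied by the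
        nonnegative \<open>u x - u z\<close> it bounds \<open>l * (u z - u x)\<close> from
        below.\<close>
      have uz: "u z \<le> u x" using z xpi by (intro u_mono) auto
      have "b * (u x - u z) \<le> b * u x" using b0 u_nonneg[of z] by (intro mult_left_mono) auto
      moreover have "l * (u x - u z) \<le> b * (u x - u z)" using lb uz by (intro mult_right_mono) auto
      ultimately have "- (b * u x) \<le> l * (u z - u x)" by (simp add: algebra_simps)
      moreover have "b * u x = (8 * sqrt x * u x / pi) * \<bar>x - z\<bar> powr - (1 / 2)" by (simp add: b_def)
      ultimately show "g1 z \<le> D z"
        using sd[of z] unfolding g1_def D_def distrib_right cos_zero l_def[symmetric] by linarith
    qed (use Di[of 0 x] xpi in auto)
    finally have I1: "- (16 * x * u x) - x * (S * x\<^sup>2) \<le> integral {0..x} D" .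
    have i2: "(\<lambda>z. u z / z\<^sup>2) integrable_on {x..pi}" using x by (intro tail_integrand_integrable u_cont) auto
    have g2: "(g2 has_integral ((x\<^sup>2 / (4 * pi)) * (tail_integral u x - u x * (1 / x - 1 / pi)) + (pi - x) * (- (S * x\<^sup>2)))) {x..pi}"
      unfolding g2_def tail_integral_def
      using has_integral_const_real[of "- (S * x\<^sup>2)" x pi] xpi x
      by (intro has_integral_add has_integral_diff has_integral_mult_right integrable_integral i2 has_integral_inverse_square) auto
    have "integral {x..pi} g2 \<le> integral {x..pi} D"
    proof (rule integral_le_spike[where N = "{x}"])
      show "g2 integrable_on {x..pi}" using g2 by blast
      fix z assume z: "z \<in> {x..pi} - {x}"
      define l where "l = (ln \<bar>cos z - 1\<bar> - ln \<bar>cos z - cos x\<bar>) / pi"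
      have "(x\<^sup>2 / (4 * z\<^sup>2)) / pi \<le> l" unfolding l_def
        using z x by (intro divide_right_mono log_quotient_ge) auto
      moreover have "0 \<le> u z - u x" using z x u_mono[of x z] by auto
      ultimately have "(x\<^sup>2 / (4 * z\<^sup>2)) / pi * (u z - u x) \<le> l * (u z - u x)" by (intro mult_right_mono)
      moreover have "(x\<^sup>2 / (4 * z\<^sup>2)) / pi * (u z - u x) = (x\<^sup>2 / (4 * pi)) * (u z / z\<^sup>2 - u x * (1 / z\<^sup>2))"
        by (simp add: diff_divide_distrib right_diff_distrib mult_ac)
      ultimately show "g2 z \<le> D z"
        using sd[of z] unfolding g2_def D_def distrib_right cos_zero l_def[symmetric] by linarith
    qed (use Di[of x pi] x in auto)
    hence I2: "(x\<^sup>2 / (4 * pi)) * (tail_integral u x - u x * (1 / x - 1 / pi)) + (pi - x) * (- (S * x\<^sup>2)) \<le> integral {x..pi} D"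
      using integral_unique[OF g2] by simp
    have comb: "integral {0..x} D + integral {x..pi} D = crest_F c (u x)"
      using Henstock_Kurzweil_Integration.integral_combine[of 0 x pi D] D x xpi by (auto simp: integral_unique)
    define T where "T = tail_integral u x"
    have "(x\<^sup>2 / (4 * pi)) * (u x * (1 / x - 1 / pi)) \<le> x * u x"
    proof -
      have "u x * (1 / x - 1 / pi) \<le> u x * (1 / x)" by (intro mult_left_mono u_nonneg) simp
      hence "(x\<^sup>2 / (4 * pi)) * (u x * (1 / x - 1 / pi)) \<le> (x\<^sup>2 / (4 * pi)) * (u x * (1 / x))"
        by (intro mult_left_mono) (auto simp: u_nonneg)
      also have "\<dots> = x * u x / (4 * pi)" using x by (simp add: power2_eq_square)
      also have "\<dots> \<le> x * u x / 1" using x u_nonneg[of x] pi_ge_two by (intro divide_left_mono) auto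
      finally show ?thesis by simp
    qed
    moreover have "(x\<^sup>2 / (4 * pi)) * (T - u x * (1 / x - 1 / pi)) = x\<^sup>2 / (4 * pi) * T - (x\<^sup>2 / (4 * pi)) * (u x * (1 / x - 1 / pi))"
      by (rule right_diff_distrib)
    moreover have "x * (S * x\<^sup>2) + (pi - x) * (S * x\<^sup>2) = pi * S * x\<^sup>2" by (simp add: algebra_simps)
    ultimately have "x\<^sup>2 / (4 * pi) * T \<le> crest_F c (u x) + 17 * (x * u x) + pi * S * x\<^sup>2"
      using I1 I2[folded T_def] comb unfolding mult_minus_right by linarith
    also have "crest_F c (u x) \<le> (4 * c + 3) * (u x)\<^sup>2"
      using crest_F_diff_le[OF c_nonneg, of 0 "u x"] u_nonneg u_le by (simp add: power2_eq_square)
    also have "x * u x \<le> (u x)\<^sup>2 / a"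
      using mult_right_mono[OF a(2)[of x] u_nonneg[of x]] x xpi a(1) by (simp add: power2_eq_square field_simps)
    also have "pi * S * x\<^sup>2 \<le> pi * S * ((u x)\<^sup>2 / a\<^sup>2)"
    proof (intro mult_left_mono)
      have "(a * x)\<^sup>2 \<le> (u x)\<^sup>2" using a x xpi by (intro power_mono) auto
      thus "x\<^sup>2 \<le> (u x)\<^sup>2 / a\<^sup>2" using a(1) by (simp add: power_mult_distrib field_simps)
    qed (use S0 in auto)
    finally have "x\<^sup>2 / (4 * pi) * T \<le> (4 * c + 3) * (u x)\<^sup>2 + 17 * ((u x)\<^sup>2 / a) + pi * S * ((u x)\<^sup>2 / a\<^sup>2)"
      by simp
    also have "\<dots> = C0 * (u x)\<^sup>2" by (simp add: C0_def algebra_simps)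
    finally have "4 * pi * (x\<^sup>2 / (4 * pi) * T) \<le> 4 * pi * (C0 * (u x)\<^sup>2)" by (intro mult_left_mono) auto
    thus "x\<^sup>2 * tail_integral u x \<le> 4 * pi * C0 * (u x)\<^sup>2" by (simp add: T_def)
  qed
qed

lemma crest_log_estimate:
  assumes "crest c \<phi>" "0 < c" "\<not> \<phi> constant_on UNIV"
  shows "\<exists>C\<ge>1. \<exists>\<delta>>0. \<forall>x. 0 < \<bar>x\<bar> \<and> \<bar>x\<bar> < \<delta> \<longrightarrow>
     \<bar>x * ln \<bar>x\<bar>\<bar> / C \<le> gamma_crit c - \<phi> x \<and> gamma_crit c - \<phi> x \<le> C * \<bar>x * ln \<bar>x\<bar>\<bar>"
proof -
  interpret crest c \<phi> by fact
  obtain A where A: "0 \<le> A" "\<And>x. 0 < x \<Longrightarrow> x \<le> pi \<Longrightarrow> u x \<le> A * (x * (1 + ln (pi / x)))"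
    using crest_upper[OF assms(2), of c] assms by (metis atLeastAtMost_iff order_refl)
  obtain B where B: "0 < B" "\<And>x. 0 < x \<Longrightarrow> x \<le> 1 / 4 \<Longrightarrow> x\<^sup>2 * tail_integral u x \<le> B * (u x)\<^sup>2"
    using crest_tail_le_square[OF assms] by blast
  \<comment> \<open>\<open>5 * A\<close> serves the upper bound, by
    \<open>1 + ln (pi / x) \<le> 5 * |ln x|\<close>, and \<open>4 * B\<close> the lower one.\<close>
  define C where "C = 1 + 5 * A + 4 * B"
  \<comment> \<open>Below \<open>1 / 16\<close> both \<open>|ln x| \<ge> 1\<close> and
    \<open>ln (1 / 4 / x) \<ge> |ln x| / 2\<close> hold.\<close>
  have main: "x * \<bar>ln x\<bar> / C \<le> u x \<and> u x \<le> C * (x * \<bar>ln x\<bar>)" if x: "0 < x" "x < 1 / 16" for x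
  proof
    have xpi: "x \<le> pi" using x pi_ge_two by linarith
    have lx: "\<bar>ln x\<bar> = - ln x" using x ln_le_zero_iff[of x] by simp
    have "exp 1 \<le> (16 :: real)" using e_less_272 by simp
    also have "16 \<le> 1 / x" using x by (simp add: field_simps)
    finally have "ln (exp 1) \<le> ln (1 / x)" using x by (intro ln_mono) auto
    hence l1: "1 \<le> \<bar>ln x\<bar>" using x by (simp add: ln_div lx)
    have "u x \<le> A * (x * (1 + ln (pi / x)))" using A(2) x xpi by simp
    also have "1 + ln (pi / x) \<le> 5 * \<bar>ln x\<bar>"
    proof -
      have "ln pi \<le> 3" using ln_le_minus_one[of pi] pi_less_4 by simp
      thus ?thesis using x l1 lx by (simp add: ln_div)
    qed
    hence "A * (x * (1 + ln (pi / x))) \<le> A * (x * (5 * \<bar>ln x\<bar>))"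
      using A x by (intro mult_left_mono) auto
    also have "\<dots> = (5 * A) * (x * \<bar>ln x\<bar>)" by simp
    also have "\<dots> \<le> C * (x * \<bar>ln x\<bar>)" using A(1) B(1) x(1) by (intro mult_right_mono mult_nonneg_nonneg) (auto simp: C_def)
    finally show "u x \<le> C * (x * \<bar>ln x\<bar>)" .
    have tp: "0 < tail_integral u y" if y: "0 < y" "y \<le> 1 / 4" for y
    proof -
      have yp: "y < pi" using y pi_ge_two by linarith
      have "0 < u y * (1 / y - 1 / pi)"
        using u_strict_mono[OF assms(3), of 0 y] y yp by (intro mult_pos_pos) (auto simp: field_simps)
      also have "\<dots> \<le> tail_integral u y" using y yp by (intro tail_integral_ge u_cont u_mono) auto
      finally show ?thesis .
    qed
    have "ln (1 / 4 / x) / (2 * sqrt B) \<le> sqrt (tail_integral u x)"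
      using x pi_ge_two by (intro sqrt_tail_lower u_cont u_nonneg tp B) auto
    moreover have "\<bar>ln x\<bar> / 2 \<le> ln (1 / 4 / x)"
    proof -
      have "ln (x * 16) \<le> ln 1" using x by (intro ln_mono) auto
      hence "ln x + ln 16 \<le> 0" using x by (simp add: ln_mult)
      moreover have "ln (16::real) = 2 * ln 4" using ln_realpow[of "4::real" 2] by simp
      ultimately show ?thesis using x lx by (simp add: ln_div ln_mult)
    qed
    ultimately have "\<bar>ln x\<bar> / 2 / (2 * sqrt B) \<le> sqrt (tail_integral u x)"
      using B(1) by (meson divide_right_mono order_trans less_imp_le mult_nonneg_nonneg real_sqrt_ge_zero zero_le_numeral)
    hence "x * (\<bar>ln x\<bar> / 2 / (2 * sqrt B)) \<le> x * sqrt (tail_integral u x)" using x by (intro mult_left_mono) auto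
    also have "\<dots> = sqrt (x\<^sup>2 * tail_integral u x)" using x by (simp add: real_sqrt_mult)
    also have "\<dots> \<le> sqrt (B * (u x)\<^sup>2)" using B(2)[of x] x by simp
    also have "\<dots> = sqrt B * u x" using u_nonneg[of x] by (simp add: real_sqrt_mult)
    finally have "x * (\<bar>ln x\<bar> / 2 / (2 * sqrt B)) \<le> sqrt B * u x" .
    hence "4 * sqrt B * (x * (\<bar>ln x\<bar> / 2 / (2 * sqrt B))) \<le> 4 * sqrt B * (sqrt B * u x)"
      using B(1) by (intro mult_left_mono) auto
    moreover have "4 * sqrt B * (sqrt B * u x) = (4 * (sqrt B * sqrt B)) * u x" by (simp only: mult_ac)
    moreover have "sqrt B * sqrt B = B" using B(1) by simp
    moreover have "4 * sqrt B * (x * (\<bar>ln x\<bar> / 2 / (2 * sqrt B))) = x * \<bar>ln x\<bar>" using B(1) by simp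
    ultimately have "x * \<bar>ln x\<bar> \<le> (4 * B) * u x" by simp
    also have "\<dots> \<le> C * u x" using A B u_nonneg by (intro mult_right_mono) (auto simp: C_def)
    finally show "x * \<bar>ln x\<bar> / C \<le> u x" using A B by (simp add: C_def field_simps)
  qed
  have "\<forall>x. 0 < \<bar>x\<bar> \<and> \<bar>x\<bar> < 1 / 16 \<longrightarrow>
     \<bar>x * ln \<bar>x\<bar>\<bar> / C \<le> gamma_crit c - \<phi> x \<and> gamma_crit c - \<phi> x \<le> C * \<bar>x * ln \<bar>x\<bar>\<bar>"
  proof (intro allI impI)
    fix x :: real assume x: "0 < \<bar>x\<bar> \<and> \<bar>x\<bar> < 1 / 16"
    have "u \<bar>x\<bar> = gamma_crit c - \<phi> x" using u_even[of x] by (cases "x \<ge> 0") (auto simp: u_def)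
    thus "\<bar>x * ln \<bar>x\<bar>\<bar> / C \<le> gamma_crit c - \<phi> x \<and> gamma_crit c - \<phi> x \<le> C * \<bar>x * ln \<bar>x\<bar>\<bar>"
      using main[of "\<bar>x\<bar>"] x by (simp add: abs_mult)
  qed
  moreover have "C \<ge> 1" using A B by (simp add: C_def)
  ultimately show ?thesis by (metis zero_less_divide_1_iff zero_less_numeral)
qed

text \<open>The logarithm is absorbed by \<open>(pi / x) powr (1 - \<beta>)\<close>; a pure power is
  the form that cancels a singular weight below.\<close>

lemma crest_upper_powr:
  assumes "0 < c1" "0 < \<beta>" "\<beta> < 1"
  obtains C where "0 \<le> C"
    "\<And>c \<phi> x. crest c \<phi> \<Longrightarrow> c \<in> {c1..c2} \<Longrightarrow> 0 < x \<Longrightarrow> x \<le> pi \<Longrightarrow> crest.u c \<phi> x \<le> C * x powr \<beta>"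
proof -
  obtain A where A: "0 \<le> A"
    "\<And>c \<phi> x. crest c \<phi> \<Longrightarrow> c \<in> {c1..c2} \<Longrightarrow> 0 < x \<Longrightarrow> x \<le> pi \<Longrightarrow> crest.u c \<phi> x \<le> A * (x * (1 + ln (pi / x)))"
    using crest_upper[OF assms(1), of c2] by blast
  define E where "E = pi powr (1 - \<beta>)"
  show ?thesis
  proof (rule that[of "A * ((1 + 1 / (1 - \<beta>)) * E)"])
    show "0 \<le> A * ((1 + 1 / (1 - \<beta>)) * E)" using A assms by (simp add: E_def)
    fix c \<phi> and x :: real assume "crest c \<phi>" "c \<in> {c1..c2}" and x: "0 < x" "x \<le> pi"
    hence "crest.u c \<phi> x \<le> A * (x * (1 + ln (pi / x)))" by (rule A(2))
    also have "\<dots> \<le> A * (x * ((1 + 1 / (1 - \<beta>)) * (pi / x) powr (1 - \<beta>)))"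
    proof (intro mult_left_mono)
      have "(1 - \<beta>) * ln (pi / x) = ln ((pi / x) powr (1 - \<beta>))" using x by (simp add: ln_powr)
      also have "\<dots> \<le> (pi / x) powr (1 - \<beta>)" using x by (intro order.trans[OF ln_le_minus_one]) auto
      finally have "ln (pi / x) \<le> 1 / (1 - \<beta>) * (pi / x) powr (1 - \<beta>)" using assms by (simp add: field_simps)
      moreover have "1 \<le> (pi / x) powr (1 - \<beta>)" using x assms by (intro ge_one_powr_ge_zero) auto
      ultimately show "1 + ln (pi / x) \<le> (1 + 1 / (1 - \<beta>)) * (pi / x) powr (1 - \<beta>)"
        unfolding distrib_right by simp
    qed (use A x in auto)
    also have "x * ((1 + 1 / (1 - \<beta>)) * (pi / x) powr (1 - \<beta>)) = (1 + 1 / (1 - \<beta>)) * (E * x powr \<beta>)"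
    proof -
      have "x * (pi / x) powr (1 - \<beta>) = E * (x powr 1 / x powr (1 - \<beta>))"
        using x by (simp add: powr_divide E_def)
      also have "x powr 1 / x powr (1 - \<beta>) = x powr \<beta>"
        using powr_diff[of x 1 "1 - \<beta>"] by simp
      finally have "x * (pi / x) powr (1 - \<beta>) = E * x powr \<beta>" .
      thus ?thesis by (metis mult.left_commute)
    qed
    finally show "crest.u c \<phi> x \<le> A * ((1 + 1 / (1 - \<beta>)) * E) * x powr \<beta>" by (simp add: mult_ac)
  qed
qed

section \<open>Hoelder estimates up to the crest\<close>

text \<open>In contrast to \<open>abs_cos_diff_ge\<close>, \<open>z\<close> ranges up to
  \<open>pi\<close>: with \<open>x \<le> 1\<close> the half sum stays below
  \<open>(1 + pi) / 2\<close>, away from the second zero of the sine.\<close>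

lemma abs_cos_diff_ge':
  assumes "0 \<le> x" "x \<le> 1" "0 \<le> z" "z \<le> pi"
  shows "z * \<bar>x - z\<bar> / 64 \<le> \<bar>cos z - cos x\<bar>"
proof -
  define w where "w = (x + z) / 2"
  have w: "0 \<le> w" "w \<le> (1 + pi) / 2" "w \<le> 4" using assms pi_less_4 by (auto simp: w_def)
  have "w / 16 \<le> sin w"
  proof (cases "w \<le> pi / 2")
    case True
    have "1 / 16 * w \<le> 2 / pi * w" using w(1) pi_less_4 by (intro mult_right_mono) (auto simp: field_simps)
    hence "w / 16 \<le> 2 / pi * w" by simp
    thus ?thesis using sin_ge_two_div_pi[of w] True w by simp
  next
    case False
    have "w / 16 \<le> 2 / 4 * (pi - w)" using w pi_ge_two by simp
    also have "\<dots> \<le> 2 / pi * (pi - w)" using w pi_ge_two pi_less_4 by (intro mult_right_mono divide_left_mono) auto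
    also have "\<dots> \<le> sin (pi - w)" using False w pi_ge_two by (intro sin_ge_two_div_pi) auto
    finally show ?thesis by simp
  qed
  moreover have "z / 32 \<le> w / 16" using assms by (simp add: w_def)
  ultimately have 1: "z / 32 \<le> \<bar>sin ((z + x) / 2)\<bar>" by (simp add: w_def add.commute)
  have 2: "\<bar>x - z\<bar> / 2 \<le> \<bar>2 * sin ((x - z) / 2)\<bar>" using assms pi_ge_two by (intro abs_two_sin_half_ge) auto
  have "z / 32 * (\<bar>x - z\<bar> / 2) \<le> \<bar>sin ((z + x) / 2)\<bar> * \<bar>2 * sin ((x - z) / 2)\<bar>"
    using 1 2 assms by (intro mult_mono) auto
  also have "\<dots> = \<bar>cos z - cos x\<bar>" by (simp add: cos_diff_cos abs_mult)
  finally show ?thesis by simp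
qed

text \<open>The gain over \<open>crest_F_diff_hoelder\<close> is the factor \<open>y\<close> in the
  bound, since the cosine difference is at most \<open>(y - x) * y\<close>. Its price is a weight
  \<open>z powr - \<beta>\<close> from the lower bounds on \<open>|cos z - cos x|\<close> and
  \<open>|cos z - cos y|\<close>, which the known bound \<open>u z \<le> A * z powr \<beta>\<close>
  cancels exactly.\<close>

lemma crest_F_diff_near:
  assumes "0 < c1" "0 < \<beta>" "\<beta> < 1"
  obtains C where "0 \<le> C"
    "\<And>c \<phi> x y. crest c \<phi> \<Longrightarrow> c \<in> {c1..c2} \<Longrightarrow> 0 \<le> x \<Longrightarrow> x < y \<Longrightarrow> y \<le> 1 \<Longrightarrow>
       crest_F c (crest.u c \<phi> y) - crest_F c (crest.u c \<phi> x) \<le> C * ((y - x) * y) powr \<beta>"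
proof -
  obtain A where A: "0 \<le> A"
    "\<And>c \<phi> x. crest c \<phi> \<Longrightarrow> c \<in> {c1..c2} \<Longrightarrow> 0 < x \<Longrightarrow> x \<le> pi \<Longrightarrow> crest.u c \<phi> x \<le> A * x powr \<beta>"
    using crest_upper_powr[OF assms, of c2] by blast
  obtain R where R: "0 \<le> R" "\<And>x y z. 0 \<le> x \<Longrightarrow> 0 \<le> y \<Longrightarrow> \<bar>smooth_diff x y z\<bar> \<le> R * ((x + y) * \<bar>x - y\<bar>)"
    using smooth_diff_bound by blast
  define m where "m = \<bar>c2 + 2\<bar>"
  define I where "I = 2 * pi powr (1 - \<beta>) / (1 - \<beta>)"
  define P where "P = 2 / \<beta> * 64 powr \<beta> * A / pi"
  have P0: "0 \<le> P" using A assms by (simp add: P_def)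
  show ?thesis
  proof (rule that[of "P * (I + I) + pi * (2 * R * m)"])
    show "0 \<le> P * (I + I) + pi * (2 * R * m)" using P0 assms R by (simp add: I_def m_def)
    fix c \<phi> and x y :: real assume cr: "crest c \<phi>" and c: "c \<in> {c1..c2}" and xy: "0 \<le> x" "x < y" "y \<le> 1"
    interpret crest c \<phi> by fact
    have um: "u z \<le> m" for z using u_le[of z] c by (auto simp: m_def)
    have pi: "y \<le> pi" "x \<le> pi" using xy pi_ge_two by linarith+
    define q where "q = ((y - x) * y) powr \<beta>"
    have q0: "0 \<le> q" by (simp add: q_def)
    define D where "D = (\<lambda>z. ((ln \<bar>cos z - cos x\<bar> - ln \<bar>cos z - cos y\<bar>) / pi + smooth_diff x y z) * (u z - 0))"
    have D: "(D has_integral (crest_F c (u y) - crest_F c (u x))) {0..pi}"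
      unfolding D_def by (rule F_u_diff_formula) (use xy pi in auto)
    define g where "g = (\<lambda>z. (P * q) * (\<bar>x - z\<bar> powr - \<beta> + \<bar>y - z\<bar> powr - \<beta>) + 2 * R * m * q)"
    note pw = abs_powr_integrable_bound[of \<beta> x 0 pi] abs_powr_integrable_bound[of \<beta> y 0 pi]
    have gi: "(g has_integral ((P * q) * (integral {0..pi} (\<lambda>z. \<bar>x - z\<bar> powr - \<beta>) + integral {0..pi} (\<lambda>z. \<bar>y - z\<bar> powr - \<beta>)) + pi * (2 * R * m * q))) {0..pi}"
      unfolding g_def using has_integral_const_real[of "2 * R * m * q" 0 pi] pw xy pi assms
      by (intro has_integral_add has_integral_mult_right integrable_integral) auto
    \<comment> \<open>\<open>(y - x) * y \<le> 1\<close> makes \<open>q\<close> at least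
      \<open>(y - x) * y\<close>, so the smooth part is dominated by \<open>q\<close> as
      well.\<close>
    have yx: "(y - x) * y \<le> 1" using mult_mono[of "y - x" 1 y 1] xy by simp
    have sq: "(y - x) * y \<le> q"
    proof -
      have "((y - x) * y) powr 1 \<le> ((y - x) * y) powr \<beta>" using xy yx assms by (intro powr_mono') auto
      thus ?thesis using xy by (simp add: q_def)
    qed
    have sd: "smooth_diff x y z * u z \<le> 2 * R * m * q" for z
    proof -
      have "smooth_diff x y z * u z \<le> \<bar>smooth_diff x y z\<bar> * u z" using u_nonneg by (intro mult_right_mono) auto
      also have "\<dots> \<le> (R * (2 * q)) * m"
      proof (rule mult_mono)
        have "(x + y) * \<bar>x - y\<bar> \<le> (2 * y) * (y - x)" using xy by (intro mult_mono) auto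
        also have "\<dots> = 2 * ((y - x) * y)" by simp
        also have "\<dots> \<le> 2 * q" using sq by linarith
        finally have "R * ((x + y) * \<bar>x - y\<bar>) \<le> R * (2 * q)" using R by (intro mult_left_mono) auto
        thus "\<bar>smooth_diff x y z\<bar> \<le> R * (2 * q)" using R(2)[of x y z] xy by simp
      qed (use um u_nonneg R q0 in auto)
      finally show ?thesis by (simp add: mult_ac)
    qed
    have "crest_F c (u y) - crest_F c (u x) = integral {0..pi} D" using integral_unique[OF D] by simp
    also have "\<dots> \<le> integral {0..pi} g"
    proof (rule integral_le_spike[where N = "{0, x, y}"])
      show "D integrable_on {0..pi}" using D by blast
      show "g integrable_on {0..pi}" using gi by blast
      fix z assume z: "z \<in> {0..pi} - {0, x, y}"
      have cz: "z * \<bar>x - z\<bar> / 64 \<le> \<bar>cos z - cos x\<bar>" "z * \<bar>y - z\<bar> / 64 \<le> \<bar>cos z - cos y\<bar>"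
        using z xy by (auto intro!: abs_cos_diff_ge' simp del: divide_le_eq_numeral1)
      have pos: "0 < z * \<bar>x - z\<bar> / 64" "0 < z * \<bar>y - z\<bar> / 64" using z by auto
      have pb: "v powr - \<beta> \<le> 64 powr \<beta> * z powr - \<beta> * w powr - \<beta>" if "z * w / 64 \<le> v" "0 < z * w / 64" "0 \<le> w" for v w
      proof -
        have "v powr - \<beta> \<le> (z * w / 64) powr - \<beta>" using that assms by (intro powr_mono2') auto
        also have "\<dots> = 64 powr \<beta> * z powr - \<beta> * w powr - \<beta>"
          using that z by (simp add: powr_divide powr_mult powr_minus field_simps)
        finally show ?thesis .
      qed
      have "ln \<bar>cos z - cos x\<bar> - ln \<bar>cos z - cos y\<bar> \<le> \<bar>ln \<bar>cos z - cos x\<bar> - ln \<bar>cos z - cos y\<bar>\<bar>" by simp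
      also have "\<dots> \<le> 2 / \<beta> * \<bar>\<bar>cos z - cos x\<bar> - \<bar>cos z - cos y\<bar>\<bar> powr \<beta> *
          (\<bar>cos z - cos x\<bar> powr - \<beta> + \<bar>cos z - cos y\<bar> powr - \<beta>)"
        using cz pos assms by (intro ln_diff_powr_le) auto
      also have "\<dots> \<le> 2 / \<beta> * q * (64 powr \<beta> * z powr - \<beta> * \<bar>x - z\<bar> powr - \<beta> + 64 powr \<beta> * z powr - \<beta> * \<bar>y - z\<bar> powr - \<beta>)"
      proof (intro mult_mono mult_left_mono add_mono pb cz pos)
        have "\<bar>\<bar>cos z - cos x\<bar> - \<bar>cos z - cos y\<bar>\<bar> \<le> \<bar>cos x - cos y\<bar>" by linarith
        also have "\<dots> \<le> \<bar>x - y\<bar> * \<bar>x + y\<bar> / 2" by (rule cos_diff_le)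
        also have "\<dots> \<le> (y - x) * (2 * y) / 2" using xy by (intro divide_right_mono mult_mono) auto
        finally show "\<bar>\<bar>cos z - cos x\<bar> - \<bar>cos z - cos y\<bar>\<bar> powr \<beta> \<le> q"
          unfolding q_def using assms by (intro powr_mono2) auto
      qed (use assms q0 in auto)
      finally have l: "ln \<bar>cos z - cos x\<bar> - ln \<bar>cos z - cos y\<bar> \<le>
        2 / \<beta> * q * (64 powr \<beta> * z powr - \<beta> * \<bar>x - z\<bar> powr - \<beta> + 64 powr \<beta> * z powr - \<beta> * \<bar>y - z\<bar> powr - \<beta>)" .
      define X where "X = \<bar>x - z\<bar> powr - \<beta> + \<bar>y - z\<bar> powr - \<beta>"
      have X0: "0 \<le> X" by (simp add: X_def)
      have "(ln \<bar>cos z - cos x\<bar> - ln \<bar>cos z - cos y\<bar>) / pi * u z \<le>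
         (2 / \<beta> * q * (64 powr \<beta> * z powr - \<beta> * X)) / pi * u z"
        using l u_nonneg by (intro mult_right_mono divide_right_mono) (auto simp: X_def algebra_simps)
      also have "\<dots> \<le> (2 / \<beta> * q * (64 powr \<beta> * z powr - \<beta> * X)) / pi * (A * z powr \<beta>)"
        using A(2)[OF cr c, of z] z assms q0 X0 by (intro mult_left_mono) auto
      also have "\<dots> = P * q * X * (z powr - \<beta> * z powr \<beta>)" by (simp add: P_def)
      also have "z powr - \<beta> * z powr \<beta> = 1" using z by (simp flip: powr_add)
      finally have "(ln \<bar>cos z - cos x\<bar> - ln \<bar>cos z - cos y\<bar>) / pi * u z \<le> P * q * X" by simp
      thus "D z \<le> g z" using sd[of z] unfolding D_def g_def distrib_right X_def by simp
    qed auto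
    also have "\<dots> \<le> (P * q) * (I + I) + pi * (2 * R * m * q)"
      unfolding integral_unique[OF gi] I_def
      using pw xy pi assms P0 q0 by (intro add_right_mono mult_left_mono add_mono) auto
    finally show "crest_F c (u y) - crest_F c (u x) \<le> (P * (I + I) + pi * (2 * R * m)) * ((y - x) * y) powr \<beta>"
      unfolding q_def[symmetric] by (simp add: algebra_simps)
  qed
qed

text \<open>Since \<open>u y \<ge> a y\<close> and \<open>y \<ge> y - x\<close>, the bound \<open>C ((y - x) y)\<^sup>\<beta>\<close> on the difference of \<open>F (u)\<close> costs
  only the exponent loss from \<open>\<beta>\<close> to \<open>2 \<beta> - 1\<close>.\<close>

lemma crest_u_hoelder:
  assumes "0 < c1" "0 < \<alpha>" "\<alpha> < 1"
  obtains C where "0 \<le> C"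
    "\<And>c \<phi> x y. crest c \<phi> \<Longrightarrow> c \<in> {c1..c2} \<Longrightarrow> \<not> \<phi> constant_on UNIV \<Longrightarrow> 0 \<le> x \<Longrightarrow> x < y \<Longrightarrow> y \<le> pi \<Longrightarrow>
       crest.u c \<phi> y - crest.u c \<phi> x \<le> C * (y - x) powr \<alpha>"
proof -
  define \<beta> where "\<beta> = (1 + \<alpha>) / 2"
  have \<beta>: "0 < \<beta>" "\<beta> < 1" "2 * \<beta> - 1 = \<alpha>" using assms by (auto simp: \<beta>_def field_simps)
  obtain C1 where C1: "0 \<le> C1"
    "\<And>c \<phi> x y. crest c \<phi> \<Longrightarrow> c \<in> {c1..c2} \<Longrightarrow> 0 \<le> x \<Longrightarrow> x < y \<Longrightarrow> y \<le> 1 \<Longrightarrow>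
       crest_F c (crest.u c \<phi> y) - crest_F c (crest.u c \<phi> x) \<le> C1 * ((y - x) * y) powr \<beta>"
    using crest_F_diff_near[OF assms(1) \<beta>(1,2), of c2] by blast
  obtain C2 where C2: "0 \<le> C2"
    "\<And>c \<phi> x y. crest c \<phi> \<Longrightarrow> c \<in> {c1..c2} \<Longrightarrow> 0 \<le> x \<Longrightarrow> x \<le> y \<Longrightarrow> y \<le> pi \<Longrightarrow>
       (crest.u c \<phi> y - crest.u c \<phi> x) * crest.u c \<phi> y \<le> C2 * (y - x) powr \<alpha>"
    using crest_F_diff_hoelder[OF assms(2,3,1), of c2] by blast
  obtain a where a: "0 < a"
    "\<And>c \<phi> x. crest c \<phi> \<Longrightarrow> c \<in> {c1..c2} \<Longrightarrow> \<not> \<phi> constant_on UNIV \<Longrightarrow> 0 \<le> x \<Longrightarrow> x \<le> pi \<Longrightarrow> a * x \<le> crest.u c \<phi> x"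
    using crest_u_uniform_lower[OF assms(1), of c2] by blast
  show ?thesis
  proof (rule that[of "2 / c1 * C1 / a + C2 / a"])
    show "0 \<le> 2 / c1 * C1 / a + C2 / a" using assms C1 C2 a by simp
    fix c \<phi> and x y :: real
    assume cr: "crest c \<phi>" and c: "c \<in> {c1..c2}" and nc: "\<not> \<phi> constant_on UNIV" and xy: "0 \<le> x" "x < y" "y \<le> pi"
    interpret crest c \<phi> by fact
    define d where "d = u y - u x"
    have d0: "0 \<le> d" using u_mono[of x y] xy by (simp add: d_def)
    have ay: "a * y \<le> u y" using a(2)[OF cr c nc] xy by simp
    have dy: "d * (a * y) \<le> d * u y" using d0 ay by (intro mult_left_mono)
    have p0: "0 \<le> (y - x) powr \<alpha>" by simp
    show "u y - u x \<le> (2 / c1 * C1 / a + C2 / a) * (y - x) powr \<alpha>"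
    proof (cases "y \<le> 1")
      case True
      have "c1 / 2 * (d * u y) \<le> c / 2 * ((u y - u x) * u y)"
        using c d0 u_nonneg[of y] by (auto simp: d_def intro!: mult_right_mono)
      also have "\<dots> \<le> crest_F c (u y) - crest_F c (u x)"
        using xy by (intro crest_F_diff_ge c_nonneg u_nonneg u_mono) auto
      also have "\<dots> \<le> C1 * ((y - x) * y) powr \<beta>" by (rule C1(2)[OF cr c xy(1,2) True])
      finally have "c1 / 2 * (d * u y) \<le> C1 * ((y - x) * y) powr \<beta>" .
      moreover have "c1 / 2 * (d * (a * y)) \<le> c1 / 2 * (d * u y)" by (rule mult_left_mono[OF dy]) (use assms in auto)
      ultimately have "c1 / 2 * (d * (a * y)) \<le> C1 * ((y - x) * y) powr \<beta>" by linarith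
      hence "d \<le> 2 / c1 * C1 / a * (((y - x) * y) powr \<beta> / y)"
        using assms a xy by (simp add: field_simps)
      also have "((y - x) * y) powr \<beta> / y \<le> (y - x) powr \<alpha>"
      proof -
        have "((y - x) * y) powr \<beta> / y = (y - x) powr \<beta> * (y powr \<beta> / y powr 1)"
          using xy by (simp add: powr_mult)
        also have "y powr \<beta> / y powr 1 = y powr (\<beta> - 1)" using powr_diff[of y \<beta> 1] by simp
        also have "(y - x) powr \<beta> * y powr (\<beta> - 1) \<le> (y - x) powr \<beta> * (y - x) powr (\<beta> - 1)"
          using xy \<beta> by (intro mult_left_mono powr_mono2') auto
        also have "\<dots> = (y - x) powr \<alpha>" by (simp add: \<beta>(3)[symmetric] flip: powr_add)
        finally show ?thesis .
      qed
      hence "2 / c1 * C1 / a * (((y - x) * y) powr \<beta> / y) \<le> 2 / c1 * C1 / a * (y - x) powr \<alpha>"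
        using assms C1 a by (intro mult_left_mono) auto
      also have "\<dots> \<le> (2 / c1 * C1 / a + C2 / a) * (y - x) powr \<alpha>"
        using C2 a p0 by (intro mult_right_mono) auto
      finally show ?thesis by (simp add: d_def)
    next
      \<comment> \<open>Beyond 1 the bound \<open>u y \<ge> a\<close> removes the degeneracy, and
        \<open>crest_F_diff_hoelder\<close> is enough.\<close>
      case False
      have "d * a \<le> d * (a * y)" using False d0 a by (intro mult_left_mono) auto
      also note dy
      also have "d * u y \<le> C2 * (y - x) powr \<alpha>" unfolding d_def using xy by (intro C2(2)[OF cr c]) auto
      finally have "d \<le> C2 / a * (y - x) powr \<alpha>" using a by (simp add: field_simps)
      also have "\<dots> \<le> (2 / c1 * C1 / a + C2 / a) * (y - x) powr \<alpha>"
        using C1 a p0 assms by (intro mult_right_mono) auto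
      finally show ?thesis by (simp add: d_def)
    qed
  qed
qed

text \<open>\<open>\<rho>\<close> is the distance to the multiples of \<open>2 * pi\<close>: it is
  1-Lipschitz with values in \<open>{0..pi}\<close>, and \<open>u\<close> factors through
  it.\<close>

lemma (in crest) phi_hoelder_global:
  assumes "\<And>x y. 0 \<le> x \<Longrightarrow> x < y \<Longrightarrow> y \<le> pi \<Longrightarrow> u y - u x \<le> C * (y - x) powr \<alpha>" "0 \<le> C" "0 < \<alpha>"
  shows "\<bar>\<phi> x - \<phi> y\<bar> \<le> C * \<bar>x - y\<bar> powr \<alpha>"
proof -
  define \<rho> where "\<rho> = (\<lambda>x. 2 * pi * \<bar>x / (2 * pi) - of_int (round (x / (2 * pi)))\<bar>)"
  have \<rho>_min: "\<rho> x \<le> \<bar>x - 2 * pi * of_int k\<bar>" for x k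
  proof -
    have "\<rho> x \<le> 2 * pi * \<bar>x / (2 * pi) - of_int k\<bar>"
      unfolding \<rho>_def by (intro mult_left_mono round_diff_minimal) auto
    also have "\<dots> = \<bar>2 * pi * (x / (2 * pi) - of_int k)\<bar>" by (simp add: abs_mult)
    also have "2 * pi * (x / (2 * pi) - of_int k) = x - 2 * pi * of_int k" by (simp add: right_diff_distrib)
    finally show ?thesis .
  qed
  have \<rho>_eq: "\<rho> x = \<bar>x - 2 * pi * of_int (round (x / (2 * pi)))\<bar>" for x
  proof -
    have "\<rho> x = \<bar>2 * pi * (x / (2 * pi) - of_int (round (x / (2 * pi))))\<bar>" by (simp add: abs_mult \<rho>_def)
    also have "2 * pi * (x / (2 * pi) - of_int (round (x / (2 * pi)))) = x - 2 * pi * of_int (round (x / (2 * pi)))"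
      by (simp add: right_diff_distrib)
    finally show ?thesis .
  qed
  have \<rho>_lip: "\<rho> x - \<rho> y \<le> \<bar>x - y\<bar>" for x y
    using \<rho>_min[of x "round (y / (2 * pi))"] \<rho>_eq[of y] by linarith
  have \<rho>_range: "0 \<le> \<rho> x" "\<rho> x \<le> pi" for x
  proof -
    have "\<bar>x / (2 * pi) - of_int (round (x / (2 * pi)))\<bar> \<le> 1 / 2"
      using of_int_round_abs_le[of "x / (2 * pi)"] by (simp add: abs_minus_commute)
    thus "0 \<le> \<rho> x" "\<rho> x \<le> pi" unfolding \<rho>_def by auto
  qed
  have u\<rho>: "u (\<rho> x) = u x" for x
  proof -
    define k where "k = round (x / (2 * pi))"
    have "u (\<rho> x) = u (x - 2 * pi * of_int k)"
      unfolding \<rho>_eq k_def using u_even by (metis abs_if)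
    also have "\<dots> = u x" using circle_periodic_int[OF u_per, of x "- k"] by simp
    finally show ?thesis .
  qed
  have key: "u y - u x \<le> C * \<bar>x - y\<bar> powr \<alpha>" for x y
  proof (cases "\<rho> x < \<rho> y")
    case True
    have "u y - u x \<le> C * (\<rho> y - \<rho> x) powr \<alpha>"
      using assms(1)[of "\<rho> x" "\<rho> y"] True \<rho>_range by (simp add: u\<rho>)
    also have "\<dots> \<le> C * \<bar>x - y\<bar> powr \<alpha>"
      using \<rho>_lip[of y x] True assms by (intro mult_left_mono powr_mono2) (auto simp: abs_minus_commute)
    finally show ?thesis .
  next
    case False
    hence "u y \<le> u x" using u_mono[of "\<rho> y" "\<rho> x"] \<rho>_range by (simp add: u\<rho>)
    moreover have "0 \<le> C * \<bar>x - y\<bar> powr \<alpha>" using assms by simp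
    ultimately show ?thesis by linarith
  qed
  show ?thesis using key[of x y] key[of y x] by (auto simp: u_def abs_le_iff abs_minus_commute)
qed

section \<open>Smoothness away from the crest\<close>

text \<open>The class \<open>P\<close> is imposed on the last derivative: continuity yields
  \<open>C^k\<close>, \<open>local_hoelder_half\<close> yields \<open>C^(k,1/2)\<close>. Derivatives
  are existentially quantified so that explicit formulas can serve as witnesses.\<close>

primrec diff_order :: "(real set \<Rightarrow> (real \<Rightarrow> real) \<Rightarrow> bool) \<Rightarrow> nat \<Rightarrow> real set \<Rightarrow> (real \<Rightarrow> real) \<Rightarrow> bool" where
  "diff_order P 0 S f \<longleftrightarrow> P S f"
| "diff_order P (Suc k) S f \<longleftrightarrow> (\<exists>f'. (\<forall>x\<in>S. (f has_real_derivative f' x) (at x)) \<and> diff_order P k S f')"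

lemma diff_order_SucI:
  assumes "\<And>x. x \<in> S \<Longrightarrow> (f has_real_derivative f' x) (at x)" "diff_order P k S f'"
  shows "diff_order P (Suc k) S f"
  unfolding diff_order.simps using assms by blast

text \<open>The constant may depend on the compact subinterval, because derivatives of
  \<open>log_op a b\<close> contain logarithms that are unbounded at \<open>a\<close> and
  \<open>b\<close>.\<close>

definition local_hoelder_half :: "real set \<Rightarrow> (real \<Rightarrow> real) \<Rightarrow> bool" where
  "local_hoelder_half S f \<longleftrightarrow>
     (\<forall>a b. {a..b} \<subseteq> S \<longrightarrow> (\<exists>C. \<forall>x\<in>{a..b}. \<forall>y\<in>{a..b}. \<bar>f x - f y\<bar> \<le> C * sqrt \<bar>x - y\<bar>))"

text \<open>Closure properties shared by continuity and local Hoelder continuity, so that sums,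
  products and inverses are treated once for both scales. \<open>P_antideriv\<close> is what makes
  the orders nested.\<close>

locale regularity_class =
  fixes P :: "real set \<Rightarrow> (real \<Rightarrow> real) \<Rightarrow> bool"
  assumes P_const: "P S (\<lambda>_. r)"
    and P_add: "P S f \<Longrightarrow> P S g \<Longrightarrow> P S (\<lambda>x. f x + g x)"
    and P_mult: "P S f \<Longrightarrow> P S g \<Longrightarrow> P S (\<lambda>x. f x * g x)"
    and P_inverse: "P S f \<Longrightarrow> (\<And>x. x \<in> S \<Longrightarrow> f x \<noteq> 0) \<Longrightarrow> P S (\<lambda>x. inverse (f x))"
    and P_antideriv: "(\<And>x. x \<in> S \<Longrightarrow> (f has_real_derivative f' x) (at x)) \<Longrightarrow> P S f' \<Longrightarrow> P S f"
    and P_cong: "(\<And>x. x \<in> S \<Longrightarrow> f x = g x) \<Longrightarrow> P S f \<Longrightarrow> P S g"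
begin

lemma order_Suc: "diff_order P (Suc k) S f \<Longrightarrow> diff_order P k S f"
proof (induction k arbitrary: f)
  case 0
  thus ?case using P_antideriv by auto
next
  case (Suc k)
  then obtain f' where f': "\<forall>x\<in>S. (f has_real_derivative f' x) (at x)" "diff_order P (Suc k) S f'" by auto
  thus ?case using Suc.IH[of f'] by auto
qed

lemma order_const: "diff_order P k S (\<lambda>_. r)"
proof (induction k arbitrary: r)
  case 0 show ?case by (simp add: P_const)
next
  case (Suc k)
  have "\<forall>x\<in>S. ((\<lambda>_. r) has_real_derivative 0) (at x)" by auto
  thus ?case using Suc[of 0] by (auto intro!: exI[of _ "\<lambda>_. 0"])
qed

lemma order_add: "diff_order P k S f \<Longrightarrow> diff_order P k S g \<Longrightarrow> diff_order P k S (\<lambda>x. f x + g x)"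
proof (induction k arbitrary: f g)
  case 0 thus ?case by (simp add: P_add)
next
  case (Suc k)
  then obtain f' g' where *: "\<forall>x\<in>S. (f has_real_derivative f' x) (at x)" "diff_order P k S f'"
    "\<forall>x\<in>S. (g has_real_derivative g' x) (at x)" "diff_order P k S g'" by auto
  have "\<forall>x\<in>S. ((\<lambda>x. f x + g x) has_real_derivative (f' x + g' x)) (at x)"
    using * by (auto intro!: derivative_intros)
  thus ?case using Suc.IH[OF *(2,4)] by auto
qed

lemma order_mult: "diff_order P k S f \<Longrightarrow> diff_order P k S g \<Longrightarrow> diff_order P k S (\<lambda>x. f x * g x)"
proof (induction k arbitrary: f g)
  case 0 thus ?case by (simp add: P_mult)
next
  case (Suc k)
  then obtain f' g' where *: "\<forall>x\<in>S. (f has_real_derivative f' x) (at x)" "diff_order P k S f'"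
    "\<forall>x\<in>S. (g has_real_derivative g' x) (at x)" "diff_order P k S g'" by auto
  have "\<forall>x\<in>S. ((\<lambda>x. f x * g x) has_real_derivative (f' x * g x + g' x * f x)) (at x)"
    using * by (auto intro!: DERIV_mult)
  moreover have "diff_order P k S (\<lambda>x. f' x * g x + g' x * f x)"
    using Suc.IH[OF *(2) order_Suc[OF Suc.prems(2)]] Suc.IH[OF *(4) order_Suc[OF Suc.prems(1)]]
    by (rule order_add)
  ultimately show ?case by auto
qed

lemma order_cmult: "diff_order P k S f \<Longrightarrow> diff_order P k S (\<lambda>x. r * f x)"
  by (rule order_mult[OF order_const])

lemma order_diff: "diff_order P k S f \<Longrightarrow> diff_order P k S g \<Longrightarrow> diff_order P k S (\<lambda>x. f x - g x)"
  using order_add[OF _ order_cmult[of k S g "-1"]] by simp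

lemma order_inverse:
  "diff_order P k S f \<Longrightarrow> (\<And>x. x \<in> S \<Longrightarrow> f x \<noteq> 0) \<Longrightarrow> diff_order P k S (\<lambda>x. inverse (f x))"
proof (induction k arbitrary: f)
  case 0 thus ?case by (simp add: P_inverse)
next
  case (Suc k)
  then obtain f' where *: "\<forall>x\<in>S. (f has_real_derivative f' x) (at x)" "diff_order P k S f'" by auto
  have "\<forall>x\<in>S. ((\<lambda>x. inverse (f x)) has_real_derivative (- 1 * (inverse (f x) * f' x * inverse (f x)))) (at x)"
    using * Suc.prems(2) by (auto intro!: DERIV_inverse')
  moreover have "diff_order P k S (\<lambda>x. inverse (f x))"
    by (rule Suc.IH[OF order_Suc[OF Suc.prems(1)] Suc.prems(2)])
  hence "diff_order P k S (\<lambda>x. - 1 * (inverse (f x) * f' x * inverse (f x)))"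
    by (intro order_cmult order_mult *(2))
  ultimately show ?case by auto
qed

lemma order_cong:
  assumes "open S" "\<And>x. x \<in> S \<Longrightarrow> f x = g x" "diff_order P k S f"
  shows "diff_order P k S g"
proof (cases k)
  case 0 thus ?thesis using assms P_cong by auto
next
  case (Suc j)
  then obtain f' where *: "\<forall>x\<in>S. (f has_real_derivative f' x) (at x)" "diff_order P j S f'" using assms by auto
  have "(g has_real_derivative f' x) (at x)" if "x \<in> S" for x
    using * that assms by (auto intro: has_field_derivative_transform_within_open[of f _ _ S g])
  thus ?thesis using Suc *(2) by auto
qed

end

interpretation cont: regularity_class "\<lambda>S f. continuous_on S f"
proof unfold_locales
  fix S and f f' :: "real \<Rightarrow> real"
  assume "\<And>x. x \<in> S \<Longrightarrow> (f has_real_derivative f' x) (at x)"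
  thus "continuous_on S f" by (intro continuous_at_imp_continuous_on ballI DERIV_isCont)
next
  fix S and f g :: "real \<Rightarrow> real"
  assume "\<And>x. x \<in> S \<Longrightarrow> f x = g x" "continuous_on S f"
  thus "continuous_on S g" using continuous_on_cong[of S S f g] by simp
qed (simp_all add: continuous_on_add continuous_on_mult continuous_on_inverse)

lemma local_hoelder_half_continuous:
  assumes "local_hoelder_half S f" "{a..b} \<subseteq> S"
  shows "continuous_on {a..b} f"
proof -
  obtain C where C: "\<forall>x\<in>{a..b}. \<forall>y\<in>{a..b}. \<bar>f x - f y\<bar> \<le> C * sqrt \<bar>x - y\<bar>"
    using assms unfolding local_hoelder_half_def by blast
  show ?thesis unfolding continuous_on_def
  proof
    fix x assume x: "x \<in> {a..b}"
    have "((\<lambda>y. C * sqrt \<bar>x - y\<bar>) \<longlongrightarrow> C * sqrt \<bar>x - x\<bar>) (at x within {a..b})" by (intro tendsto_intros)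
    hence "((\<lambda>y. C * sqrt \<bar>x - y\<bar>) \<longlongrightarrow> 0) (at x within {a..b})" by simp
    moreover have "\<forall>\<^sub>F y in at x within {a..b}. dist (f y) (f x) \<le> C * sqrt \<bar>x - y\<bar>"
      unfolding eventually_at_filter using C x by (auto simp: dist_real_def abs_minus_commute)
    ultimately have "((\<lambda>y. dist (f y) (f x)) \<longlongrightarrow> 0) (at x within {a..b})"
      by (intro Lim_null_comparison[where f = "\<lambda>y. dist (f y) (f x)"]) auto
    thus "(f \<longlongrightarrow> f x) (at x within {a..b})" by (simp add: tendsto_dist_iff[of f])
  qed
qed

lemma hoelder_half_bound:
  assumes "local_hoelder_half S f" "{a..b} \<subseteq> S"
  obtains C M where "0 \<le> C" "0 \<le> M" "\<And>x y. x \<in> {a..b} \<Longrightarrow> y \<in> {a..b} \<Longrightarrow> \<bar>f x - f y\<bar> \<le> C * sqrt \<bar>x - y\<bar>"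
    "\<And>x. x \<in> {a..b} \<Longrightarrow> \<bar>f x\<bar> \<le> M"
proof -
  obtain C where C: "\<forall>x\<in>{a..b}. \<forall>y\<in>{a..b}. \<bar>f x - f y\<bar> \<le> C * sqrt \<bar>x - y\<bar>"
    using assms unfolding local_hoelder_half_def by blast
  have "bounded (f ` {a..b})"
    using local_hoelder_half_continuous[OF assms] by (intro compact_imp_bounded compact_continuous_image) auto
  then obtain M where M: "\<And>y. y \<in> {a..b} \<Longrightarrow> \<bar>f y\<bar> \<le> M" unfolding bounded_real by blast
  show ?thesis
  proof (rule that[of "\<bar>C\<bar>" "\<bar>M\<bar>"])
    fix x y assume "x \<in> {a..b}" "y \<in> {a..b}"
    hence "\<bar>f x - f y\<bar> \<le> C * sqrt \<bar>x - y\<bar>" using C by blast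
    also have "\<dots> \<le> \<bar>C\<bar> * sqrt \<bar>x - y\<bar>" by (intro mult_right_mono) auto
    finally show "\<bar>f x - f y\<bar> \<le> \<bar>C\<bar> * sqrt \<bar>x - y\<bar>" .
  next
    fix x assume "x \<in> {a..b}" thus "\<bar>f x\<bar> \<le> \<bar>M\<bar>" using M by force
  qed auto
qed

lemma differentiable_imp_local_hoelder_half:
  assumes "\<And>x. x \<in> S \<Longrightarrow> (f has_real_derivative f' x) (at x)" "continuous_on S f'"
  shows "local_hoelder_half S f"
  unfolding local_hoelder_half_def
proof (intro allI impI)
  fix a b assume ab: "{a..b} \<subseteq> S"
  have "bounded (f' ` {a..b})"
    using assms(2) ab by (intro compact_imp_bounded compact_continuous_image) (auto intro: continuous_on_subset)
  then obtain M where M: "\<And>y. y \<in> {a..b} \<Longrightarrow> \<bar>f' y\<bar> \<le> M" unfolding bounded_real by blast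
  have "\<bar>f x - f y\<bar> \<le> (M * sqrt (b - a)) * sqrt \<bar>x - y\<bar>" if xy: "x \<in> {a..b}" "y \<in> {a..b}" for x y
  proof -
    have M0: "0 \<le> M" using M[OF xy(1)] by linarith
    have d: "(f has_real_derivative f' z) (at z within {a..b})" if "z \<in> {a..b}" for z
      using assms(1)[OF subsetD[OF ab that]] by (rule has_field_derivative_at_within)
    have "norm (f x - f y) \<le> M * norm (x - y)"
      using M xy by (intro field_differentiable_bound[of "{a..b}" f f'] d) auto
    also have "norm (x - y) = sqrt \<bar>x - y\<bar> * sqrt \<bar>x - y\<bar>" by simp
    also have "M * (sqrt \<bar>x - y\<bar> * sqrt \<bar>x - y\<bar>) \<le> M * (sqrt (b - a) * sqrt \<bar>x - y\<bar>)"
      using xy M0 by (intro mult_left_mono mult_right_mono) auto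
    finally show ?thesis by (simp add: mult_ac)
  qed
  thus "\<exists>C. \<forall>x\<in>{a..b}. \<forall>y\<in>{a..b}. \<bar>f x - f y\<bar> \<le> C * sqrt \<bar>x - y\<bar>" by blast
qed

interpretation hoelder: regularity_class local_hoelder_half
proof unfold_locales
  fix S :: "real set" and r :: real
  show "local_hoelder_half S (\<lambda>_. r)"
    unfolding local_hoelder_half_def by (auto intro!: exI[of _ 0])
next
  fix S and f g :: "real \<Rightarrow> real"
  assume fg: "local_hoelder_half S f" "local_hoelder_half S g"
  show "local_hoelder_half S (\<lambda>x. f x + g x)" unfolding local_hoelder_half_def
  proof (intro allI impI)
    fix a b assume ab: "{a..b} \<subseteq> S"
    obtain C M where C: "\<And>x y. x \<in> {a..b} \<Longrightarrow> y \<in> {a..b} \<Longrightarrow> \<bar>f x - f y\<bar> \<le> C * sqrt \<bar>x - y\<bar>"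
      using hoelder_half_bound[OF fg(1) ab] by metis
    obtain D M where D: "\<And>x y. x \<in> {a..b} \<Longrightarrow> y \<in> {a..b} \<Longrightarrow> \<bar>g x - g y\<bar> \<le> D * sqrt \<bar>x - y\<bar>"
      using hoelder_half_bound[OF fg(2) ab] by metis
    have "\<bar>(f x + g x) - (f y + g y)\<bar> \<le> (C + D) * sqrt \<bar>x - y\<bar>" if "x \<in> {a..b}" "y \<in> {a..b}" for x y
      using C[OF that] D[OF that] by (simp add: distrib_right)
    thus "\<exists>C. \<forall>x\<in>{a..b}. \<forall>y\<in>{a..b}. \<bar>f x + g x - (f y + g y)\<bar> \<le> C * sqrt \<bar>x - y\<bar>" by blast
  qed
  show "local_hoelder_half S (\<lambda>x. f x * g x)" unfolding local_hoelder_half_def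
  proof (intro allI impI)
    fix a b assume ab: "{a..b} \<subseteq> S"
    obtain C M where C: "0 \<le> C" "0 \<le> M" "\<And>x y. x \<in> {a..b} \<Longrightarrow> y \<in> {a..b} \<Longrightarrow> \<bar>f x - f y\<bar> \<le> C * sqrt \<bar>x - y\<bar>"
      "\<And>x. x \<in> {a..b} \<Longrightarrow> \<bar>f x\<bar> \<le> M"
      using hoelder_half_bound[OF fg(1) ab] by metis
    obtain D L where D: "0 \<le> D" "0 \<le> L" "\<And>x y. x \<in> {a..b} \<Longrightarrow> y \<in> {a..b} \<Longrightarrow> \<bar>g x - g y\<bar> \<le> D * sqrt \<bar>x - y\<bar>"
      "\<And>x. x \<in> {a..b} \<Longrightarrow> \<bar>g x\<bar> \<le> L"
      using hoelder_half_bound[OF fg(2) ab] by metis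
    have "\<bar>f x * g x - f y * g y\<bar> \<le> (C * L + M * D) * sqrt \<bar>x - y\<bar>" if xy: "x \<in> {a..b}" "y \<in> {a..b}" for x y
    proof -
      have "f x * g x - f y * g y = (f x - f y) * g x + f y * (g x - g y)" by (simp add: algebra_simps)
      hence "\<bar>f x * g x - f y * g y\<bar> \<le> \<bar>f x - f y\<bar> * \<bar>g x\<bar> + \<bar>f y\<bar> * \<bar>g x - g y\<bar>"
        using abs_triangle_ineq[of "(f x - f y) * g x" "f y * (g x - g y)"] by (simp add: abs_mult)
      also have "\<dots> \<le> (C * sqrt \<bar>x - y\<bar>) * L + M * (D * sqrt \<bar>x - y\<bar>)"
        using C D xy by (intro add_mono mult_mono) auto
      finally show ?thesis by (simp add: algebra_simps)
    qed
    thus "\<exists>C. \<forall>x\<in>{a..b}. \<forall>y\<in>{a..b}. \<bar>f x * g x - f y * g y\<bar> \<le> C * sqrt \<bar>x - y\<bar>" by blast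
  qed
next
  fix S and f :: "real \<Rightarrow> real"
  assume f: "local_hoelder_half S f" and nz: "\<And>x. x \<in> S \<Longrightarrow> f x \<noteq> 0"
  show "local_hoelder_half S (\<lambda>x. inverse (f x))" unfolding local_hoelder_half_def
  proof (intro allI impI)
    fix a b assume ab: "{a..b} \<subseteq> S"
    obtain C M where C: "0 \<le> C" "\<And>x y. x \<in> {a..b} \<Longrightarrow> y \<in> {a..b} \<Longrightarrow> \<bar>f x - f y\<bar> \<le> C * sqrt \<bar>x - y\<bar>"
      using hoelder_half_bound[OF f ab] by metis
    have "continuous_on {a..b} (\<lambda>x. inverse (f x))"
      using local_hoelder_half_continuous[OF f ab] nz ab by (intro continuous_intros) auto
    hence "bounded ((\<lambda>x. inverse (f x)) ` {a..b})" by (intro compact_imp_bounded compact_continuous_image) auto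
    then obtain M where M: "\<And>y. y \<in> {a..b} \<Longrightarrow> \<bar>inverse (f y)\<bar> \<le> M" unfolding bounded_real by blast
    have "\<bar>inverse (f x) - inverse (f y)\<bar> \<le> (M * C * M) * sqrt \<bar>x - y\<bar>" if xy: "x \<in> {a..b}" "y \<in> {a..b}" for x y
    proof -
      have M0: "0 \<le> M" using M[OF xy(1)] by linarith
      have "inverse (f x) - inverse (f y) = inverse (f x) * (f y - f x) * inverse (f y)"
        using nz xy ab by (intro inverse_diff_inverse[THEN trans]) (auto simp: algebra_simps)
      hence "\<bar>inverse (f x) - inverse (f y)\<bar> = \<bar>inverse (f x)\<bar> * \<bar>f x - f y\<bar> * \<bar>inverse (f y)\<bar>"
        by (simp only: abs_mult abs_minus_commute)
      also have "\<dots> \<le> M * (C * sqrt \<bar>x - y\<bar>) * M"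
        using M C xy M0 by (intro mult_mono) auto
      finally show ?thesis by (simp add: mult_ac)
    qed
    thus "\<exists>C. \<forall>x\<in>{a..b}. \<forall>y\<in>{a..b}. \<bar>inverse (f x) - inverse (f y)\<bar> \<le> C * sqrt \<bar>x - y\<bar>" by blast
  qed
next
  fix S and f f' :: "real \<Rightarrow> real"
  assume d: "\<And>x. x \<in> S \<Longrightarrow> (f has_real_derivative f' x) (at x)" and f': "local_hoelder_half S f'"
  show "local_hoelder_half S f" unfolding local_hoelder_half_def
  proof (intro allI impI)
    fix a b assume ab: "{a..b} \<subseteq> S"
    have "local_hoelder_half {a..b} f"
      using d ab local_hoelder_half_continuous[OF f' ab] by (intro differentiable_imp_local_hoelder_half) auto
    thus "\<exists>C. \<forall>x\<in>{a..b}. \<forall>y\<in>{a..b}. \<bar>f x - f y\<bar> \<le> C * sqrt \<bar>x - y\<bar>"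
      unfolding local_hoelder_half_def by blast
  qed
next
  fix S and f g :: "real \<Rightarrow> real"
  assume eq: "\<And>x. x \<in> S \<Longrightarrow> f x = g x" and f: "local_hoelder_half S f"
  show "local_hoelder_half S g" unfolding local_hoelder_half_def
  proof (intro allI impI)
    fix a b assume ab: "{a..b} \<subseteq> S"
    obtain C where C: "\<forall>x\<in>{a..b}. \<forall>y\<in>{a..b}. \<bar>f x - f y\<bar> \<le> C * sqrt \<bar>x - y\<bar>"
      using f ab unfolding local_hoelder_half_def by blast
    have fg: "f x = g x" if "x \<in> {a..b}" for x using eq[OF subsetD[OF ab that]] .
    have "\<forall>x\<in>{a..b}. \<forall>y\<in>{a..b}. \<bar>g x - g y\<bar> \<le> C * sqrt \<bar>x - y\<bar>" using C by (simp add: fg)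
    thus "\<exists>C. \<forall>x\<in>{a..b}. \<forall>y\<in>{a..b}. \<bar>g x - g y\<bar> \<le> C * sqrt \<bar>x - y\<bar>" by blast
  qed
qed

definition smooth_fun :: "real set \<Rightarrow> (real \<Rightarrow> real) \<Rightarrow> bool" where
  "smooth_fun S f \<longleftrightarrow> (\<forall>k. diff_order continuous_on k S f)"

lemma diff_order_cont_imp_hoelder:
  "diff_order continuous_on (Suc k) S f \<Longrightarrow> diff_order local_hoelder_half k S f"
proof (induction k arbitrary: f)
  case 0
  thus ?case using differentiable_imp_local_hoelder_half by auto
next
  case (Suc k)
  then obtain f' where "\<forall>x\<in>S. (f has_real_derivative f' x) (at x)" "diff_order continuous_on (Suc k) S f'" by auto
  thus ?case using Suc.IH[of f'] by auto
qed

lemma smooth_fun_hoelder: "smooth_fun S f \<Longrightarrow> diff_order local_hoelder_half k S f"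
  by (simp add: smooth_fun_def diff_order_cont_imp_hoelder del: diff_order.simps)

text \<open>On the open set \<open>S\<close>, \<open>deriv f\<close> agrees with the existential
  witness and replaces it through \<open>order_cong\<close>.\<close>

lemma diff_order_deriv_iterate:
  assumes "open S" "diff_order continuous_on (Suc k) S f" "x \<in> S"
  shows "((deriv ^^ k) f) field_differentiable (at x)"
  using assms(2)
proof (induction k arbitrary: f)
  case 0
  thus ?case using assms by (auto simp: field_differentiable_def)
next
  case (Suc k)
  then obtain f' where f': "\<forall>x\<in>S. (f has_real_derivative f' x) (at x)" "diff_order continuous_on (Suc k) S f'" by auto
  have "diff_order continuous_on (Suc k) S (deriv f)"
    by (rule cont.order_cong[OF assms(1) _ f'(2)]) (use f'(1) in \<open>auto simp: DERIV_imp_deriv\<close>)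
  from Suc.IH[OF this] show ?case by (simp only: funpow_Suc_right o_def)
qed

text \<open>The half-angle cotangent \<open>w\<close> satisfies \<open>w' = - 1 / 4 - w\<^sup>2\<close>.\<close>

lemma smooth_log_ker:
  assumes "\<And>t. t \<in> S \<Longrightarrow> sin (t / 2) \<noteq> 0"
  shows "smooth_fun S log_ker"
  unfolding smooth_fun_def
proof
  define w :: "real \<Rightarrow> real" where "w = (\<lambda>t. cos (t / 2) / (2 * sin (t / 2)))"
  have dw: "(w has_real_derivative (- 1 / 4 - w t * w t)) (at t)" if "t \<in> S" for t
  proof -
    define s where "s = sin (t / 2)"
    define e where "e = cos (t / 2)"
    have se: "s * s + e * e = 1" unfolding s_def e_def using sin_cos_squared_add[of "t / 2"] by (simp add: power2_eq_square)
    have s0: "s \<noteq> 0" using assms[OF that] by (simp add: s_def)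
    have "(w has_real_derivative ((- (e * (e * 1)) - s * (s * 1)) / (4 * (s * s)))) (at t)"
      unfolding w_def using s0
      by (auto intro!: derivative_eq_intros simp: s_def[symmetric] e_def[symmetric] field_simps)
    also have "(- (e * (e * 1)) - s * (s * 1)) / (4 * (s * s)) = - 1 / 4 - (e / (2 * s)) * (e / (2 * s))"
      using s0 by (simp add: field_simps)
    finally show ?thesis by (simp add: w_def s_def e_def)
  qed
  have cw: "continuous_on S w" using dw by (intro continuous_at_imp_continuous_on ballI DERIV_isCont)
  have sw: "diff_order continuous_on k S w" for k
  proof (induction k)
    case (Suc k)
    have "diff_order continuous_on k S (\<lambda>t. w t * w t)" by (rule cont.order_mult[OF Suc Suc])
    hence "diff_order continuous_on k S (\<lambda>t. - 1 / 4 - w t * w t)"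
      by (rule cont.order_diff[OF cont.order_const])
    with dw show ?case by (rule diff_order_SucI)
  qed (simp add: cw)
  fix k
  have "diff_order continuous_on (Suc k) S log_ker"
    by (rule diff_order_SucI[OF _ sw]) (use log_ker_has_derivative assms in \<open>auto simp: w_def\<close>)
  thus "diff_order continuous_on k S log_ker" by (rule cont.order_Suc)
qed

lemma smooth_kw_series: "diff_order continuous_on j S (kw_series k)"
proof (induction j arbitrary: k)
  case 0
  show ?case by (auto intro!: continuous_at_imp_continuous_on DERIV_isCont[OF kw_series_has_derivative])
next
  case (Suc j)
  thus ?case using kw_series_has_derivative by auto
qed

lemma smooth_smooth_ker: "smooth_fun S smooth_ker"
proof -
  have eq: "smooth_ker = (\<lambda>t. 1 / (2 * pi) * (1 - 4 * kw_series 0 t))" by (auto simp: smooth_ker_def)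
  show ?thesis unfolding smooth_fun_def eq
    by (intro allI cont.order_cmult cont.order_diff cont.order_const smooth_kw_series)
qed

lemma smooth_K_ker:
  assumes "\<And>t. t \<in> S \<Longrightarrow> sin (t / 2) \<noteq> 0"
  shows "smooth_fun S K_ker"
proof -
  have eq: "K_ker = (\<lambda>t. smooth_ker t - 1 / pi * log_ker t)" by (auto simp: K_ker_def)
  show ?thesis using smooth_smooth_ker smooth_log_ker[OF assms] unfolding smooth_fun_def eq
    by (intro allI cont.order_cmult cont.order_diff) auto
qed

lemma diff_order_translate:
  assumes "diff_order continuous_on k V f" "\<And>x. x \<in> S \<Longrightarrow> x - r \<in> V"
  shows "diff_order continuous_on k S (\<lambda>x. f (x - r))"
  using assms(1)
proof (induction k arbitrary: f)
  case 0
  thus ?case using assms(2) by (auto intro!: continuous_on_compose2[of V f] continuous_intros)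
next
  case (Suc k)
  then obtain f' where f': "\<forall>x\<in>V. (f has_real_derivative f' x) (at x)" "diff_order continuous_on k V f'" by auto
  have "((\<lambda>x. f (x - r)) has_real_derivative f' (x - r)) (at x)" if "x \<in> S" for x
  proof -
    have "(f has_real_derivative f' (x - r)) (at (x - r))" using f'(1) assms(2)[OF that] by blast
    moreover have "((\<lambda>x. x - r) has_real_derivative 1) (at x)" by (auto intro!: derivative_eq_intros)
    ultimately show ?thesis using DERIV_chain2[of f "f' (x - r)" "\<lambda>x. x - r" x 1 UNIV] by simp
  qed
  thus ?case using Suc.IH[OF f'(2)] by (rule diff_order_SucI)
qed

section \<open>Parameter integrals with smooth kernels\<close>

lemma conv_integrand_continuous:
  fixes k g :: "real \<Rightarrow> real"
  assumes "continuous_on V k" "continuous_on {p..q} g" "\<And>x y. x \<in> S \<Longrightarrow> y \<in> {p..q} \<Longrightarrow> x - y \<in> V"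
  shows "continuous_on (S \<times> cbox p q) (\<lambda>(x, y). k (x - y) * g y)"
proof -
  have "continuous_on (S \<times> cbox p q) (\<lambda>z. k (fst z - snd z))"
    by (rule continuous_on_compose2[OF assms(1)]) (use assms(3) in \<open>auto intro!: continuous_intros\<close>)
  moreover have "continuous_on (S \<times> cbox p q) (\<lambda>z. g (snd z))"
    by (rule continuous_on_compose2[OF assms(2)]) (auto intro!: continuous_intros)
  ultimately show ?thesis unfolding case_prod_unfold by (intro continuous_intros)
qed

lemma conv_integral_has_derivative:
  fixes k g :: "real \<Rightarrow> real"
  assumes k: "\<And>t. t \<in> V \<Longrightarrow> (k has_real_derivative k' t) (at t)" "continuous_on V k'"
    and g: "continuous_on {p..q} g"
    and S: "open S" "convex S" "\<And>x y. x \<in> S \<Longrightarrow> y \<in> {p..q} \<Longrightarrow> x - y \<in> V"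
    and x: "x \<in> S"
  shows "((\<lambda>x. integral {p..q} (\<lambda>y. k (x - y) * g y)) has_real_derivative
     integral {p..q} (\<lambda>y. k' (x - y) * g y)) (at x)"
proof -
  have ck: "continuous_on V k" using k(1) by (auto intro!: continuous_at_imp_continuous_on DERIV_isCont)
  have "((\<lambda>x. integral (cbox p q) (\<lambda>y. k (x - y) * g y)) has_real_derivative
     integral (cbox p q) (\<lambda>y. k' (x - y) * g y)) (at x within S)"
  proof (rule leibniz_rule_field_derivative)
    fix x t assume xt: "x \<in> S" "t \<in> cbox p q"
    have "(k has_real_derivative k' (x - t)) (at (x - t))" using k(1) S(3) xt by simp
    moreover have "((\<lambda>x. x - t) has_real_derivative 1) (at x within S)" by (auto intro!: derivative_eq_intros)
    ultimately have "((\<lambda>x. k (x - t)) has_real_derivative k' (x - t)) (at x within S)"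
      using DERIV_chain2[of k "k' (x - t)" "\<lambda>x. x - t" x 1 S] by simp
    thus "((\<lambda>x. k (x - t) * g t) has_real_derivative k' (x - t) * g t) (at x within S)"
      by (rule DERIV_cmult_right)
  next
    fix x assume x: "x \<in> S"
    have "continuous_on {p..q} (\<lambda>y. k (x - y))"
      by (rule continuous_on_compose2[OF ck]) (intro continuous_intros image_subsetI S(3)[OF x] | assumption)+
    hence "continuous_on {p..q} (\<lambda>y. k (x - y) * g y)" by (intro continuous_on_mult g)
    thus "(\<lambda>y. k (x - y) * g y) integrable_on cbox p q" by (simp add: integrable_continuous_interval)
  qed (use conv_integrand_continuous[OF k(2) g S(3)] S x in auto)
  thus ?thesis unfolding at_within_open[OF x S(1)] by simp
qed

lemma conv_integral_order:
  fixes k g :: "real \<Rightarrow> real"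
  assumes "diff_order continuous_on n V k" "continuous_on {p..q} g"
    and S: "open S" "convex S" "\<And>x y. x \<in> S \<Longrightarrow> y \<in> {p..q} \<Longrightarrow> x - y \<in> V"
  shows "diff_order continuous_on n S (\<lambda>x. integral {p..q} (\<lambda>y. k (x - y) * g y))"
  using assms(1)
proof (induction n arbitrary: k)
  case 0
  hence "continuous_on V k" by simp
  from integral_continuous_on_param[OF conv_integrand_continuous[OF this assms(2) S(3)]]
  show ?case by simp
next
  case (Suc n)
  then obtain k' where k': "\<forall>x\<in>V. (k has_real_derivative k' x) (at x)" "diff_order continuous_on n V k'" by auto
  have "continuous_on V k'" using k'(2)
  proof (induction n arbitrary: k')
    case (Suc n) thus ?case by (metis cont.order_Suc)
  qed simp
  hence "((\<lambda>x. integral {p..q} (\<lambda>y. k (x - y) * g y)) has_real_derivative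
     integral {p..q} (\<lambda>y. k' (x - y) * g y)) (at x)" if "x \<in> S" for x
    using k'(1) by (intro conv_integral_has_derivative[OF _ _ assms(2) S that]) auto
  thus ?case using Suc.IH[OF k'(2)] by (rule diff_order_SucI)
qed

lemma conv_integral_smooth:
  assumes "smooth_fun V k" "continuous_on {p..q} g"
    "open S" "convex S" "\<And>x y. x \<in> S \<Longrightarrow> y \<in> {p..q} \<Longrightarrow> x - y \<in> V"
  shows "smooth_fun S (\<lambda>x. integral {p..q} (\<lambda>y. k (x - y) * g y))"
  using assms conv_integral_order unfolding smooth_fun_def by blast

section \<open>Differentiability of the logarithmic convolution on an interval\<close>

definition log_op :: "real \<Rightarrow> real \<Rightarrow> (real \<Rightarrow> real) \<Rightarrow> real \<Rightarrow> real" where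
  "log_op a b g x = integral {a..b} (\<lambda>y. log_ker (x - y) * g y)"

text \<open>For \<open>e > 0\<close> a smooth approximation of \<open>log_ker\<close>, whose
  integrals may be differentiated under the integral sign; the derivative of \<open>log_ker\<close>
  itself is not integrable at 0.\<close>

definition reg_ker :: "real \<Rightarrow> real \<Rightarrow> real" where
  "reg_ker e t = ln ((2 * sin (t / 2))\<^sup>2 + e\<^sup>2) / 2"

definition reg_ker_deriv :: "real \<Rightarrow> real \<Rightarrow> real" where
  "reg_ker_deriv e t = sin t / ((2 * sin (t / 2))\<^sup>2 + e\<^sup>2)"

lemma reg_ker_has_derivative:
  assumes "0 < e"
  shows "(reg_ker e has_real_derivative reg_ker_deriv e t) (at t)"
proof -
  have pos: "0 < (2 * sin (t / 2))\<^sup>2 + e\<^sup>2" using assms by (intro add_nonneg_pos) auto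
  have "((\<lambda>t. (2 * sin (t / 2))\<^sup>2 + e\<^sup>2) has_real_derivative 2 * sin t) (at t)"
    using sin_double[of "t / 2"] by (auto intro!: derivative_eq_intros)
  from DERIV_cdivide[OF DERIV_chain2[OF DERIV_ln[OF pos] this], of 2]
  have "(reg_ker e has_real_derivative inverse ((2 * sin (t / 2))\<^sup>2 + e\<^sup>2) * (2 * sin t) / 2) (at t)"
    unfolding reg_ker_def .
  moreover have "inverse X * (2 * y) / 2 = y / X" for X y :: real
    by (cases "X = 0") (auto simp: field_simps)
  ultimately show ?thesis unfolding reg_ker_deriv_def by (simp only:)
qed

lemma reg_ker_continuous: "0 < e \<Longrightarrow> continuous_on S (reg_ker e)"
  by (intro continuous_at_imp_continuous_on ballI DERIV_isCont[OF reg_ker_has_derivative])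

lemma reg_ker_deriv_continuous:
  assumes "0 < e"
  shows "continuous_on S (reg_ker_deriv e)"
proof -
  have "(2 * sin (t / 2))\<^sup>2 + e\<^sup>2 \<noteq> 0" for t
    using assms by (intro less_imp_neq[THEN not_sym] add_nonneg_pos) auto
  thus ?thesis unfolding reg_ker_deriv_def by (intro continuous_intros) auto
qed

text \<open>With \<open>r = sqrt (e / S)\<close> the error is \<open>ln (1 + r ^ 4) / 2\<close>, at
  most \<open>2 * r\<close> because \<open>1 + r ^ 4 \<le> (1 + r) ^ 4\<close>. The singularity in
  \<open>t\<close> is integrable; 3 bounds \<open>2 * sqrt 2\<close>.\<close>

lemma reg_ker_close:
  assumes "0 < e" "t \<noteq> 0" "\<bar>t\<bar> \<le> pi"
  shows "\<bar>reg_ker e t - log_ker t\<bar> \<le> 3 * sqrt e * \<bar>t\<bar> powr - (1 / 2)"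
proof -
  define S where "S = \<bar>2 * sin (t / 2)\<bar>"
  have St: "\<bar>t\<bar> / 2 \<le> S" unfolding S_def by (rule abs_two_sin_half_ge[OF assms(3)])
  have S0: "0 < S" using St assms(2) by linarith
  define r where "r = sqrt (e / S)"
  have r0: "0 \<le> r" using assms S0 by (simp add: r_def)
  have r4: "r ^ 4 = (e / S)\<^sup>2"
  proof -
    have "r ^ 4 = (r\<^sup>2)\<^sup>2" by simp
    thus ?thesis using assms S0 by (simp add: r_def)
  qed
  have "reg_ker e t = ln (S\<^sup>2 + e\<^sup>2) / 2" by (simp add: reg_ker_def S_def)
  also have "S\<^sup>2 + e\<^sup>2 = S\<^sup>2 * (1 + r ^ 4)" using S0 by (simp add: r4 power_divide field_simps)
  also have "ln (S\<^sup>2 * (1 + r ^ 4)) / 2 = ln S + ln (1 + r ^ 4) / 2"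
  proof -
    have "0 < 1 + r ^ 4" using r0 by (intro add_pos_nonneg) auto
    hence "ln (S\<^sup>2 * (1 + r ^ 4)) = ln (S\<^sup>2) + ln (1 + r ^ 4)" using S0 by (intro ln_mult_pos) auto
    thus ?thesis using S0 by (simp add: ln_realpow)
  qed
  finally have eq: "reg_ker e t - log_ker t = ln (1 + r ^ 4) / 2" by (simp add: log_ker_def S_def)
  have "ln (1 + r ^ 4) \<le> ln ((1 + r) ^ 4)"
  proof (rule ln_mono)
    have "(1 + r) ^ 4 = 1 + r ^ 4 + (4 * r + 6 * r\<^sup>2 + 4 * r ^ 3)"
      by (simp add: power4_eq_xxxx power3_eq_cube power2_eq_square algebra_simps)
    thus "1 + r ^ 4 \<le> (1 + r) ^ 4" using r0 by simp
  qed (use r0 in \<open>auto intro!: add_pos_nonneg\<close>)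
  also have "\<dots> = 4 * ln (1 + r)" using r0 by (simp add: ln_realpow)
  also have "\<dots> \<le> 4 * r" using ln_add_one_self_le_self[OF r0] by simp
  finally have "ln (1 + r ^ 4) / 2 \<le> 2 * r" by simp
  moreover have "0 \<le> ln (1 + r ^ 4)" using r0 by (intro ln_ge_zero) auto
  ultimately have "\<bar>reg_ker e t - log_ker t\<bar> \<le> 2 * r" unfolding eq by simp
  also have "r \<le> sqrt (e / (\<bar>t\<bar> / 2))"
    unfolding r_def using St assms by (intro real_sqrt_le_mono divide_left_mono) (auto intro!: mult_pos_pos S0)
  also have "sqrt (e / (\<bar>t\<bar> / 2)) = sqrt 2 * (sqrt e * (1 / sqrt \<bar>t\<bar>))"
    by (simp add: real_sqrt_mult real_sqrt_divide)
  also have "1 / sqrt \<bar>t\<bar> = \<bar>t\<bar> powr - (1 / 2)" unfolding powr_minus_divide by (subst powr_half_sqrt) auto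
  finally have "\<bar>reg_ker e t - log_ker t\<bar> \<le> (2 * sqrt 2) * (sqrt e * \<bar>t\<bar> powr - (1 / 2))" by simp
  also have "\<dots> \<le> 3 * (sqrt e * \<bar>t\<bar> powr - (1 / 2))"
  proof (rule mult_right_mono)
    have "sqrt 2 \<le> (3 / 2 :: real)" by (rule real_le_lsqrt) (auto simp: power2_eq_square)
    thus "2 * sqrt 2 \<le> (3 :: real)" by simp
  qed (use assms in auto)
  finally show ?thesis by simp
qed

lemma reg_ker_deriv_eq:
  fixes t :: real
  assumes "sin (t / 2) \<noteq> 0"
  defines "s \<equiv> \<bar>2 * sin (t / 2)\<bar>"
  shows "\<bar>sin t\<bar> \<le> s" and "cos (t / 2) / (2 * sin (t / 2)) = sin t / s\<^sup>2"
proof -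
  have sin: "sin t = 2 * sin (t / 2) * cos (t / 2)" using sin_double[of "t / 2"] by simp
  show "\<bar>sin t\<bar> \<le> s" unfolding sin s_def abs_mult by (intro mult_left_le) auto
  show "cos (t / 2) / (2 * sin (t / 2)) = sin t / s\<^sup>2"
    using assms(1) unfolding sin s_def by (simp add: power2_eq_square)
qed

text \<open>Uniform in \<open>e\<close>. The bound is not integrable by itself, but against a
  Hoelder-1/2 difference of the density it becomes a multiple of
  \<open>|t| powr - (1 / 2)\<close>.\<close>

lemma reg_ker_deriv_bound:
  assumes "t \<noteq> 0" "\<bar>t\<bar> \<le> pi"
  shows "\<bar>reg_ker_deriv e t\<bar> \<le> 2 / \<bar>t\<bar>"
proof -
  define s where "s = \<bar>2 * sin (t / 2)\<bar>"
  have nz: "sin (t / 2) \<noteq> 0" using assms pi_gt_zero by (subst sin_half_eq_0_iff) auto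
  have st: "\<bar>t\<bar> / 2 \<le> s" unfolding s_def by (rule abs_two_sin_half_ge[OF assms(2)])
  have s0: "0 < s" using nz by (simp add: s_def)
  have "\<bar>reg_ker_deriv e t\<bar> = \<bar>sin t\<bar> / (s\<^sup>2 + e\<^sup>2)" by (simp add: reg_ker_deriv_def s_def abs_divide)
  also have "\<dots> \<le> s / s\<^sup>2"
    using reg_ker_deriv_eq(1)[OF nz] s0 by (intro frac_le) (auto simp: s_def)
  also have "\<dots> = 1 / s" using s0 by (simp add: power2_eq_square)
  also have "\<dots> \<le> 1 / (\<bar>t\<bar> / 2)" using st assms by (intro divide_left_mono) (auto intro!: mult_pos_pos s0)
  finally show ?thesis by simp
qed

text \<open>The power \<open>1 / 4\<close> of \<open>e\<close> costs the same power of
  \<open>|t|\<close>; against a Hoelder-1/2 difference the exponent \<open>- (5 / 4)\<close> becomes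
  \<open>- (3 / 4)\<close>, which is still integrable.\<close>

lemma reg_ker_deriv_close:
  assumes "0 < e" "t \<noteq> 0" "\<bar>t\<bar> \<le> pi"
  shows "\<bar>reg_ker_deriv e t - cos (t / 2) / (2 * sin (t / 2))\<bar> \<le> 3 * e powr (1 / 4) * \<bar>t\<bar> powr - (5 / 4)"
proof -
  define s where "s = \<bar>2 * sin (t / 2)\<bar>"
  have nz: "sin (t / 2) \<noteq> 0" using assms pi_gt_zero by (subst sin_half_eq_0_iff) auto
  have st: "\<bar>t\<bar> / 2 \<le> s" unfolding s_def by (rule abs_two_sin_half_ge[OF assms(3)])
  have s0: "0 < s" using nz by (simp add: s_def)
  define w where "w = e / s"
  have w0: "0 < w" using assms s0 by (simp add: w_def)
  have "reg_ker_deriv e t - cos (t / 2) / (2 * sin (t / 2)) = sin t / (s\<^sup>2 + e\<^sup>2) - sin t / s\<^sup>2"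
    unfolding reg_ker_deriv_eq(2)[OF nz] by (simp add: reg_ker_deriv_def s_def)
  also have "\<dots> = - (sin t * (1 / s\<^sup>2 * (w\<^sup>2 / (1 + w\<^sup>2))))"
  proof -
    define p where "p = 1 + w\<^sup>2"
    have p: "0 < p" unfolding p_def by (intro add_pos_nonneg) auto
    have w2: "w\<^sup>2 = p - 1" by (simp add: p_def)
    have "s\<^sup>2 + e\<^sup>2 = s\<^sup>2 * p" using s0 by (simp add: p_def w_def power_divide field_simps)
    thus ?thesis unfolding p_def[symmetric] unfolding w2 using s0 p by (simp add: field_simps)
  qed
  finally have "\<bar>reg_ker_deriv e t - cos (t / 2) / (2 * sin (t / 2))\<bar> = \<bar>sin t\<bar> * (1 / s\<^sup>2 * (w\<^sup>2 / (1 + w\<^sup>2)))"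
    by (simp add: abs_mult)
  also have "\<dots> \<le> s * (1 / s\<^sup>2 * w powr (1 / 4))"
  proof (intro mult_mono)
    show "w\<^sup>2 / (1 + w\<^sup>2) \<le> w powr (1 / 4)"
    proof (cases "w \<le> 1")
      case True
      have "w\<^sup>2 / (1 + w\<^sup>2) \<le> w\<^sup>2 / 1" by (intro divide_left_mono) (auto intro!: add_pos_nonneg)
      moreover have "w\<^sup>2 = w powr 2" using w0 by (simp add: powr_numeral)
      moreover have "w powr 2 \<le> w powr (1 / 4)" using True w0 powr_mono'[of "1 / 4" 2 w] by simp
      ultimately show ?thesis by simp
    next
      case False
      have "w\<^sup>2 / (1 + w\<^sup>2) \<le> 1" by (simp add: divide_le_eq add_pos_nonneg)
      also have "1 \<le> w powr (1 / 4)" using False by (intro ge_one_powr_ge_zero) auto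
      finally show ?thesis .
    qed
  qed (use reg_ker_deriv_eq(1)[OF nz] s0 in \<open>auto simp: s_def\<close>)
  also have "\<dots> = e powr (1 / 4) * s powr - (5 / 4)"
  proof -
    have w: "w powr (1 / 4) = e powr (1 / 4) * s powr - (1 / 4)"
      using assms s0 by (simp add: w_def powr_divide powr_minus_divide)
    have "s * (1 / s\<^sup>2 * w powr (1 / 4)) = e powr (1 / 4) * s powr - (1 / 4) * s powr - 1"
      unfolding w using s0 by (simp add: power2_eq_square powr_minus_divide)
    also have "\<dots> = e powr (1 / 4) * s powr - (5 / 4)"
      using powr_add[of s "- (1 / 4)" "- 1"] by simp
    finally show ?thesis .
  qed
  also have "\<dots> \<le> e powr (1 / 4) * (3 * \<bar>t\<bar> powr - (5 / 4))"
  proof (rule mult_left_mono)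
    have "s powr - (5 / 4) \<le> (\<bar>t\<bar> / 2) powr - (5 / 4)" using st assms by (intro powr_mono2') auto
    also have "\<dots> = 2 powr (5 / 4) * \<bar>t\<bar> powr - (5 / 4)" by (simp add: powr_divide powr_minus_divide)
    also have "\<dots> \<le> 3 * \<bar>t\<bar> powr - (5 / 4)"
    proof (rule mult_right_mono)
      have "(2::real) powr (5 / 4) \<le> 2 powr (3 / 2)" by (intro powr_mono) auto
      also have "2 powr (3 / 2 :: real) = 2 powr (1 + 1 / 2)" by simp
      also have "\<dots> = 2 * sqrt 2" unfolding powr_add by (simp add: powr_half_sqrt)
      also have "sqrt 2 \<le> (3 / 2 :: real)" by (rule real_le_lsqrt) (auto simp: power2_eq_square)
      finally show "(2::real) powr (5 / 4) \<le> 3" by simp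
    qed auto
    finally show "s powr - (5 / 4) \<le> 3 * \<bar>t\<bar> powr - (5 / 4)" .
  qed auto
  finally show ?thesis by (simp add: mult_ac)
qed

lemma log_op_integrable:
  assumes "{a..b} \<subseteq> {-pi..pi}" "continuous_on {a..b} g"
  shows "(\<lambda>y. log_ker (x - y) * g y) integrable_on {a..b}"
proof -
  have "(\<lambda>y. log_ker (x - y)) absolutely_integrable_on {a..b}"
    by (rule absolutely_integrable_on_subinterval[OF log_ker_shift_absolutely_integrable assms(1)])
  from absolutely_integrable_mult_continuous[OF this assms(2)] show ?thesis
    by (simp add: absolutely_integrable_on_def)
qed

lemma reg_ker_integrable:
  assumes "0 < e" "continuous_on {a..b} g"
  shows "(\<lambda>y. reg_ker e (x - y) * g y) integrable_on {a..b}"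
    and "(\<lambda>y. reg_ker_deriv e (x - y) * g y) integrable_on {a..b}"
  using assms
  by (auto intro!: integrable_continuous_interval continuous_on_mult
      continuous_on_compose2[OF reg_ker_continuous[OF assms(1), of UNIV]]
      continuous_on_compose2[OF reg_ker_deriv_continuous[OF assms(1), of UNIV]] continuous_intros)

lemma reg_ker_op_close:
  assumes e: "0 < e" and ab: "{a..b} \<subseteq> {-pi..pi}" "b - a \<le> pi" and g: "continuous_on {a..b} g"
    and M: "\<And>y. y \<in> {a..b} \<Longrightarrow> \<bar>g y\<bar> \<le> M" and x: "x \<in> {a..b}"
  shows "\<bar>integral {a..b} (\<lambda>y. reg_ker e (x - y) * g y) - log_op a b g x\<bar> \<le> 12 * M * sqrt (b - a) * sqrt e"
proof -
  have M0: "0 \<le> M" using M[OF x] by linarith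
  define h where "h = (\<lambda>y. (3 * sqrt e * M) * \<bar>x - y\<bar> powr - (1 / 2))"
  define d where "d = (\<lambda>y. if y = x then 0 else reg_ker e (x - y) * g y - log_ker (x - y) * g y)"
  note pw = abs_powr_integrable_bound[of "1/2" x a b]
  have i: "(\<lambda>y. reg_ker e (x - y) * g y - log_ker (x - y) * g y) integrable_on {a..b}"
    by (intro integrable_diff reg_ker_integrable log_op_integrable e g ab)
  have "integral {a..b} (\<lambda>y. reg_ker e (x - y) * g y) - log_op a b g x =
     integral {a..b} (\<lambda>y. reg_ker e (x - y) * g y - log_ker (x - y) * g y)"
    unfolding log_op_def
    by (intro Henstock_Kurzweil_Integration.integral_diff[symmetric] reg_ker_integrable log_op_integrable e g ab)
  also have "\<dots> = integral {a..b} d"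
    by (rule integral_spike[of "{x}"]) (auto simp: d_def)
  finally have eq: "integral {a..b} (\<lambda>y. reg_ker e (x - y) * g y) - log_op a b g x = integral {a..b} d" .
  have "norm (integral {a..b} d) \<le> integral {a..b} h"
  proof (rule integral_norm_bound_integral)
    show "d integrable_on {a..b}" by (rule integrable_spike[OF i, of "{x}"]) (auto simp: d_def)
    show "h integrable_on {a..b}" unfolding h_def using pw x by (intro integrable_on_mult_right) auto
    fix y assume y: "y \<in> {a..b}"
    show "norm (d y) \<le> h y"
    proof (cases "y = x")
      case False
      have "\<bar>reg_ker e (x - y) - log_ker (x - y)\<bar> * \<bar>g y\<bar> \<le> (3 * sqrt e * \<bar>x - y\<bar> powr - (1 / 2)) * M"
        using e False x y ab M[OF y] by (intro mult_mono reg_ker_close) auto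
      moreover have "d y = (reg_ker e (x - y) - log_ker (x - y)) * g y" using False by (simp add: d_def left_diff_distrib)
      ultimately show ?thesis by (simp add: h_def abs_mult mult_ac)
    qed (use e M0 in \<open>simp add: d_def h_def\<close>)
  qed
  also have "integral {a..b} h = (3 * sqrt e * M) * integral {a..b} (\<lambda>y. \<bar>x - y\<bar> powr - (1 / 2))"
    unfolding h_def by (rule Henstock_Kurzweil_Integration.integral_mult_right)
  also have "\<dots> \<le> (3 * sqrt e * M) * (4 * sqrt (b - a))"
    using pw(2) x e M0 by (intro mult_left_mono) (auto simp: powr_half_sqrt)
  finally show ?thesis unfolding eq by (simp add: mult_ac)
qed

text \<open>Uniform convergence of the derivatives is asked for on a neighbourhood \<open>S\<close>
  only, which can be kept away from the endpoints of the integral.\<close>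

lemma derivative_of_limit:
  fixes f :: "nat \<Rightarrow> real \<Rightarrow> real"
  assumes S: "open S" "convex S" "x \<in> S"
    and d: "\<And>n y. y \<in> S \<Longrightarrow> (f n has_real_derivative f' n y) (at y)"
    and lim: "\<And>y. y \<in> S \<Longrightarrow> (\<lambda>n. f n y) \<longlonglongrightarrow> F y"
    and u: "\<And>n y. y \<in> S \<Longrightarrow> \<bar>f' n y - D y\<bar> \<le> \<eta> n" "\<eta> \<longlonglongrightarrow> 0"
  shows "(F has_real_derivative D x) (at x)"
proof -
  have "\<exists>g. \<forall>y\<in>S. (\<lambda>n. f n y) \<longlonglongrightarrow> g y \<and> (g has_derivative (*) (D y)) (at y within S)"
  proof (rule has_derivative_sequence[where S = S and f = f and f' = "\<lambda>n y. (*) (f' n y)"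
        and g' = "\<lambda>y. (*) (D y)" and ?x0.0 = x and l = "F x"])
    fix n y assume "y \<in> S"
    thus "(f n has_derivative (*) (f' n y)) (at y within S)"
      using d[of y n] by (auto simp: has_field_derivative_def intro: has_derivative_at_withinI)
  next
    fix e :: real assume "e > 0"
    hence "\<forall>\<^sub>F n in sequentially. \<eta> n < e" using u(2) by (intro order_tendstoD) auto
    thus "\<forall>\<^sub>F n in sequentially. \<forall>y\<in>S. \<forall>h. norm (f' n y * h - D y * h) \<le> e * norm h"
    proof eventually_elim
      case (elim n)
      show ?case
      proof (intro ballI allI)
        fix y h assume "y \<in> S"
        hence "\<bar>f' n y - D y\<bar> * \<bar>h\<bar> \<le> e * \<bar>h\<bar>" using u(1)[of y n] elim by (intro mult_right_mono) auto
        thus "norm (f' n y * h - D y * h) \<le> e * norm h" by (simp add: abs_mult flip: left_diff_distrib)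
      qed
    qed
  qed (use S lim in auto)
  then obtain g where g: "\<And>y. y \<in> S \<Longrightarrow> (\<lambda>n. f n y) \<longlonglongrightarrow> g y"
    "\<And>y. y \<in> S \<Longrightarrow> (g has_derivative (*) (D y)) (at y within S)" by blast
  have "g y = F y" if "y \<in> S" for y using g(1)[OF that] lim[OF that] LIMSEQ_unique by blast
  moreover have "(g has_real_derivative D x) (at x)"
    using g(2)[OF S(3)] at_within_open[OF S(3,1)] by (simp add: has_field_derivative_def)
  ultimately show ?thesis using S by (auto intro: has_field_derivative_transform_within_open)
qed

text \<open>The length bound keeps \<open>|x - y| \<le> pi\<close> for points of the interval, the
  range in which \<open>|t| / 2 \<le> |2 * sin (t / 2)|\<close>.\<close>

locale log_op_interval =
  fixes a b :: real
  assumes ab: "- pi < a" "a < b" "b < pi" "b - a \<le> pi"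
begin

lemma sub: "{a..b} \<subseteq> {-pi..pi}"
  using ab by auto

lemma reg_op_has_derivative:
  assumes "0 < e" "continuous_on {a..b} g"
  shows "((\<lambda>x. integral {a..b} (\<lambda>y. reg_ker e (x - y) * g y)) has_real_derivative
     integral {a..b} (\<lambda>y. reg_ker_deriv e (x - y) * g y)) (at x)"
  by (rule conv_integral_has_derivative[of UNIV _ _ _ _ _ UNIV])
     (use assms reg_ker_has_derivative reg_ker_deriv_continuous in auto)

lemma reg_op_tendsto:
  assumes "continuous_on {a..b} g" "x \<in> {a..b}"
  shows "(\<lambda>n. integral {a..b} (\<lambda>y. reg_ker (1 / (real n + 1)) (x - y) * g y)) \<longlonglongrightarrow> log_op a b g x"
proof -
  have "bounded (g ` {a..b})" using assms by (intro compact_imp_bounded compact_continuous_image) auto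
  then obtain M where M: "\<And>y. y \<in> {a..b} \<Longrightarrow> \<bar>g y\<bar> \<le> M" unfolding bounded_real by blast
  have "(\<lambda>n. integral {a..b} (\<lambda>y. reg_ker (1 / (real n + 1)) (x - y) * g y) - log_op a b g x) \<longlonglongrightarrow> 0"
  proof (rule Lim_null_comparison)
    show "\<forall>\<^sub>F n in sequentially. norm (integral {a..b} (\<lambda>y. reg_ker (1 / (real n + 1)) (x - y) * g y) - log_op a b g x)
       \<le> 12 * M * sqrt (b - a) * sqrt (1 / (real n + 1))"
      unfolding real_norm_def
      by (intro always_eventually allI reg_ker_op_close sub ab assms M) auto
    show "(\<lambda>n. 12 * M * sqrt (b - a) * sqrt (1 / (real n + 1))) \<longlonglongrightarrow> 0"
    proof -
      have "(\<lambda>n. sqrt (1 / (real n + 1))) \<longlonglongrightarrow> sqrt 0" by (intro tendsto_real_sqrt) real_asymp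
      from tendsto_mult_left[OF this, of "12 * M * sqrt (b - a)"] show ?thesis by simp
    qed
  qed
  thus ?thesis by (rule LIM_zero_cancel)
qed

text \<open>Moves the derivative from the kernel to the density. With the density 1 it also
  evaluates the integral of the kernel derivative.\<close>

lemma reg_deriv_by_parts:
  assumes e: "0 < e" and g: "\<And>y. y \<in> {a..b} \<Longrightarrow> (g has_real_derivative g' y) (at y within {a..b})"
    "continuous_on {a..b} g'"
  shows "integral {a..b} (\<lambda>y. reg_ker_deriv e (x - y) * g y) =
     integral {a..b} (\<lambda>y. reg_ker e (x - y) * g' y) + reg_ker e (x - a) * g a - reg_ker e (x - b) * g b"
proof -
  have cg: "continuous_on {a..b} g" using g(1) by (intro DERIV_continuous_on)
  have "((\<lambda>y. reg_ker e (x - y) * g' y - reg_ker_deriv e (x - y) * g y) has_integral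
     (reg_ker e (x - b) * g b - reg_ker e (x - a) * g a)) {a..b}"
  proof (rule fundamental_theorem_of_calculus)
    fix y assume y: "y \<in> {a..b}"
    have "((\<lambda>y. x - y) has_real_derivative - 1) (at y within {a..b})" by (auto intro!: derivative_eq_intros)
    from DERIV_chain2[OF reg_ker_has_derivative[OF e] this]
    have "((\<lambda>y. reg_ker e (x - y)) has_real_derivative reg_ker_deriv e (x - y) * - 1) (at y within {a..b})" .
    from DERIV_mult[OF this g(1)[OF y]]
    show "((\<lambda>y. reg_ker e (x - y) * g y) has_vector_derivative
        reg_ker e (x - y) * g' y - reg_ker_deriv e (x - y) * g y) (at y within {a..b})"
      by (simp add: has_real_derivative_iff_has_vector_derivative[symmetric] mult_ac)
  qed (use ab in auto)
  moreover have "integral {a..b} (\<lambda>y. reg_ker e (x - y) * g' y - reg_ker_deriv e (x - y) * g y) =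
     integral {a..b} (\<lambda>y. reg_ker e (x - y) * g' y) - integral {a..b} (\<lambda>y. reg_ker_deriv e (x - y) * g y)"
    by (intro Henstock_Kurzweil_Integration.integral_diff reg_ker_integrable e g cg)
  ultimately show ?thesis by (simp add: integral_unique)
qed

lemma boundary_close:
  assumes "0 < e" "0 < d" "y \<in> {a..b}" "x \<in> {a..b}" "d \<le> \<bar>x - y\<bar>"
  shows "\<bar>reg_ker e (x - y) - log_ker (x - y)\<bar> \<le> 3 * d powr - (1 / 2) * sqrt e"
proof -
  have "\<bar>reg_ker e (x - y) - log_ker (x - y)\<bar> \<le> 3 * sqrt e * \<bar>x - y\<bar> powr - (1 / 2)"
    using assms ab by (intro reg_ker_close) auto
  also have "\<dots> \<le> 3 * sqrt e * d powr - (1 / 2)" using assms by (intro mult_left_mono powr_mono2') auto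
  finally show ?thesis by (simp add: mult_ac)
qed

text \<open>By \<open>reg_deriv_by_parts\<close> the derivative of the regularised operator involves
  only \<open>reg_ker\<close>, so all its terms converge at rate \<open>sqrt e\<close>, locally
  uniformly.\<close>

lemma log_op_deriv_C1:
  assumes g: "\<And>y. y \<in> {a..b} \<Longrightarrow> (g has_real_derivative g' y) (at y within {a..b})"
    "continuous_on {a..b} g'" and x: "x \<in> {a<..<b}"
  shows "(log_op a b g has_real_derivative
     (log_op a b g' x + g a * log_ker (x - a) - g b * log_ker (x - b))) (at x)"
proof -
  \<comment> \<open>Points within \<open>d\<close> of \<open>x\<close> keep the distance
    \<open>d\<close> from both endpoints, where the boundary logarithms blow up.\<close>
  define d where "d = min ((x - a) / 2) ((b - x) / 2)"
  have d: "0 < d" "d \<le> (x - a) / 2" "d \<le> (b - x) / 2"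
    unfolding d_def by (use x in simp, rule min.cobounded1, rule min.cobounded2)
  define S where "S = {x - d<..<x + d}"
  have Sd: "y \<in> {a..b}" "d \<le> \<bar>y - a\<bar>" "d \<le> \<bar>y - b\<bar>" if "y \<in> S" for y
    using that d unfolding S_def by auto
  have cg: "continuous_on {a..b} g" using g(1) by (intro DERIV_continuous_on)
  have "bounded (g' ` {a..b})" using g(2) by (intro compact_imp_bounded compact_continuous_image) auto
  then obtain M where M: "\<And>y. y \<in> {a..b} \<Longrightarrow> \<bar>g' y\<bar> \<le> M" unfolding bounded_real by blast
  define B where "B = 3 * d powr - (1 / 2)"
  define K where "K = 12 * M * sqrt (b - a) + B * \<bar>g a\<bar> + B * \<bar>g b\<bar>"
  show ?thesis
  proof (rule derivative_of_limit[where S = S and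
      f = "\<lambda>n x. integral {a..b} (\<lambda>y. reg_ker (1 / (real n + 1)) (x - y) * g y)" and
      f' = "\<lambda>n x. integral {a..b} (\<lambda>y. reg_ker_deriv (1 / (real n + 1)) (x - y) * g y)" and
      \<eta> = "\<lambda>n. K * sqrt (1 / (real n + 1))"])
    show "open S" "convex S" "x \<in> S" using d by (auto simp: S_def)
    show "(\<lambda>n. K * sqrt (1 / (real n + 1))) \<longlonglongrightarrow> 0"
    proof -
      have "(\<lambda>n. sqrt (1 / (real n + 1))) \<longlonglongrightarrow> sqrt 0" by (intro tendsto_real_sqrt) real_asymp
      from tendsto_mult_left[OF this, of K] show ?thesis by simp
    qed
    fix n y assume y: "y \<in> S"
    show "((\<lambda>x. integral {a..b} (\<lambda>y. reg_ker (1 / (real n + 1)) (x - y) * g y)) has_real_derivative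
       integral {a..b} (\<lambda>z. reg_ker_deriv (1 / (real n + 1)) (y - z) * g z)) (at y)"
      by (rule reg_op_has_derivative[OF _ cg]) auto
    define e where "e = 1 / (real n + 1)"
    have e: "0 < e" by (simp add: e_def)
    define I where "I = integral {a..b} (\<lambda>z. reg_ker e (y - z) * g' z)"
    have 1: "\<bar>I - log_op a b g' y\<bar> \<le> 12 * M * sqrt (b - a) * sqrt e"
      unfolding I_def by (rule reg_ker_op_close[OF e sub ab(4) g(2) M Sd(1)[OF y]])
    have 2: "\<bar>(reg_ker e (y - a) - log_ker (y - a)) * g a\<bar> \<le> B * \<bar>g a\<bar> * sqrt e"
      using mult_right_mono[OF boundary_close[OF e d(1) _ Sd(1)[OF y] Sd(2)[OF y]], of "\<bar>g a\<bar>"] ab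
      by (simp add: abs_mult B_def mult_ac)
    have 3: "\<bar>(reg_ker e (y - b) - log_ker (y - b)) * g b\<bar> \<le> B * \<bar>g b\<bar> * sqrt e"
      using mult_right_mono[OF boundary_close[OF e d(1) _ Sd(1)[OF y] Sd(3)[OF y]], of "\<bar>g b\<bar>"] ab
      by (simp add: abs_mult B_def mult_ac)
    have "integral {a..b} (\<lambda>z. reg_ker_deriv e (y - z) * g z) - (log_op a b g' y + g a * log_ker (y - a) - g b * log_ker (y - b))
       = (I - log_op a b g' y) + (reg_ker e (y - a) - log_ker (y - a)) * g a - (reg_ker e (y - b) - log_ker (y - b)) * g b"
      using reg_deriv_by_parts[OF e g, of y] by (simp add: I_def algebra_simps)
    hence "\<bar>integral {a..b} (\<lambda>z. reg_ker_deriv e (y - z) * g z) - (log_op a b g' y + g a * log_ker (y - a) - g b * log_ker (y - b))\<bar>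
       \<le> 12 * M * sqrt (b - a) * sqrt e + B * \<bar>g a\<bar> * sqrt e + B * \<bar>g b\<bar> * sqrt e"
      using 1 2 3 by linarith
    also have "\<dots> = K * sqrt e" by (simp add: K_def algebra_simps)
    finally show "\<bar>integral {a..b} (\<lambda>z. reg_ker_deriv (1 / (real n + 1)) (y - z) * g z) -
       (log_op a b g' y + g a * log_ker (y - a) - g b * log_ker (y - b))\<bar> \<le> K * sqrt (1 / (real n + 1))"
      by (simp add: e_def)
  next
    fix y assume "y \<in> S"
    thus "(\<lambda>n. integral {a..b} (\<lambda>z. reg_ker (1 / (real n + 1)) (y - z) * g z)) \<longlonglongrightarrow> log_op a b g y"
      by (intro reg_op_tendsto cg Sd)
  qed
qed

text \<open>The kernel derivative has a non-integrable singularity of order \<open>1 / t\<close>.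
  Subtracting \<open>g x\<close> from the density makes it integrable by Hoelder continuity, and the
  constant \<open>g x\<close> contributes boundary logarithms only.\<close>

lemma log_op_deriv_hoelder:
  assumes C: "0 \<le> C" "\<And>y z. y \<in> {a..b} \<Longrightarrow> z \<in> {a..b} \<Longrightarrow> \<bar>g y - g z\<bar> \<le> C * sqrt \<bar>y - z\<bar>"
    and cg: "continuous_on {a..b} g"
  obtains D where "\<And>x. x \<in> {a<..<b} \<Longrightarrow> (log_op a b g has_real_derivative D x) (at x)"
    "continuous_on {a<..<b} D"
proof -
  define dk where "dk = (\<lambda>t. cos (t / 2) / (2 * sin (t / 2)) :: real)"
  define D where "D = (\<lambda>x. integral {a..b} (\<lambda>y. dk (x - y) * (g y - g x)) + g x * (log_ker (x - a) - log_ker (x - b)))"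
  define e where "e = (\<lambda>n::nat. 1 / (real n + 1))"
  define f' where "f' = (\<lambda>n x. integral {a..b} (\<lambda>y. reg_ker_deriv (e n) (x - y) * g y))"
  have e: "0 < e n" for n by (simp add: e_def)
  have elim: "e \<longlonglongrightarrow> 0" unfolding e_def by real_asymp
  have "bounded (g ` {a..b})" using cg by (intro compact_imp_bounded compact_continuous_image) auto
  then obtain M where M: "\<And>y. y \<in> {a..b} \<Longrightarrow> \<bar>g y\<bar> \<le> M" unfolding bounded_real by blast
  have M0: "0 \<le> M" using M[of a] ab by auto
  have xy: "\<bar>x - y\<bar> \<le> pi" if "x \<in> {a..b}" "y \<in> {a..b}" for x y using that ab by auto
  have gx: "continuous_on {a..b} (\<lambda>y. g y - g x)" for x by (intro continuous_intros cg)
  have bnd: "\<bar>reg_ker_deriv (e n) (x - y) * (g y - g x)\<bar> \<le> (2 * C) * \<bar>x - y\<bar> powr - (1 / 2)"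
    if "x \<in> {a..b}" "y \<in> {a..b}" for x y n
  proof (cases "x = y")
    case False
    have "\<bar>reg_ker_deriv (e n) (x - y)\<bar> * \<bar>g y - g x\<bar> \<le> (2 / \<bar>x - y\<bar>) * (C * sqrt \<bar>x - y\<bar>)"
      using C(2)[OF that] False xy[OF that] by (intro mult_mono reg_ker_deriv_bound) (auto simp: abs_minus_commute)
    also have "\<dots> = (2 * C) * (sqrt \<bar>x - y\<bar> / \<bar>x - y\<bar>)" by simp
    also have "sqrt \<bar>x - y\<bar> / \<bar>x - y\<bar> = 1 / sqrt \<bar>x - y\<bar>"
      by (simp add: sqrt_divide_self_eq inverse_eq_divide)
    also have "1 / sqrt \<bar>x - y\<bar> = \<bar>x - y\<bar> powr - (1 / 2)" unfolding powr_minus_divide by (subst powr_half_sqrt) auto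
    finally show ?thesis by (simp add: abs_mult)
  qed auto
  have close: "\<bar>(reg_ker_deriv (e n) (x - y) - dk (x - y)) * (g y - g x)\<bar> \<le> (3 * C * e n powr (1 / 4)) * \<bar>x - y\<bar> powr - (3 / 4)"
    if "x \<in> {a..b}" "y \<in> {a..b}" for x y n
  proof (cases "x = y")
    case False
    have "\<bar>reg_ker_deriv (e n) (x - y) - dk (x - y)\<bar> * \<bar>g y - g x\<bar>
      \<le> (3 * e n powr (1 / 4) * \<bar>x - y\<bar> powr - (5 / 4)) * (C * sqrt \<bar>x - y\<bar>)"
      unfolding dk_def using C(2)[OF that] False xy[OF that] e[of n]
      by (intro mult_mono reg_ker_deriv_close) (auto simp: abs_minus_commute)
    also have "\<dots> = (3 * C * e n powr (1 / 4)) * (\<bar>x - y\<bar> powr - (5 / 4) * \<bar>x - y\<bar> powr (1 / 2))"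
      by (simp add: powr_half_sqrt)
    also have "\<bar>x - y\<bar> powr - (5 / 4) * \<bar>x - y\<bar> powr (1 / 2) = \<bar>x - y\<bar> powr - (3 / 4)"
      using powr_add[of "\<bar>x - y\<bar>" "- (5 / 4)" "1 / 2"] by simp
    finally show ?thesis by (simp add: abs_mult)
  qed auto
  have elim4: "(\<lambda>n. e n powr (1 / 4)) \<longlonglongrightarrow> 0"
    unfolding e_def by real_asymp
  \<comment> \<open>Integrability of the limit comes from the regularised integrands, which have a
    common majorant. On the diagonal the factor \<open>g y - g x\<close> vanishes, so the value of
    \<open>dk\<close> at 0, a division by 0, is harmless.\<close>
  have di: "(\<lambda>y. dk (x - y) * (g y - g x)) integrable_on {a..b}" if x: "x \<in> {a..b}" for x
  proof (rule dominated_convergence(1)[where f = "\<lambda>n y. reg_ker_deriv (e n) (x - y) * (g y - g x)"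
        and h = "\<lambda>y. (2 * C) * \<bar>x - y\<bar> powr - (1 / 2)"])
    show "(\<lambda>y. (2 * C) * \<bar>x - y\<bar> powr - (1 / 2)) integrable_on {a..b}"
      using abs_powr_integrable_bound(1)[of "1/2" x a b] x by (intro integrable_on_mult_right) auto
    fix y assume y: "y \<in> {a..b}"
    have "(\<lambda>n. reg_ker_deriv (e n) (x - y) * (g y - g x) - dk (x - y) * (g y - g x)) \<longlonglongrightarrow> 0"
    proof (rule Lim_null_comparison)
      show "\<forall>\<^sub>F n in sequentially. norm (reg_ker_deriv (e n) (x - y) * (g y - g x) - dk (x - y) * (g y - g x))
         \<le> (3 * C * e n powr (1 / 4)) * \<bar>x - y\<bar> powr - (3 / 4)"
        using close[OF x y] by (simp add: left_diff_distrib)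
      have "(\<lambda>n. (3 * C * e n powr (1 / 4)) * \<bar>x - y\<bar> powr - (3 / 4)) \<longlonglongrightarrow> (3 * C * 0) * \<bar>x - y\<bar> powr - (3 / 4)"
        by (intro tendsto_intros elim4)
      thus "(\<lambda>n. (3 * C * e n powr (1 / 4)) * \<bar>x - y\<bar> powr - (3 / 4)) \<longlonglongrightarrow> 0" by simp
    qed
    thus "(\<lambda>n. reg_ker_deriv (e n) (x - y) * (g y - g x)) \<longlonglongrightarrow> dk (x - y) * (g y - g x)" by (rule LIM_zero_cancel)
  qed (use bnd[OF x] reg_ker_integrable(2)[OF e gx] in auto)
  have f'_eq: "f' n x = integral {a..b} (\<lambda>y. reg_ker_deriv (e n) (x - y) * (g y - g x)) + g x * (reg_ker (e n) (x - a) - reg_ker (e n) (x - b))" for n x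
  proof -
    have c1: "integral {a..b} (\<lambda>y. reg_ker_deriv (e n) (x - y) * 1) = reg_ker (e n) (x - a) - reg_ker (e n) (x - b)"
      using reg_deriv_by_parts[OF e, of "\<lambda>_. 1" "\<lambda>_. 0" n x] by simp
    have "((\<lambda>y. reg_ker_deriv (e n) (x - y) * (g y - g x) + g x * (reg_ker_deriv (e n) (x - y) * 1)) has_integral
      (integral {a..b} (\<lambda>y. reg_ker_deriv (e n) (x - y) * (g y - g x)) + g x * (reg_ker (e n) (x - a) - reg_ker (e n) (x - b)))) {a..b}"
      unfolding c1[symmetric]
      by (intro has_integral_add has_integral_mult_right integrable_integral reg_ker_integrable(2) e gx continuous_intros)
    thus ?thesis unfolding f'_def by (intro integral_unique) (simp add: algebra_simps)
  qed
  \<comment> \<open>24 is \<open>3 * 8\<close>, with \<open>8 = 2 / (1 - 3 / 4)\<close> from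
    \<open>abs_powr_integrable_bound\<close>.\<close>
  define L where "L = 24 * C * (b - a) powr (1 / 4)"
  have main: "(log_op a b g has_real_derivative D x) (at x) \<and> isCont D x" if x: "x \<in> {a<..<b}" for x
  proof -
    define d where "d = min ((x - a) / 2) ((b - x) / 2)"
    have d: "0 < d" "d \<le> (x - a) / 2" "d \<le> (b - x) / 2"
    unfolding d_def by (use x in simp, rule min.cobounded1, rule min.cobounded2)
    define S where "S = {x - d<..<x + d}"
    have Sd: "y \<in> {a..b}" "d \<le> \<bar>y - a\<bar>" "d \<le> \<bar>y - b\<bar>" if "y \<in> S" for y
      using that d unfolding S_def by auto
    have S: "open S" "convex S" "x \<in> S" using d by (auto simp: S_def)
    define B where "B = 3 * d powr - (1 / 2)"
    define \<eta> where "\<eta> = (\<lambda>n. L * e n powr (1 / 4) + 2 * M * B * sqrt (e n))"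
    have \<eta>: "\<eta> \<longlonglongrightarrow> 0"
    proof -
      have "(\<lambda>n. L * e n powr (1 / 4) + 2 * M * B * sqrt (e n)) \<longlonglongrightarrow> L * 0 + 2 * M * B * sqrt 0"
        by (intro tendsto_add tendsto_mult_left tendsto_real_sqrt elim4 elim)
      thus ?thesis unfolding \<eta>_def real_sqrt_zero mult_zero_right add_0_right .
    qed
    have unif: "\<bar>f' n y - D y\<bar> \<le> \<eta> n" if y: "y \<in> S" for n y
    proof -
      note yab = Sd(1)[OF y]
      define I where "I = integral {a..b} (\<lambda>z. (reg_ker_deriv (e n) (y - z) - dk (y - z)) * (g z - g y))"
      have "I = integral {a..b} (\<lambda>z. reg_ker_deriv (e n) (y - z) * (g z - g y)) - integral {a..b} (\<lambda>z. dk (y - z) * (g z - g y))"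
        unfolding I_def left_diff_distrib
        by (intro Henstock_Kurzweil_Integration.integral_diff reg_ker_integrable(2) e gx di yab)
      hence eq: "f' n y - D y = I + g y * (reg_ker (e n) (y - a) - log_ker (y - a)) - g y * (reg_ker (e n) (y - b) - log_ker (y - b))"
        unfolding f'_eq D_def by (simp add: algebra_simps)
      have "norm I \<le> integral {a..b} (\<lambda>z. (3 * C * e n powr (1 / 4)) * \<bar>y - z\<bar> powr - (3 / 4))"
        unfolding I_def
      proof (rule integral_norm_bound_integral)
        show "(\<lambda>z. (reg_ker_deriv (e n) (y - z) - dk (y - z)) * (g z - g y)) integrable_on {a..b}"
          unfolding left_diff_distrib by (intro integrable_diff reg_ker_integrable(2) e gx di yab)
        show "(\<lambda>z. (3 * C * e n powr (1 / 4)) * \<bar>y - z\<bar> powr - (3 / 4)) integrable_on {a..b}"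
          using abs_powr_integrable_bound(1)[of "3/4" y a b] yab by (intro integrable_on_mult_right) auto
      qed (use close[OF yab] in auto)
      also have "\<dots> = (3 * C * e n powr (1 / 4)) * integral {a..b} (\<lambda>z. \<bar>y - z\<bar> powr - (3 / 4))"
        by (rule Henstock_Kurzweil_Integration.integral_mult_right)
      also have "\<dots> \<le> (3 * C * e n powr (1 / 4)) * (8 * (b - a) powr (1 / 4))"
        using abs_powr_integrable_bound(2)[of "3/4" y a b] yab C(1) by (intro mult_left_mono) auto
      finally have 1: "\<bar>I\<bar> \<le> L * e n powr (1 / 4)" by (simp add: L_def mult_ac)
      have b: "\<bar>g y * q\<bar> \<le> M * B * sqrt (e n)" if "\<bar>q\<bar> \<le> B * sqrt (e n)" for q
        using mult_mono[OF M[OF yab] that] M0 by (simp add: abs_mult mult_ac)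
      have 2: "\<bar>g y * (reg_ker (e n) (y - a) - log_ker (y - a))\<bar> \<le> M * B * sqrt (e n)"
        unfolding B_def by (rule b[unfolded B_def], rule boundary_close[OF e d(1) _ yab Sd(2)[OF y]]) (use ab in auto)
      have 3: "\<bar>g y * (reg_ker (e n) (y - b) - log_ker (y - b))\<bar> \<le> M * B * sqrt (e n)"
        unfolding B_def by (rule b[unfolded B_def], rule boundary_close[OF e d(1) _ yab Sd(3)[OF y]]) (use ab in auto)
      show ?thesis using 1 2 3 unfolding eq \<eta>_def by linarith
    qed
    have "(log_op a b g has_real_derivative D x) (at x)"
    proof (rule derivative_of_limit[OF S, where f' = f' and \<eta> = \<eta> and
          f = "\<lambda>n x. integral {a..b} (\<lambda>y. reg_ker (e n) (x - y) * g y)"])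
      fix n y assume "y \<in> S"
      show "((\<lambda>x. integral {a..b} (\<lambda>y. reg_ker (e n) (x - y) * g y)) has_real_derivative f' n y) (at y)"
        unfolding f'_def by (rule reg_op_has_derivative[OF e cg])
    next
      fix y assume "y \<in> S"
      thus "(\<lambda>n. integral {a..b} (\<lambda>z. reg_ker (e n) (y - z) * g z)) \<longlonglongrightarrow> log_op a b g y"
        unfolding e_def by (intro reg_op_tendsto cg Sd)
    qed (use unif \<eta> in auto)
    moreover have "continuous_on S D"
    proof (rule uniform_limit_theorem[where F = sequentially])
      have "continuous_on S (f' n)" for n
        using integral_continuous_on_param[OF conv_integrand_continuous[OF reg_ker_deriv_continuous[OF e[of n], of UNIV] cg, of S]]
        unfolding f'_def by simp
      thus "\<forall>\<^sub>F n in sequentially. continuous_on S (f' n)" by simp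
      show "uniform_limit S f' D sequentially"
      proof (rule uniform_limitI)
        fix r :: real assume "0 < r"
        hence "\<forall>\<^sub>F n in sequentially. \<eta> n < r" using \<eta> by (intro order_tendstoD) auto
        thus "\<forall>\<^sub>F n in sequentially. \<forall>y\<in>S. dist (f' n y) (D y) < r"
        proof eventually_elim
          case (elim n)
          thus ?case using unif[of _ n] by (auto simp: dist_real_def intro: le_less_trans)
        qed
      qed
    qed auto
    hence "isCont D x" using S continuous_on_eq_continuous_at by blast
    ultimately show ?thesis by blast
  qed
  show ?thesis
    by (rule that[of D]) (use main in \<open>auto intro: continuous_at_imp_continuous_on\<close>)
qed

text \<open>A merely continuous density gains half a derivative because translations of the
  logarithm are Hoelder continuous in the mean (\<open>log_ker_L1_modulus\<close>).\<close>

lemma log_op_hoelder: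
  assumes "continuous_on {a..b} g"
  shows "local_hoelder_half S (log_op a b g)"
proof -
  have "bounded (g ` {a..b})" using assms by (intro compact_imp_bounded compact_continuous_image) auto
  then obtain M where M: "\<And>y. y \<in> {a..b} \<Longrightarrow> \<bar>g y\<bar> \<le> M" unfolding bounded_real by blast
  have M0: "0 \<le> M" using M[of a] ab by auto
  obtain C where C: "0 \<le> C"
    "\<And>x y. integral {-pi..pi} (\<lambda>z. \<bar>log_ker (x - z) - log_ker (y - z)\<bar>) \<le> C * \<bar>x - y\<bar> powr (1 / 2)"
    using log_ker_L1_modulus[of "1 / 2"] by auto
  have key: "\<bar>log_op a b g x - log_op a b g y\<bar> \<le> (M * C) * sqrt \<bar>x - y\<bar>" for x y
  proof -
    have il: "(\<lambda>z. \<bar>log_ker (x - z) - log_ker (y - z)\<bar>) integrable_on {a..b}"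
      by (rule integrable_subinterval_real[OF log_ker_shift_diff_integrable sub])
    have "log_op a b g x - log_op a b g y = integral {a..b} (\<lambda>z. (log_ker (x - z) - log_ker (y - z)) * g z)"
      unfolding log_op_def left_diff_distrib
      by (intro Henstock_Kurzweil_Integration.integral_diff[symmetric] log_op_integrable sub assms)
    moreover have "norm (integral {a..b} (\<lambda>z. (log_ker (x - z) - log_ker (y - z)) * g z)) \<le>
       integral {a..b} (\<lambda>z. M * \<bar>log_ker (x - z) - log_ker (y - z)\<bar>)"
    proof (rule integral_norm_bound_integral)
      show "(\<lambda>z. (log_ker (x - z) - log_ker (y - z)) * g z) integrable_on {a..b}"
        unfolding left_diff_distrib by (intro integrable_diff log_op_integrable sub assms)
      show "(\<lambda>z. M * \<bar>log_ker (x - z) - log_ker (y - z)\<bar>) integrable_on {a..b}"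
        by (intro integrable_on_mult_right il)
      fix z assume "z \<in> {a..b}"
      from mult_right_mono[OF M[OF this], of "\<bar>log_ker (x - z) - log_ker (y - z)\<bar>"]
      show "norm ((log_ker (x - z) - log_ker (y - z)) * g z) \<le> M * \<bar>log_ker (x - z) - log_ker (y - z)\<bar>"
        by (simp add: abs_mult mult.commute)
    qed
    moreover have "integral {a..b} (\<lambda>z. M * \<bar>log_ker (x - z) - log_ker (y - z)\<bar>) = M * integral {a..b} (\<lambda>z. \<bar>log_ker (x - z) - log_ker (y - z)\<bar>)"
      by (rule Henstock_Kurzweil_Integration.integral_mult_right)
    moreover have "integral {a..b} (\<lambda>z. \<bar>log_ker (x - z) - log_ker (y - z)\<bar>) \<le> integral {-pi..pi} (\<lambda>z. \<bar>log_ker (x - z) - log_ker (y - z)\<bar>)"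
      by (intro integral_subset_le sub il log_ker_shift_diff_integrable) auto
    hence "M * integral {a..b} (\<lambda>z. \<bar>log_ker (x - z) - log_ker (y - z)\<bar>) \<le> M * (C * \<bar>x - y\<bar> powr (1 / 2))"
      using C(2)[of x y] M0 by (intro mult_left_mono) auto
    ultimately show ?thesis by (simp add: powr_half_sqrt mult.assoc)
  qed
  thus ?thesis unfolding local_hoelder_half_def by blast
qed

lemma boundary_smooth:
  "smooth_fun {a<..<b} (\<lambda>x. p * log_ker (x - a) - q * log_ker (x - b))"
proof -
  have l: "smooth_fun {0<..<2 * pi} log_ker" "smooth_fun {- 2 * pi<..<0} log_ker"
    by (rule smooth_log_ker, subst sin_half_eq_0_iff; force)+
  show ?thesis unfolding smooth_fun_def
  proof (intro allI cont.order_diff cont.order_cmult)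
    fix k
    show "diff_order continuous_on k {a<..<b} (\<lambda>x. log_ker (x - a))"
    proof (rule diff_order_translate)
      show "diff_order continuous_on k {0<..<2 * pi} log_ker" using l(1) unfolding smooth_fun_def by blast
    qed (use ab in auto)
    show "diff_order continuous_on k {a<..<b} (\<lambda>x. log_ker (x - b))"
    proof (rule diff_order_translate)
      show "diff_order continuous_on k {- 2 * pi<..<0} log_ker" using l(2) unfolding smooth_fun_def by blast
    qed (use ab in auto)
  qed
qed

text \<open>Induction on \<open>k\<close>: by \<open>log_op_deriv_C1\<close> the derivative is the
  same operator applied to \<open>g'\<close> plus boundary terms, which are smooth inside the
  interval.\<close>

lemma log_op_gain_hoelder:
  assumes "open S" "{a..b} \<subseteq> S" "diff_order continuous_on k S g"
  shows "diff_order local_hoelder_half k {a<..<b} (log_op a b g)"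
  using assms(3)
proof (induction k arbitrary: g)
  case 0
  hence "continuous_on {a..b} g" using assms(2) continuous_on_subset by auto
  thus ?case by (simp add: log_op_hoelder)
next
  case (Suc k)
  then obtain g' where g': "\<forall>x\<in>S. (g has_real_derivative g' x) (at x)" "diff_order continuous_on k S g'" by auto
  have "continuous_on S g'" using g'(2)
  proof (induction k arbitrary: g')
    case (Suc n) thus ?case by (metis cont.order_Suc)
  qed simp
  hence cg': "continuous_on {a..b} g'" using assms(2) continuous_on_subset by auto
  have dg: "(g has_real_derivative g' y) (at y within {a..b})" if "y \<in> {a..b}" for y
    using g'(1) subsetD[OF assms(2) that] by (auto intro: has_field_derivative_at_within)
  have "diff_order local_hoelder_half k {a<..<b} (\<lambda>x. log_op a b g' x + (g a * log_ker (x - a) - g b * log_ker (x - b)))"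
    by (intro hoelder.order_add Suc.IH[OF g'(2)] smooth_fun_hoelder boundary_smooth)
  hence o: "diff_order local_hoelder_half k {a<..<b} (\<lambda>x. log_op a b g' x + g a * log_ker (x - a) - g b * log_ker (x - b))"
    by (simp add: algebra_simps)
  show ?case by (rule diff_order_SucI[OF log_op_deriv_C1[OF dg cg'] o])
qed

text \<open>The base case is \<open>log_op_deriv_hoelder\<close>; the induction step goes through
  \<open>log_op_deriv_C1\<close> again.\<close>

lemma log_op_gain_derivative:
  assumes "open S" "{a..b} \<subseteq> S" "diff_order local_hoelder_half k S g"
  shows "diff_order continuous_on (Suc k) {a<..<b} (log_op a b g)"
  using assms(3)
proof (induction k arbitrary: g)
  case 0
  hence h: "local_hoelder_half S g" by simp
  obtain C M where C: "0 \<le> C" "\<And>x y. x \<in> {a..b} \<Longrightarrow> y \<in> {a..b} \<Longrightarrow> \<bar>g x - g y\<bar> \<le> C * sqrt \<bar>x - y\<bar>"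
    using hoelder_half_bound[OF h assms(2)] by metis
  obtain D where D: "\<And>x. x \<in> {a<..<b} \<Longrightarrow> (log_op a b g has_real_derivative D x) (at x)"
    "continuous_on {a<..<b} D"
    using log_op_deriv_hoelder[OF C local_hoelder_half_continuous[OF h assms(2)]] by metis
  show ?case by (rule diff_order_SucI[OF D(1)]) (use D(2) in auto)
next
  case (Suc k)
  then obtain g' where g': "\<forall>x\<in>S. (g has_real_derivative g' x) (at x)" "diff_order local_hoelder_half k S g'" by auto
  have "local_hoelder_half S g'" using g'(2)
  proof (induction k arbitrary: g')
    case (Suc n) thus ?case by (metis hoelder.order_Suc)
  qed simp
  hence cg': "continuous_on {a..b} g'" using assms(2) local_hoelder_half_continuous by blast
  have dg: "(g has_real_derivative g' y) (at y within {a..b})" if "y \<in> {a..b}" for y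
    using g'(1) subsetD[OF assms(2) that] by (auto intro: has_field_derivative_at_within)
  have "diff_order continuous_on (Suc k) {a<..<b} (\<lambda>x. log_op a b g' x + (g a * log_ker (x - a) - g b * log_ker (x - b)))"
    using boundary_smooth unfolding smooth_fun_def by (intro cont.order_add Suc.IH[OF g'(2)]) blast
  hence o: "diff_order continuous_on (Suc k) {a<..<b} (\<lambda>x. log_op a b g' x + g a * log_ker (x - a) - g b * log_ker (x - b))"
    by (simp only: add_diff_eq)
  show ?case by (rule diff_order_SucI[OF log_op_deriv_C1[OF dg cg'] o])
qed

end

section \<open>Inversion of F and bootstrapping\<close>

context regularity_class
begin

text \<open>Where \<open>u > 0\<close>, the factorisation of differences of \<open>crest_F\<close>
  by the positive \<open>q\<close> turns difference quotients of \<open>F (u)\<close> into those of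
  \<open>u\<close>. The derivative of \<open>u\<close> is that of \<open>F (u)\<close> divided by
  \<open>q (u x) (u x)\<close>, where \<open>q v v\<close> is the derivative of
  \<open>crest_F c\<close> at \<open>v\<close>. Passing from \<open>F (u)\<close> to
  \<open>u\<close> at order 0 depends on the class and is the hypothesis
  \<open>base\<close>.\<close>

lemma order_of_crest_F:
  assumes "0 \<le> c" and S: "open S" and cont: "continuous_on S u" and pos: "\<And>x. x \<in> S \<Longrightarrow> 0 < u x"
    and base: "P S (\<lambda>x. crest_F c (u x)) \<Longrightarrow> P S u"
  shows "diff_order P k S (\<lambda>x. crest_F c (u x)) \<Longrightarrow> diff_order P k S u"
proof (induction k)
  case 0
  thus ?case using base by simp
next
  case (Suc k)
  define q where "q = (\<lambda>v w. sqrt 3 * c / 2 * (v + w) + (v * v + v * w + w * w) / 2)"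
  have qpos: "0 < q v w" if "0 < v" "0 < w" for v w
    unfolding q_def using that assms(1) by (intro add_nonneg_pos divide_pos_pos add_pos_pos mult_nonneg_nonneg mult_pos_pos) auto
  have fac: "crest_F c v - crest_F c w = (v - w) * q v w" for v w
    by (simp add: crest_F_def q_def power2_eq_square field_simps)
  have qq: "q v v = sqrt 3 * c * v + 3 / 2 * (v * v)" for v by (simp add: q_def)
  from Suc.prems obtain G where G: "\<forall>x\<in>S. ((\<lambda>x. crest_F c (u x)) has_real_derivative G x) (at x)" "diff_order P k S G"
    by auto
  have u: "diff_order P k S u" by (rule Suc.IH[OF order_Suc[OF Suc.prems]])
  have d: "(u has_real_derivative G x * inverse (q (u x) (u x))) (at x)" if x: "x \<in> S" for x
  proof -
    have ux: "u \<midarrow>x\<rightarrow> u x"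
      using cont S x by (simp add: continuous_on_eq_continuous_at isCont_def)
    have lim: "((\<lambda>y. (crest_F c (u y) - crest_F c (u x)) / (y - x) * inverse (q (u y) (u x))) \<longlongrightarrow> G x * inverse (q (u x) (u x))) (at x)"
    proof (intro tendsto_mult tendsto_inverse)
      show "((\<lambda>y. (crest_F c (u y) - crest_F c (u x)) / (y - x)) \<longlongrightarrow> G x) (at x)"
        using G(1) x by (simp add: has_field_derivative_iff)
      show "((\<lambda>y. q (u y) (u x)) \<longlongrightarrow> q (u x) (u x)) (at x)"
        unfolding q_def by (intro tendsto_intros ux) auto
      show "q (u x) (u x) \<noteq> 0" using qpos[OF pos[OF x] pos[OF x]] by simp
    qed
    have "\<forall>\<^sub>F y in at x. y \<in> S" using S x by (simp add: eventually_at_in_open')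
    hence "\<forall>\<^sub>F y in at x. (crest_F c (u y) - crest_F c (u x)) / (y - x) * inverse (q (u y) (u x)) = (u y - u x) / (y - x)"
    proof eventually_elim
      case (elim y)
      have "v * Q / d * inverse Q = v / d" if "Q \<noteq> 0" for v Q d :: real
        by (cases "d = 0") (use that in \<open>auto simp: field_simps\<close>)
      moreover have "q (u y) (u x) \<noteq> 0" using qpos[OF pos[OF elim] pos[OF x]] by simp
      ultimately show ?case unfolding fac by blast
    qed
    from Lim_transform_eventually[OF lim this] show ?thesis by (simp add: has_field_derivative_iff)
  qed
  have "diff_order P k S (\<lambda>x. sqrt 3 * c * u x + 3 / 2 * (u x * u x))"
    by (intro order_add order_cmult order_mult u)
  hence "diff_order P k S (\<lambda>x. q (u x) (u x))" by (simp add: qq)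
  hence "diff_order P k S (\<lambda>x. inverse (q (u x) (u x)))"
    by (rule order_inverse) (use qpos pos in force)
  hence "diff_order P k S (\<lambda>x. G x * inverse (q (u x) (u x)))" by (rule order_mult[OF G(2)])
  with d show ?case by (rule diff_order_SucI)
qed

end

text \<open>On a compact interval \<open>u \<ge> m > 0\<close>, and the cubic part of
  \<open>crest_F\<close> alone makes the factor \<open>q\<close> at least
  \<open>3 / 2 * (m * m)\<close>.\<close>

lemma crest_F_inverse_hoelder:
  assumes "0 \<le> c" and cont: "continuous_on S u" and pos: "\<And>x. x \<in> S \<Longrightarrow> 0 < u x"
    and F: "local_hoelder_half S (\<lambda>x. crest_F c (u x))"
  shows "local_hoelder_half S u"
  unfolding local_hoelder_half_def
proof (intro allI impI)
  fix a b assume ab: "{a..b} \<subseteq> S"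
  obtain C where C: "\<forall>x\<in>{a..b}. \<forall>y\<in>{a..b}. \<bar>crest_F c (u x) - crest_F c (u y)\<bar> \<le> C * sqrt \<bar>x - y\<bar>"
    using F ab unfolding local_hoelder_half_def by blast
  show "\<exists>C. \<forall>x\<in>{a..b}. \<forall>y\<in>{a..b}. \<bar>u x - u y\<bar> \<le> C * sqrt \<bar>x - y\<bar>"
  proof (cases "a \<le> b")
    case True
    have "continuous_on {a..b} u" using cont ab continuous_on_subset by blast
    then obtain z where z: "z \<in> {a..b}" "\<And>y. y \<in> {a..b} \<Longrightarrow> u z \<le> u y"
      using continuous_attains_inf[of "{a..b}" u] True by auto
    define m where "m = u z"
    have m: "0 < m" "\<And>y. y \<in> {a..b} \<Longrightarrow> m \<le> u y" using pos z ab by (auto simp: m_def)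
    define r where "r = 3 / 2 * (m * m)"
    have r0: "0 < r" using m by (simp add: r_def)
    have "\<bar>u x - u y\<bar> \<le> (C / r) * sqrt \<bar>x - y\<bar>" if xy: "x \<in> {a..b}" "y \<in> {a..b}" for x y
    proof -
      define q where "q = sqrt 3 * c / 2 * (u x + u y) + (u x * u x + u x * u y + u y * u y) / 2"
      have mm: "m * m \<le> u x * u x" "m * m \<le> u x * u y" "m * m \<le> u y * u y"
        using m xy by (auto intro!: mult_mono order.trans[OF less_imp_le[OF m(1)]])
      have "0 \<le> sqrt 3 * c / 2 * (u x + u y)" using assms(1) m(2)[OF xy(1)] m(2)[OF xy(2)] m(1) by (intro mult_nonneg_nonneg) auto
      moreover have "3 / 2 * k \<le> X + (p + v + w) / 2" if "0 \<le> X" "k \<le> p" "k \<le> v" "k \<le> w" for k X p v w :: real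
        using that by (simp add: field_simps)
      ultimately have qr: "r \<le> q" using mm unfolding q_def r_def by blast
      have "crest_F c (u x) - crest_F c (u y) = (u x - u y) * q"
        by (simp add: crest_F_def q_def power2_eq_square field_simps)
      moreover have "\<bar>crest_F c (u x) - crest_F c (u y)\<bar> \<le> C * sqrt \<bar>x - y\<bar>" using C xy by blast
      moreover have "\<bar>q\<bar> = q" using qr r0 by simp
      ultimately have "\<bar>u x - u y\<bar> * q \<le> C * sqrt \<bar>x - y\<bar>" by (simp add: abs_mult)
      moreover have "\<bar>u x - u y\<bar> * r \<le> \<bar>u x - u y\<bar> * q" using qr by (intro mult_left_mono) auto
      ultimately have "\<bar>u x - u y\<bar> * r \<le> C * sqrt \<bar>x - y\<bar>" by linarith
      thus ?thesis using r0 by (simp add: field_simps)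
    qed
    thus ?thesis by blast
  qed auto
qed

context crest
begin

text \<open>Away from the diagonal the kernel is smooth, so locally only the logarithmic part over a small
  interval around the point is singular.\<close>

lemma F_u_local:
  assumes "- pi < a" "a < b" "b < 0"
  obtains H where "smooth_fun {a<..<b} H"
    "\<And>x. x \<in> {a<..<b} \<Longrightarrow> crest_F c (u x) = H x - 1 / pi * log_op a b u x"
proof
  define H1 where "H1 = (\<lambda>x. integral {-pi..a} (\<lambda>y. K_ker (x - y) * u y))"
  define H2 where "H2 = (\<lambda>x. integral {b..pi} (\<lambda>y. K_ker (x - y) * u y))"
  define H3 where "H3 = (\<lambda>x. integral {a..b} (\<lambda>y. smooth_ker (x - y) * u y))"
  define r where "r = circ_conv K_ker u 0"
  define H where "H = (\<lambda>x. (H1 x + H2 x) + H3 x - r)"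
  have s1: "smooth_fun {a<..<b} H1" unfolding H1_def
  proof (rule conv_integral_smooth[where V = "{0<..<2 * pi}"])
    show "smooth_fun {0<..<2 * pi} K_ker"
      by (rule smooth_K_ker, subst sin_half_eq_0_iff) auto
  qed (use assms in \<open>auto intro: u_cont\<close>)
  have s2: "smooth_fun {a<..<b} H2" unfolding H2_def
  proof (rule conv_integral_smooth[where V = "{- 2 * pi<..<0}"])
    show "smooth_fun {- 2 * pi<..<0} K_ker"
      by (rule smooth_K_ker, subst sin_half_eq_0_iff) auto
  qed (use assms in \<open>auto intro: u_cont\<close>)
  have s3: "smooth_fun {a<..<b} H3" unfolding H3_def
    by (rule conv_integral_smooth[where V = UNIV]) (auto intro: smooth_smooth_ker u_cont)
  show "smooth_fun {a<..<b} H"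
    using s1 s2 s3 unfolding H_def smooth_fun_def
    by (intro allI cont.order_diff cont.order_add cont.order_const) auto
  fix x assume x: "x \<in> {a<..<b}"
  define f where "f = (\<lambda>y. K_ker (x - y) * u y)"
  have fi: "f integrable_on {-pi..pi}"
    using circ_conv_integrable[OF K_ker_periodic K_ker_absolutely_integrable u_cont, of x]
    unfolding absolutely_integrable_on_def f_def by blast
  have sub: "{a..b} \<subseteq> {-pi..pi}" using assms by auto
  have li: "(\<lambda>y. log_ker (x - y) * u y) integrable_on {a..b}" by (intro log_op_integrable sub u_cont)
  have si: "(\<lambda>y. smooth_ker (x - y) * u y) integrable_on {a..b}"
    by (intro integrable_continuous_interval continuous_on_mult u_cont
        continuous_on_compose2[OF smooth_ker_continuous[of UNIV]] continuous_intros) auto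
  have "circ_conv K_ker u x = integral {-pi..a} f + integral {a..pi} f"
    unfolding circ_conv_def f_def[symmetric]
    using assms fi by (intro Henstock_Kurzweil_Integration.integral_combine[symmetric]) auto
  also have "integral {a..pi} f = integral {a..b} f + integral {b..pi} f"
    using assms integrable_subinterval_real[OF fi, of a pi]
    by (intro Henstock_Kurzweil_Integration.integral_combine[symmetric]) auto
  also have "integral {a..b} f = H3 x - 1 / pi * log_op a b u x"
  proof -
    have "((\<lambda>y. smooth_ker (x - y) * u y - 1 / pi * (log_ker (x - y) * u y)) has_integral (H3 x - 1 / pi * log_op a b u x)) {a..b}"
      unfolding H3_def log_op_def by (intro has_integral_diff has_integral_mult_right integrable_integral li si)
    thus ?thesis unfolding f_def K_ker_def by (intro integral_unique) (simp add: left_diff_distrib)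
  qed
  finally have "circ_conv K_ker u x = H1 x + H2 x + H3 x - 1 / pi * log_op a b u x"
    by (simp add: H1_def H2_def f_def)
  thus "crest_F c (u x) = H x - 1 / pi * log_op a b u x"
    using F_u_diff[of x 0 0] by (simp add: H_def r_def)
qed

text \<open>One induction step makes two gains, from \<open>C^k\<close> to \<open>C^(k,1/2)\<close>
  and from there to \<open>C^(k+1)\<close>, each through \<open>F_u_local\<close> on a smaller
  interval. The endpoints are therefore generalised in the induction.\<close>

lemma u_diff_order:
  assumes nc: "\<not> \<phi> constant_on UNIV"
  shows "- pi < a \<Longrightarrow> a < b \<Longrightarrow> b < 0 \<Longrightarrow> diff_order continuous_on k {a<..<b} u"
proof (induction k arbitrary: a b)
  case 0
  show ?case by (simp add: u_cont)
next
  case (Suc k)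
  have pos: "0 < u x" if "- pi < x" "x < 0" for x
    using u_strict_mono[OF nc, of 0 "- x"] that by (simp add: u_even)
  have conv: "diff_order P k {a<..<b} (\<lambda>x. crest_F c (u x))"
    if P: "regularity_class P" and ab: "- pi < a" "a < b" "b < 0"
      and sm: "\<And>H. smooth_fun {a<..<b} H \<Longrightarrow> diff_order P k {a<..<b} H"
      and l: "diff_order P k {a<..<b} (log_op a b u)" for P k a b
  proof -
    interpret regularity_class P by (rule P)
    obtain H where H: "smooth_fun {a<..<b} H"
      "\<And>x. x \<in> {a<..<b} \<Longrightarrow> crest_F c (u x) = H x - 1 / pi * log_op a b u x"
      using F_u_local[OF ab] by blast
    have "diff_order P k {a<..<b} (\<lambda>x. H x - 1 / pi * log_op a b u x)"
      by (intro order_diff order_cmult sm H l)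
    thus ?thesis by (rule order_cong[rotated 2]) (use H(2) in auto)
  qed
  \<comment> \<open>Nested intervals inside \<open>{-pi<..<0}\<close>: the induction hypothesis is
    used on \<open>{a1<..<b1}\<close>, the first gain holds on \<open>{a2<..<b2}\<close>, the second
    on \<open>{a<..<b}\<close>.\<close>
  define a1 where "a1 = (a - pi) / 2"
  define b1 where "b1 = b / 2"
  define a2 where "a2 = (a1 + a) / 2"
  define b2 where "b2 = (b1 + b) / 2"
  have ord: "- pi < a1" "a1 < a2" "a2 < a" "b < b2" "b2 < b1" "b1 < 0" "a < b"
    using Suc.prems by (auto simp: a1_def b1_def a2_def b2_def field_simps)
  interpret outer: log_op_interval a2 b2 by unfold_locales (use ord in auto)
  interpret inner: log_op_interval a b by unfold_locales (use ord in auto)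
  have "diff_order continuous_on k {a1<..<b1} u" using ord by (intro Suc.IH) auto
  hence l1: "diff_order local_hoelder_half k {a2<..<b2} (log_op a2 b2 u)"
    using ord by (intro outer.log_op_gain_hoelder[of "{a1<..<b1}"]) auto
  have "diff_order local_hoelder_half k {a2<..<b2} (\<lambda>x. crest_F c (u x))"
    by (rule conv[OF hoelder.regularity_class_axioms _ _ _ smooth_fun_hoelder l1]) (use ord in auto)
  hence "diff_order local_hoelder_half k {a2<..<b2} u"
    using ord by (rule_tac hoelder.order_of_crest_F[OF c_nonneg])
      (auto intro!: u_cont pos crest_F_inverse_hoelder[OF c_nonneg])
  hence l2: "diff_order continuous_on (Suc k) {a<..<b} (log_op a b u)"
    using ord by (intro inner.log_op_gain_derivative[of "{a2<..<b2}"]) auto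
  have "diff_order continuous_on (Suc k) {a<..<b} (\<lambda>x. crest_F c (u x))"
  proof (rule conv[OF cont.regularity_class_axioms _ _ _ _ l2])
    show "diff_order continuous_on (Suc k) {a<..<b} H" if "smooth_fun {a<..<b} H" for H
      using that unfolding smooth_fun_def by blast
  qed (use ord in auto)
  thus ?case
    by (rule cont.order_of_crest_F[OF c_nonneg, rotated -1]) (use ord in \<open>auto intro!: u_cont pos\<close>)
qed

lemma phi_smooth:
  assumes "\<not> \<phi> constant_on UNIV"
  shows "smooth_on_open {-pi<..<0} \<phi>"
  unfolding smooth_on_open_def
proof (intro allI ballI)
  fix k and x :: real assume x: "x \<in> {-pi<..<0}"
  define a where "a = (x - pi) / 2"
  define b where "b = x / 2"
  have ab: "- pi < a" "a < x" "x < b" "b < 0" using x by (auto simp: a_def b_def)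
  have "diff_order continuous_on (Suc k) {a<..<b} (\<lambda>x. gamma_crit c - u x)"
    using ab by (intro cont.order_diff cont.order_const u_diff_order assms) auto
  moreover have "(\<lambda>x. gamma_crit c - u x) = \<phi>" by (auto simp: u_def)
  ultimately have "diff_order continuous_on (Suc k) {a<..<b} \<phi>" by simp
  thus "((deriv ^^ k) \<phi>) field_differentiable (at x)"
    using ab by (intro diff_order_deriv_iterate[of "{a<..<b}"]) auto
qed

lemma phi_strict_mono:
  assumes "\<not> \<phi> constant_on UNIV"
  shows "strict_mono_on {-pi<..<0} \<phi>"
proof (rule strict_mono_onI)
  fix x y :: real assume "x \<in> {-pi<..<0}" "y \<in> {-pi<..<0}" "x < y"
  hence "u (- y) < u (- x)" by (intro u_strict_mono[OF assms]) auto
  thus "\<phi> x < \<phi> y" by (simp add: u_def even)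
qed

end

section \<open>Uniform bound on the Hoelder seminorm, and conclusion\<close>

lemma hoelder_norm_le:
  assumes "\<And>x y. \<bar>f x - f y\<bar> \<le> M * \<bar>x - y\<bar> powr \<alpha>"
  shows "hoelder_norm \<alpha> f \<le> ereal M"
  unfolding hoelder_norm_def
proof (rule SUP_least, clarify)
  fix x y :: real assume "x \<noteq> y"
  thus "ereal (\<bar>f x - f y\<bar> / \<bar>x - y\<bar> powr \<alpha>) \<le> ereal M"
    using assms[of x y] by (simp add: divide_le_eq)
qed

text \<open>Hoelder continuity with the largest exponent \<open>\<beta>\<close> of \<open>A\<close> gives all smaller ones for
  \<open>|x - y| \<le> 1\<close>; for larger distances the bound on the oscillation suffices.\<close>

lemma crest_hoelder_norm_uniform:
  assumes A: "compact A" "A \<subseteq> {0<..<1}" and I: "compact I" "I \<subseteq> {0<..}"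
  shows "\<exists>M::real. \<forall>\<alpha>\<in>A. \<forall>c\<in>I. \<forall>\<phi>. crest_solution c \<phi> \<longrightarrow> hoelder_norm \<alpha> \<phi> \<le> ereal M"
proof (cases "A = {} \<or> I = {}")
  case False
  obtain \<beta> where \<beta>: "\<beta> \<in> A" "\<And>\<alpha>. \<alpha> \<in> A \<Longrightarrow> \<alpha> \<le> \<beta>"
    using compact_attains_sup[OF A(1)] False by blast
  obtain c1 where c1: "c1 \<in> I" "\<And>c. c \<in> I \<Longrightarrow> c1 \<le> c" using compact_attains_inf[OF I(1)] False by blast
  obtain c2 where c2: "c2 \<in> I" "\<And>c. c \<in> I \<Longrightarrow> c \<le> c2" using compact_attains_sup[OF I(1)] False by blast
  have \<beta>01: "0 < \<beta>" "\<beta> < 1" using \<beta>(1) A(2) by auto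
  have c10: "0 < c1" using c1(1) I(2) by auto
  obtain C where C: "0 \<le> C"
    "\<And>c \<phi> x y. crest c \<phi> \<Longrightarrow> c \<in> {c1..c2} \<Longrightarrow> \<not> \<phi> constant_on UNIV \<Longrightarrow> 0 \<le> x \<Longrightarrow> x < y \<Longrightarrow> y \<le> pi \<Longrightarrow>
       crest.u c \<phi> y - crest.u c \<phi> x \<le> C * (y - x) powr \<beta>"
    using crest_u_hoelder[OF c10 \<beta>01, of c2] by blast
  define M where "M = max C (\<bar>c2\<bar> + 2)"
  have M0: "0 \<le> M" using C by (simp add: M_def)
  show ?thesis
  proof (intro exI[of _ M] ballI allI impI)
    fix \<alpha> c \<phi> assume \<alpha>: "\<alpha> \<in> A" and cI: "c \<in> I" and sol: "crest_solution c \<phi>"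
    have \<alpha>b: "0 < \<alpha>" "\<alpha> \<le> \<beta>" using \<alpha> \<beta>(2) A(2) by auto
    have c: "c \<in> {c1..c2}" using c1 c2 cI by auto
    interpret crest c \<phi> using cI I(2) sol by unfold_locales auto
    show "hoelder_norm \<alpha> \<phi> \<le> ereal M"
    proof (rule hoelder_norm_le)
      fix x y
      show "\<bar>\<phi> x - \<phi> y\<bar> \<le> M * \<bar>x - y\<bar> powr \<alpha>"
      proof (cases "\<phi> constant_on UNIV")
        \<comment> \<open>Constant profiles are separated because the linear lower bound behind
          \<open>C\<close> fails for them.\<close>
        case True
        hence "\<phi> x = \<phi> y" by (auto simp: constant_on_def)
        thus ?thesis using M0 by simp
      next
        case nc: False
        show ?thesis
        proof (cases "\<bar>x - y\<bar> \<le> 1")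
          case True
          have "\<bar>\<phi> x - \<phi> y\<bar> \<le> C * \<bar>x - y\<bar> powr \<beta>"
            using C \<beta>01 by (intro phi_hoelder_global C(2)[OF crest_axioms c nc]) auto
          also have "\<dots> \<le> M * \<bar>x - y\<bar> powr \<alpha>"
            using True \<alpha>b C by (intro mult_mono powr_mono') (auto simp: M_def)
          finally show ?thesis .
        next
          case False
          have "\<bar>\<phi> x - \<phi> y\<bar> = \<bar>u x - u y\<bar>" by (simp add: u_def)
          also have "\<dots> \<le> c + 2" using u_nonneg[of x] u_nonneg[of y] u_le[of x] u_le[of y] by linarith
          also have "\<dots> \<le> M * 1" using c by (auto simp: M_def)
          also have "\<dots> \<le> M * \<bar>x - y\<bar> powr \<alpha>"
            using False \<alpha>b M0 by (intro mult_left_mono ge_one_powr_ge_zero) auto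
          finally show ?thesis .
        qed
      qed
    qed
  qed
qed auto

theorem theorem4p4:
  fixes c :: real and \<phi> :: "real \<Rightarrow> real"
  assumes "c \<ge> 0"
    and "crest_solution c \<phi>"
  shows
    "(\<not> \<phi> constant_on UNIV \<longrightarrow>
        smooth_on_open {-pi<..<0} \<phi> \<and> strict_mono_on {-pi<..<0} \<phi>)
     \<and> (\<forall>\<alpha>\<in>{0<..<1}. \<phi> \<in> hoelder_space \<alpha>)
     \<and> (\<forall>A J. compact A \<and> A \<subseteq> {0<..<1} \<and> compact J \<and> J \<subseteq> {0<..} \<longrightarrow>
          (\<exists>M::real. \<forall>\<alpha>\<in>A. \<forall>c'\<in>J. \<forall>\<psi>. crest_solution c' \<psi> \<longrightarrow> hoelder_norm \<alpha> \<psi> \<le> ereal M))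
     \<and> (\<not> \<phi> constant_on UNIV \<longrightarrow>
          (\<exists>C\<ge>1. \<exists>\<delta>>0. \<forall>x. 0 < \<bar>x\<bar> \<and> \<bar>x\<bar> < \<delta> \<longrightarrow>
             \<bar>x * ln \<bar>x\<bar>\<bar> / C \<le> gamma_crit c - \<phi> x \<and>
             gamma_crit c - \<phi> x \<le> C * \<bar>x * ln \<bar>x\<bar>\<bar>))"
proof -
  interpret crest c \<phi> using assms by unfold_locales
  have cpos: "0 < c" if "\<not> \<phi> constant_on UNIV"
    using constant_if_c_0 that c_nonneg by (cases "c = 0") auto
  have "\<phi> \<in> hoelder_space \<alpha>" if \<alpha>: "\<alpha> \<in> {0<..<1}" for \<alpha>
  \<comment> \<open>At \<open>c = 0\<close> the uniform bound does not apply, but there every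
    solution is constant and has seminorm 0.\<close>
  proof (cases "\<phi> constant_on UNIV")
    case True
    hence "\<phi> x = \<phi> y" for x y by (auto simp: constant_on_def)
    hence "\<bar>\<phi> x - \<phi> y\<bar> \<le> 0 * \<bar>x - y\<bar> powr \<alpha>" for x y by simp
    hence "hoelder_norm \<alpha> \<phi> \<le> ereal 0" by (rule hoelder_norm_le)
    thus ?thesis using per by (auto simp: hoelder_space_def)
  next
    case False
    obtain M where "hoelder_norm \<alpha> \<phi> \<le> ereal M"
      using crest_hoelder_norm_uniform[of "{\<alpha>}" "{c}"] \<alpha> cpos[OF False] sol by auto
    hence "hoelder_norm \<alpha> \<phi> < \<infinity>" by (rule le_less_trans) simp
    thus ?thesis using per by (simp add: hoelder_space_def)
  qed
  thus ?thesis
    using phi_smooth phi_strict_mono crest_hoelder_norm_uniform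
      crest_log_estimate[OF crest_axioms cpos] by blast
qed

end
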